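(* Let $(M,g)$ be a compact oriented non-trapping Riemannian surface with strictly convex boundary. Let $(x,v)\in\partial_+SM$ and $t\in(0,\tau(x,v))$, and let $\eta=\eta_{x,v,t}\in T^*_{(x,v)}(\partial_+SM)$ be the covector uniquely defined by $$\eta(V)=b(x,v,t),\qquad \eta(H)=-\mu(x,v)\,a(x,v,t).$$ Then, in fan-beam coordinates $(s,\alpha)$ on $\partial_+SM$, one has $\eta=\eta_s\,ds+\eta_\alpha\,d\alpha$ with $$\eta_\alpha=b(x,v,t),\qquad \eta_s=\mathrm{II}(s)\,b(x,v,t)-\mu(x,v)\,a(x,v,t).$$
   Context: $SM$ is the unit tangent bundle, $\pi:SM\to M$ the projection, $\varphi_t(x,v)=(\gamma_{x,v}(t),\dot\gamma_{x,v}(t))$ the geodesic flow, and $\tau(x,v)\ge 0$ the first exit time of the geodesic $\gamma_{x,v}$ starting from $(x,v)$; non-trapping means that $\tau$ is finite everywhere. Strictly convex boundary means that the second fundamental form $\mathrm{II}$ of $\partial M$ (with respect to the inward normal) is strictly positive. $\nu_x$ is the unit inward normal at $x\in\partial M$, and $\partial_\pm SM=\{(x,v)\in SM: x\in\partial M,\ \pm g(v,\nu_x)\ge 0\}$. For $v\in T_xM$, $v_\perp$ denotes the rotation of $v$ by $+\pi/2$. $X$ is the generator of the geodesic flow, $V$ is the generator of the (counterclockwise) rotation action on the circle fibers of $SM$, and $X_\perp=[X,V]$. On $\partial SM$, $\mu(x,v)=g(v,\nu_x)$, $\mu_\perp=V\mu=g(v_\perp,\nu_x)$, and $H=\mu_\perp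 X+\mu X_\perp$, which is the horizontal lift of the oriented unit tangent vector to $\partial M$, namely the rotation of $\nu_x$ by $-\pi/2$. $(V,H)$ is a basis of $T_{(x,v)}(\partial_+SM)$. The scalar Jacobi functions $a(x,v,t)$, $b(x,v,t)$ are the solutions of $\ddot a+\kappa(\gamma_{x,v}(t))a=0$, $\ddot b+\kappa(\gamma_{x,v}(t))b=0$ (dots denote $d/dt$, $\kappa$ is the Gauss curvature) with $a(x,v,0)=1$, $\dot a(x,v,0)=0$, $b(x,v,0)=0$, $\dot b(x,v,0)=1$. Fan-beam coordinates: $\partial M$ is parameterized by $g$-arclength, $\partial M=\{\Gamma(s): s\in[0,L]\}$ with $\Gamma$ $L$-periodic and $\dot\Gamma$ the oriented unit tangent vector (the rotation of $\nu$ by $-\pi/2$). The point $(x,v)\in\partial_+SM$ has coordinates $(s,\alpha)$, $\alpha\in[-\pi/2,\pi/2]$, if $x=\Gamma(s)$ and $v=\cos\alpha\,\nu_{\Gamma(s)}-\sin\alpha\,\dot\Gamma(s)$ (so $\mu=\cos\alpha$, $V=\partial_\alpha$). $\mathrm{II}(s)$ is the second fundamental form at $\Gamma(s)$, i.e. $\mathrm{II}(s)=-\partial_\rho w(0,s)$ when the metric is written $d\rho^2+e^{2w(\rho,s)}ds^2$ in boundary normal coordinates $(\rho,s)$, with $\rho$ the distance to the boundary and $w(0,s)=0$. *)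

theory Defs
  imports "HOL-Analysis.Analysis"
begin

section \<open>Smooth maps on open and relatively open sets\<close>

primrec Ck_on :: "nat \<Rightarrow> 'a::euclidean_space set \<Rightarrow> ('a \<Rightarrow> 'b::real_normed_vector) \<Rightarrow> bool" where
  "Ck_on 0 S f = continuous_on S f"
| "Ck_on (Suc k) S f =
    (f differentiable_on S \<and> (\<forall>i\<in>Basis. Ck_on k S (\<lambda>x. frechet_derivative f (at x) i)))"

text \<open>
  \<open>Ck_on\<close> is used on open sets only. On an arbitrary set (in practice a relatively open
  subset of the half plane) smoothness means local extendability to a smooth map on an open set.
\<close>

definition smooth_on :: "'a::euclidean_space set \<Rightarrow> ('a \<Rightarrow> 'b::real_normed_vector) \<Rightarrow> bool" where
  "smooth_on S f \<longleftrightarrow>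
    (\<forall>x\<in>S. \<exists>N h. open N \<and> x \<in> N \<and> (\<forall>k. Ck_on k N h) \<and> (\<forall>y\<in>N \<inter> S. h y = f y))"


section \<open>Oriented Riemannian surfaces with boundary\<close>

type_synonym 'a chart = "'a set \<times> ('a \<Rightarrow> real^2)"

text \<open>
  The metric is given by its component matrix in every chart, as a function of the chart coordinates.
\<close>

record 'a surface =
  points :: "'a topology"
  atlas :: "'a chart set"
  metric :: "'a chart \<Rightarrow> real^2 \<Rightarrow> real^2^2"

definition half_plane :: "(real^2) set" where
  "half_plane = {y. 0 \<le> y $ 2}"

abbreviation chart_image :: "'a chart \<Rightarrow> (real^2) set" where
  "chart_image c \<equiv> snd c ` fst c"

definition is_chart :: "'a topology \<Rightarrow> 'a chart \<Rightarrow> bool" where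
  "is_chart T c \<longleftrightarrow>
    openin T (fst c) \<and> openin (top_of_set half_plane) (chart_image c) \<and>
    homeomorphic_map (subtopology T (fst c)) (top_of_set (chart_image c)) (snd c)"

definition overlap :: "'a chart \<Rightarrow> 'a chart \<Rightarrow> (real^2) set" where
  "overlap c c' = snd c ` (fst c \<inter> fst c')"

definition transition :: "'a chart \<Rightarrow> 'a chart \<Rightarrow> real^2 \<Rightarrow> real^2" where
  "transition c c' y = snd c' (inv_into (fst c) (snd c) y)"

definition d_transition :: "'a chart \<Rightarrow> 'a chart \<Rightarrow> real^2 \<Rightarrow> real^2 \<Rightarrow> real^2" where
  "d_transition c c' y = frechet_derivative (transition c c') (at y within overlap c c')"

definition oriented_surface :: "'a surface \<Rightarrow> bool" where
  "oriented_surface M \<longleftrightarrow>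
    Hausdorff_space (points M) \<and> second_countable (points M) \<and>
    (\<forall>c\<in>atlas M. is_chart (points M) c) \<and>
    topspace (points M) = (\<Union>c\<in>atlas M. fst c) \<and>
    (\<forall>c\<in>atlas M. \<forall>c'\<in>atlas M.
       smooth_on (overlap c c') (transition c c') \<and>
       (\<forall>y\<in>overlap c c'. 0 < det (matrix (d_transition c c' y))))"

text \<open>The bilinear form with matrix \<open>A\<close>.\<close>

definition bform :: "real^2^2 \<Rightarrow> real^2 \<Rightarrow> real^2 \<Rightarrow> real" where
  "bform A u w = u \<bullet> (A *v w)"

definition riemannian_metric :: "'a surface \<Rightarrow> bool" where
  "riemannian_metric M \<longleftrightarrow>
    (\<forall>c\<in>atlas M.
       smooth_on (chart_image c) (metric M c) \<and>
       (\<forall>y\<in>chart_image c. transpose (metric M c y) = metric M c y \<and>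
          (\<forall>w. w \<noteq> 0 \<longrightarrow> 0 < bform (metric M c y) w w))) \<and>
    (\<forall>c\<in>atlas M. \<forall>c'\<in>atlas M. \<forall>y\<in>overlap c c'. \<forall>u w.
       bform (metric M c y) u w =
       bform (metric M c' (transition c c' y)) (d_transition c c' y u) (d_transition c c' y w))"

definition oriented_riemannian_surface :: "'a surface \<Rightarrow> bool" where
  "oriented_riemannian_surface M \<longleftrightarrow> oriented_surface M \<and> riemannian_metric M"

definition charts_at :: "'a surface \<Rightarrow> 'a \<Rightarrow> 'a chart set" where
  "charts_at M x = {c \<in> atlas M. x \<in> fst c}"

definition boundary :: "'a surface \<Rightarrow> 'a set" where
  "boundary M = {x. \<exists>c\<in>charts_at M x. snd c x $ 2 = 0}"

text \<open>
  A tangent vector at \<open>x\<close> is a family of coordinate vectors, one for each chart around \<open>x\<close>,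
  related by the differentials of the transition maps, and \<open>0\<close> by convention at all other charts.
\<close>

type_synonym 'a tvec = "'a chart \<Rightarrow> real^2"

definition tangent_space :: "'a surface \<Rightarrow> 'a \<Rightarrow> 'a tvec set" where
  "tangent_space M x =
    {v. (\<forall>c\<in>charts_at M x. \<forall>c'\<in>charts_at M x. v c' = d_transition c c' (snd c x) (v c)) \<and>
        (\<forall>c. c \<notin> charts_at M x \<longrightarrow> v c = 0)}"

text \<open>
  Scalars computed in a chart are turned into chart independent ones by taking the common value
  of the expression in all charts around the point.
\<close>

definition chart_value :: "'a surface \<Rightarrow> 'a \<Rightarrow> ('a chart \<Rightarrow> real) \<Rightarrow> real" where
  "chart_value M x f = (THE r. \<forall>c\<in>charts_at M x. f c = r)"

definition inner_g :: "'a surface \<Rightarrow> 'a \<Rightarrow> 'a tvec \<Rightarrow> 'a tvec \<Rightarrow> real" where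
  "inner_g M x u w = chart_value M x (\<lambda>c. bform (metric M c (snd c x)) (u c) (w c))"

definition boundary_tangent_space :: "'a surface \<Rightarrow> 'a \<Rightarrow> 'a tvec set" where
  "boundary_tangent_space M x = {u \<in> tangent_space M x. \<forall>c\<in>charts_at M x. u c $ 2 = 0}"

definition inward_normal :: "'a surface \<Rightarrow> 'a \<Rightarrow> 'a tvec" where
  "inward_normal M x = (THE n. n \<in> tangent_space M x \<and> inner_g M x n n = 1 \<and>
     (\<forall>u\<in>boundary_tangent_space M x. inner_g M x n u = 0) \<and>
     (\<forall>c\<in>charts_at M x. 0 < n c $ 2))"

text \<open>
  Rotation by \<open>+\<pi>/2\<close> for the inner product with matrix \<open>A\<close> and the standard orientation; see
  \<open>rot_coord\<close> below.
\<close>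

definition rot_coord :: "real^2^2 \<Rightarrow> real^2 \<Rightarrow> real^2" where
  "rot_coord A w = (1 / sqrt (det A)) *\<^sub>R vector [- ((A *v w) $ 2), (A *v w) $ 1]"

definition perp :: "'a surface \<Rightarrow> 'a \<Rightarrow> 'a tvec \<Rightarrow> 'a tvec" where
  "perp M x v = (\<lambda>c. if c \<in> charts_at M x then rot_coord (metric M c (snd c x)) (v c) else 0)"


section \<open>Connection and curvature\<close>

text \<open>
  \<open>S\<close> is the coordinate domain and \<open>G\<close> the matrix of the metric on it. Derivatives are taken
  within \<open>S\<close>, so that they are one-sided at boundary points.
\<close>

definition pd :: "(real^2) set \<Rightarrow> 2 \<Rightarrow> (real^2 \<Rightarrow> real) \<Rightarrow> real^2 \<Rightarrow> real" where
  "pd S i f y = frechet_derivative f (at y within S) (axis i 1)"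

definition christoffel ::
    "(real^2) set \<Rightarrow> (real^2 \<Rightarrow> real^2^2) \<Rightarrow> 2 \<Rightarrow> 2 \<Rightarrow> 2 \<Rightarrow> real^2 \<Rightarrow> real" where
  "christoffel S G k i j y =
    (1/2) * (\<Sum>l\<in>UNIV. matrix_inv (G y) $ k $ l *
      (pd S i (\<lambda>z. G z $ j $ l) y + pd S j (\<lambda>z. G z $ i $ l) y - pd S l (\<lambda>z. G z $ i $ j) y))"

definition christoffel_vec ::
    "(real^2) set \<Rightarrow> (real^2 \<Rightarrow> real^2^2) \<Rightarrow> real^2 \<Rightarrow> real^2 \<Rightarrow> real^2 \<Rightarrow> real^2" where
  "christoffel_vec S G y u w =
    (\<chi> k. \<Sum>i\<in>UNIV. \<Sum>j\<in>UNIV. christoffel S G k i j y * u $ i * w $ j)"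

text \<open>The component along \<open>\<partial>\<^sub>l\<close> of \<open>R(\<partial>\<^sub>i, \<partial>\<^sub>j)\<partial>\<^sub>k\<close>, where \<open>R(X,Y) = [\<nabla>\<^sub>X, \<nabla>\<^sub>Y] - \<nabla>\<^bsub>[X,Y]\<^esub>\<close>.\<close>

definition riemann ::
    "(real^2) set \<Rightarrow> (real^2 \<Rightarrow> real^2^2) \<Rightarrow> 2 \<Rightarrow> 2 \<Rightarrow> 2 \<Rightarrow> 2 \<Rightarrow> real^2 \<Rightarrow> real" where
  "riemann S G l k i j y =
    pd S i (christoffel S G l j k) y - pd S j (christoffel S G l i k) y +
    (\<Sum>m\<in>UNIV. christoffel S G l i m y * christoffel S G m j k y -
               christoffel S G l j m y * christoffel S G m i k y)"

text \<open>\<open>g(R(\<partial>\<^sub>1, \<partial>\<^sub>2)\<partial>\<^sub>2, \<partial>\<^sub>1) / det g\<close>\<close>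

definition gauss_curvature :: "'a surface \<Rightarrow> 'a \<Rightarrow> real" where
  "gauss_curvature M x = chart_value M x (\<lambda>c.
     (\<Sum>l\<in>UNIV. metric M c (snd c x) $ 1 $ l *
        riemann (chart_image c) (metric M c) l 2 1 2 (snd c x)) / det (metric M c (snd c x)))"

text \<open>
  The second fundamental form \<open>II(u, w) = g(\<nabla>\<^sub>u W, \<nu>)\<close>, where \<open>W\<close> is any extension of \<open>w\<close> to a
  field tangent to the boundary. As the boundary is \<open>{y. y $ 2 = 0}\<close> in every chart, \<open>W\<close> may be
  taken with constant components, and then \<open>\<nabla>\<^sub>u W\<close> consists of the Christoffel term only.
\<close>

definition second_ff :: "'a surface \<Rightarrow> 'a \<Rightarrow> 'a tvec \<Rightarrow> 'a tvec \<Rightarrow> real" where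
  "second_ff M x u w = chart_value M x (\<lambda>c.
     bform (metric M c (snd c x))
       (christoffel_vec (chart_image c) (metric M c) (snd c x) (u c) (w c))
       (inward_normal M x c))"

definition strictly_convex_boundary :: "'a surface \<Rightarrow> bool" where
  "strictly_convex_boundary M \<longleftrightarrow>
    (\<forall>x\<in>boundary M. \<forall>u\<in>boundary_tangent_space M x. u \<noteq> (\<lambda>c. 0) \<longrightarrow> 0 < second_ff M x u u)"


section \<open>Unit tangent bundle, geodesics and scalar Jacobi functions\<close>

definition SM :: "'a surface \<Rightarrow> ('a \<times> 'a tvec) set" where
  "SM M = {(x, v). x \<in> topspace (points M) \<and> v \<in> tangent_space M x \<and> inner_g M x v v = 1}"

definition boundary_SM :: "'a surface \<Rightarrow> ('a \<times> 'a tvec) set" where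
  "boundary_SM M = {p \<in> SM M. fst p \<in> boundary M}"

definition mu :: "'a surface \<Rightarrow> 'a \<times> 'a tvec \<Rightarrow> real" where
  "mu M p = inner_g M (fst p) (snd p) (inward_normal M (fst p))"

definition mu_perp :: "'a surface \<Rightarrow> 'a \<times> 'a tvec \<Rightarrow> real" where
  "mu_perp M p = inner_g M (fst p) (perp M (fst p) (snd p)) (inward_normal M (fst p))"

definition inward_SM :: "'a surface \<Rightarrow> ('a \<times> 'a tvec) set" where
  "inward_SM M = {p \<in> boundary_SM M. 0 \<le> mu M p}"

text \<open>Coordinates on the tangent bundle induced by a chart.\<close>

definition tcoord :: "'a chart \<Rightarrow> 'a \<times> 'a tvec \<Rightarrow> (real^2) \<times> (real^2)" where
  "tcoord c p = (snd c (fst p), snd p c)"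

text \<open>The generator of the geodesic flow in these coordinates.\<close>

definition X_coord ::
    "'a surface \<Rightarrow> 'a chart \<Rightarrow> (real^2) \<times> (real^2) \<Rightarrow> (real^2) \<times> (real^2)" where
  "X_coord M c q = (snd q, - christoffel_vec (chart_image c) (metric M c) (fst q) (snd q) (snd q))"

text \<open>
  \<open>z = (\<gamma>, \<gamma>')\<close> where \<open>\<gamma> : [0, T] \<rightarrow> M\<close> is the unit speed geodesic with initial data \<open>p\<close>.
\<close>

definition geodesic_lift ::
    "'a surface \<Rightarrow> 'a \<times> 'a tvec \<Rightarrow> real \<Rightarrow> (real \<Rightarrow> 'a \<times> 'a tvec) \<Rightarrow> bool" where
  "geodesic_lift M p T z \<longleftrightarrow>
    z 0 = p \<and> (\<forall>u\<in>{0..T}. z u \<in> SM M) \<and>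
    continuous_map (top_of_set {0..T}) (points M) (fst \<circ> z) \<and>
    (\<forall>u\<in>{0..T}. \<forall>c\<in>charts_at M (fst (z u)).
       ((\<lambda>r. tcoord c (z r)) has_vector_derivative X_coord M c (tcoord c (z u)))
         (at u within {0..T}))"

text \<open>
  The geodesic from \<open>p\<close> leaves \<open>M\<close> at the supremum of the times up to which it exists in \<open>M\<close>.
\<close>

definition exit_time :: "'a surface \<Rightarrow> 'a \<times> 'a tvec \<Rightarrow> ereal" where
  "exit_time M p = (SUP T\<in>{T. 0 \<le> T \<and> (\<exists>z. geodesic_lift M p T z)}. ereal T)"

definition non_trapping :: "'a surface \<Rightarrow> bool" where
  "non_trapping M \<longleftrightarrow> (\<forall>p\<in>SM M. exit_time M p < \<infinity>)"

text \<open>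
  The value at time \<open>t\<close> of the solution of \<open>f'' + \<kappa>(\<gamma>) f = 0\<close>, \<open>f 0 = f0\<close>, \<open>f' 0 = f1\<close> along the
  geodesic \<open>\<gamma>\<close> with initial data \<open>p\<close>.
\<close>

definition jacobi_solution ::
    "'a surface \<Rightarrow> real \<Rightarrow> real \<Rightarrow> 'a \<times> 'a tvec \<Rightarrow> real \<Rightarrow> real" where
  "jacobi_solution M f0 f1 p t = (THE r. \<exists>z f f'. geodesic_lift M p t z \<and>
     (\<forall>u\<in>{0..t}. (f has_real_derivative f' u) (at u within {0..t}) \<and>
        (f' has_real_derivative - gauss_curvature M (fst (z u)) * f u) (at u within {0..t})) \<and>
     f 0 = f0 \<and> f' 0 = f1 \<and> f t = r)"

definition jacobi_a :: "'a surface \<Rightarrow> 'a \<times> 'a tvec \<Rightarrow> real \<Rightarrow> real" where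
  "jacobi_a M = jacobi_solution M 1 0"

definition jacobi_b :: "'a surface \<Rightarrow> 'a \<times> 'a tvec \<Rightarrow> real \<Rightarrow> real" where
  "jacobi_b M = jacobi_solution M 0 1"


section \<open>Tangent vectors and vector fields on the unit tangent bundle\<close>

text \<open>
  Tangent vectors of the tangent bundle are again families indexed by the charts of \<open>M\<close>, through
  the induced coordinates \<open>tcoord\<close>.
\<close>

type_synonym 'a ttvec = "'a chart \<Rightarrow> (real^2) \<times> (real^2)"

definition velocity ::
    "'a surface \<Rightarrow> (real \<Rightarrow> 'a \<times> 'a tvec) \<Rightarrow> real \<Rightarrow> 'a ttvec" where
  "velocity M z u = (\<lambda>c. if c \<in> charts_at M (fst (z u))
     then vector_derivative (\<lambda>r. tcoord c (z r)) (at u) else 0)"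

definition differentiable_curve ::
    "'a surface \<Rightarrow> real set \<Rightarrow> (real \<Rightarrow> 'a \<times> 'a tvec) \<Rightarrow> bool" where
  "differentiable_curve M I z \<longleftrightarrow>
    continuous_map (top_of_set I) (points M) (fst \<circ> z) \<and>
    (\<forall>u\<in>I. \<forall>c\<in>charts_at M (fst (z u)). (\<lambda>r. tcoord c (z r)) differentiable (at u))"

text \<open>
  The tangent space at \<open>p\<close> of \<open>\<partial>SM\<close>. For \<open>p\<close> in \<open>\<partial>\<^sub>+SM\<close> this is also the tangent
  space of \<open>\<partial>\<^sub>+SM\<close>, a submanifold with boundary of \<open>\<partial>SM\<close> of the same dimension.
\<close>

definition tangent_boundary_SM ::
    "'a surface \<Rightarrow> 'a \<times> 'a tvec \<Rightarrow> 'a ttvec set" where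
  "tangent_boundary_SM M p = {\<xi>. \<exists>e z. 0 < e \<and> differentiable_curve M {-e<..<e} z \<and>
     (\<forall>u\<in>{-e<..<e}. z u \<in> boundary_SM M) \<and> z 0 = p \<and> \<xi> = velocity M z 0}"

definition covector :: "'a ttvec set \<Rightarrow> ('a ttvec \<Rightarrow> real) \<Rightarrow> bool" where
  "covector T \<eta> \<longleftrightarrow> (\<forall>\<xi>\<in>T. \<forall>\<zeta>\<in>T. \<forall>r q.
     \<eta> (\<lambda>c. r *\<^sub>R \<xi> c + q *\<^sub>R \<zeta> c) = r * \<eta> \<xi> + q * \<eta> \<zeta>)"

text \<open>
  The derivative at \<open>\<theta> = 0\<close> of the rotation action \<open>w \<mapsto> cos \<theta> w + sin \<theta> w\<^sub>\<perp>\<close>, in coordinates.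
\<close>

definition V_coord ::
    "'a surface \<Rightarrow> 'a chart \<Rightarrow> (real^2) \<times> (real^2) \<Rightarrow> (real^2) \<times> (real^2)" where
  "V_coord M c q = (0, rot_coord (metric M c (fst q)) (snd q))"

text \<open>\<open>[A, B] f = A (B f) - B (A f)\<close>\<close>

definition lie_bracket ::
    "'c::real_normed_vector set \<Rightarrow> ('c \<Rightarrow> 'c) \<Rightarrow> ('c \<Rightarrow> 'c) \<Rightarrow> 'c \<Rightarrow> 'c" where
  "lie_bracket D A B q =
    frechet_derivative B (at q within D) (A q) - frechet_derivative A (at q within D) (B q)"

text \<open>
  \<open>X_coord\<close> and \<open>V_coord\<close> are defined on the whole tangent bundle and are tangent to \<open>SM\<close>, so that
  their bracket on the tangent bundle restricts to the bracket of their restrictions to \<open>SM\<close>.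
\<close>

definition X_perp_coord ::
    "'a surface \<Rightarrow> 'a chart \<Rightarrow> (real^2) \<times> (real^2) \<Rightarrow> (real^2) \<times> (real^2)" where
  "X_perp_coord M c = lie_bracket (chart_image c \<times> UNIV) (X_coord M c) (V_coord M c)"

definition field_at :: "'a surface \<Rightarrow>
    ('a chart \<Rightarrow> (real^2) \<times> (real^2) \<Rightarrow> (real^2) \<times> (real^2)) \<Rightarrow> 'a \<times> 'a tvec \<Rightarrow> 'a ttvec" where
  "field_at M F p = (\<lambda>c. if c \<in> charts_at M (fst p) then F c (tcoord c p) else 0)"

definition X_field :: "'a surface \<Rightarrow> 'a \<times> 'a tvec \<Rightarrow> 'a ttvec" where
  "X_field M = field_at M (X_coord M)"

definition V_field :: "'a surface \<Rightarrow> 'a \<times> 'a tvec \<Rightarrow> 'a ttvec" where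
  "V_field M = field_at M (V_coord M)"

definition X_perp_field :: "'a surface \<Rightarrow> 'a \<times> 'a tvec \<Rightarrow> 'a ttvec" where
  "X_perp_field M = field_at M (X_perp_coord M)"

definition H_field :: "'a surface \<Rightarrow> 'a \<times> 'a tvec \<Rightarrow> 'a ttvec" where
  "H_field M p = (\<lambda>c. mu_perp M p *\<^sub>R X_field M p c + mu M p *\<^sub>R X_perp_field M p c)"


section \<open>Fan-beam coordinates\<close>

definition curve_velocity :: "'a surface \<Rightarrow> (real \<Rightarrow> 'a) \<Rightarrow> real \<Rightarrow> 'a tvec" where
  "curve_velocity M \<Gamma> s = (\<lambda>c. if c \<in> charts_at M (\<Gamma> s)
     then vector_derivative (\<lambda>r. snd c (\<Gamma> r)) (at s) else 0)"

text \<open>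
  As \<open>\<nu>\<close> is a unit vector, the last condition also says that \<open>s\<close> is arclength.
\<close>

definition boundary_arclength_param ::
    "'a surface \<Rightarrow> (real \<Rightarrow> 'a) \<Rightarrow> real \<Rightarrow> bool" where
  "boundary_arclength_param M \<Gamma> L \<longleftrightarrow>
    0 < L \<and> (\<forall>s. \<Gamma> (s + L) = \<Gamma> s) \<and> \<Gamma> ` {0..L} = boundary M \<and> inj_on \<Gamma> {0..<L} \<and>
    continuous_map euclideanreal (points M) \<Gamma> \<and>
    (\<forall>c\<in>atlas M. smooth_on {s. \<Gamma> s \<in> fst c} (\<lambda>s. snd c (\<Gamma> s))) \<and>
    (\<forall>s. curve_velocity M \<Gamma> s = (\<lambda>c. - perp M (\<Gamma> s) (inward_normal M (\<Gamma> s)) c))"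

definition fan_beam ::
    "'a surface \<Rightarrow> (real \<Rightarrow> 'a) \<Rightarrow> real \<Rightarrow> real \<Rightarrow> 'a \<times> 'a tvec" where
  "fan_beam M \<Gamma> s \<alpha> =
    (\<Gamma> s, \<lambda>c. cos \<alpha> *\<^sub>R inward_normal M (\<Gamma> s) c - sin \<alpha> *\<^sub>R curve_velocity M \<Gamma> s c)"

text \<open>The coordinate vectors \<open>\<partial>\<^sub>s\<close>, \<open>\<partial>\<^sub>\<alpha>\<close> and the coordinates of a vector in this basis.\<close>

definition fan_s :: "'a surface \<Rightarrow> (real \<Rightarrow> 'a) \<Rightarrow> real \<Rightarrow> real \<Rightarrow> 'a ttvec" where
  "fan_s M \<Gamma> s \<alpha> = velocity M (\<lambda>r. fan_beam M \<Gamma> r \<alpha>) s"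

definition fan_alpha :: "'a surface \<Rightarrow> (real \<Rightarrow> 'a) \<Rightarrow> real \<Rightarrow> real \<Rightarrow> 'a ttvec" where
  "fan_alpha M \<Gamma> s \<alpha> = velocity M (\<lambda>r. fan_beam M \<Gamma> s r) \<alpha>"

definition fan_components ::
    "'a surface \<Rightarrow> (real \<Rightarrow> 'a) \<Rightarrow> real \<Rightarrow> real \<Rightarrow> 'a ttvec \<Rightarrow> real \<times> real" where
  "fan_components M \<Gamma> s \<alpha> \<xi> =
    (THE q. \<xi> = (\<lambda>c. fst q *\<^sub>R fan_s M \<Gamma> s \<alpha> c + snd q *\<^sub>R fan_alpha M \<Gamma> s \<alpha> c))"

definition fan_ds :: "'a surface \<Rightarrow> (real \<Rightarrow> 'a) \<Rightarrow> real \<Rightarrow> real \<Rightarrow> 'a ttvec \<Rightarrow> real" where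
  "fan_ds M \<Gamma> s \<alpha> \<xi> = fst (fan_components M \<Gamma> s \<alpha> \<xi>)"

definition fan_dalpha :: "'a surface \<Rightarrow> (real \<Rightarrow> 'a) \<Rightarrow> real \<Rightarrow> real \<Rightarrow> 'a ttvec \<Rightarrow> real" where
  "fan_dalpha M \<Gamma> s \<alpha> \<xi> = snd (fan_components M \<Gamma> s \<alpha> \<xi>)"

definition II :: "'a surface \<Rightarrow> (real \<Rightarrow> 'a) \<Rightarrow> real \<Rightarrow> real" where
  "II M \<Gamma> s = second_ff M (\<Gamma> s) (curve_velocity M \<Gamma> s) (curve_velocity M \<Gamma> s)"


section \<open>Consistency of the coordinate formulas\<close>

lemma bform_2:
  "bform A u w = u$1 * (A$1$1 * w$1 + A$1$2 * w$2) + u$2 * (A$2$1 * w$1 + A$2$2 * w$2)"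
  by (simp add: bform_def inner_vec_def matrix_vector_mult_def sum_2)

lemma rot_coord:
  assumes sym: "transpose A = A" and pos: "\<And>w. w \<noteq> 0 \<Longrightarrow> 0 < bform A w w"
  shows "bform A (rot_coord A w) w = 0"
    and "bform A (rot_coord A w) (rot_coord A w) = bform A w w"
    and "w \<noteq> 0 \<Longrightarrow> 0 < w $ 1 * rot_coord A w $ 2 - w $ 2 * rot_coord A w $ 1"
proof -
  have s: "A$2$1 = A$1$2"
    using arg_cong[OF sym, of "\<lambda>B. B $ 1 $ 2"] by (simp add: transpose_def)
  have "0 < bform A (axis 1 1) (axis 1 1)"
    by (rule pos) (simp add: axis_eq_0_iff)
  then have a: "0 < A$1$1"
    by (simp add: bform_2 axis_def)
  have "0 < bform A (vector [- A$1$2, A$1$1]) (vector [- A$1$2, A$1$1])"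
  proof (rule pos)
    show "(vector [- A$1$2, A$1$1] :: real^2) \<noteq> 0"
      using a by (auto simp: vec_eq_iff forall_2)
  qed
  then have "0 < A$1$1 * det A"
    using s by (simp add: bform_2 det_2 algebra_simps)
  then have d: "0 < det A"
    using a by (simp add: zero_less_mult_iff)
  define k where "k = 1 / sqrt (det A)"
  have k: "0 < k" "k * k * det A = 1"
    using d by (simp_all add: k_def)
  define p q where "p = A$1$1 * w$1 + A$1$2 * w$2" and "q = A$1$2 * w$1 + A$2$2 * w$2"
  have r: "rot_coord A w $ 1 = - k * q" "rot_coord A w $ 2 = k * p"
    using s by (simp_all add: rot_coord_def k_def p_def q_def matrix_vector_mult_def sum_2 diff_divide_distrib add_divide_distrib)
  show "bform A (rot_coord A w) w = 0"
    using s by (simp add: bform_2 r p_def q_def algebra_simps)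
  have "bform A (rot_coord A w) (rot_coord A w) = k * k * det A * (w$1 * p + w$2 * q)"
    using s by (simp add: bform_2 r det_2 p_def q_def algebra_simps)
  also have "\<dots> = bform A w w"
    using s by (simp add: k bform_2 p_def q_def)
  finally show "bform A (rot_coord A w) (rot_coord A w) = bform A w w" .
  assume "w \<noteq> 0"
  have "w $ 1 * rot_coord A w $ 2 - w $ 2 * rot_coord A w $ 1 = k * bform A w w"
    using s by (simp add: r bform_2 p_def q_def algebra_simps)
  then show "0 < w $ 1 * rot_coord A w $ 2 - w $ 2 * rot_coord A w $ 1"
    using k pos[OF \<open>w \<noteq> 0\<close>] by simp
qed

lemma V_coord_generator:
  "((\<lambda>\<theta>. (fst q, cos \<theta> *\<^sub>R snd q + sin \<theta> *\<^sub>R rot_coord (metric M c (fst q)) (snd q)))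
     has_vector_derivative V_coord M c q) (at 0)"
  unfolding V_coord_def
  by (auto intro!: derivative_eq_intros has_vector_derivative_Pair)

lemma pd_eq:
  assumes S: "openin (top_of_set half_plane) S" and y: "y \<in> S"
    and f: "(f has_derivative f') (at y within S)"
  shows "pd S i f y = f' (axis i 1)"
proof -
  have "frechet_derivative f (at y within S) = f'"
  proof (rule frechet_derivative_unique_within[OF _ f])
    show "(f has_derivative frechet_derivative f (at y within S)) (at y within S)"
      using f by (metis differentiable_def frechet_derivative_works)
    fix b :: "real^2" and e :: real
    assume b: "b \<in> Basis" and e: "0 < e"
    obtain T where T: "open T" "S = half_plane \<inter> T"
      using S by (auto simp: openin_open)
    then obtain r where r: "0 < r" "ball y r \<subseteq> T"
      using y by (meson IntD2 open_contains_ball)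
    define d where "d = min e r / 2"
    have d: "0 < d" "d < e" "d < r"
      using e r by (auto simp: d_def)
    have "y + d *\<^sub>R b \<in> ball y r"
      using d b by (simp add: dist_norm norm_Basis)
    moreover have "0 \<le> b $ 2"
      using b by (auto simp: Basis_vec_def axis_def)
    then have "y + d *\<^sub>R b \<in> half_plane"
      using y T d by (auto simp: half_plane_def)
    ultimately have "y + d *\<^sub>R b \<in> S"
      using T r by auto
    then show "\<exists>d. 0 < \<bar>d\<bar> \<and> \<bar>d\<bar> < e \<and> y + d *\<^sub>R b \<in> S"
      using d by (intro exI[of _ d]) auto
  qed
  then show ?thesis
    by (simp add: pd_def)
qed

text \<open>
  In boundary normal coordinates \<open>(s, \<rho>)\<close>, where \<open>g = e\<^bsup>2w\<^esup> ds\<^sup>2 + d\<rho>\<^sup>2\<close> and \<open>w = 0\<close> on the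
  boundary, the expression defining \<open>II(\<partial>\<^sub>s, \<partial>\<^sub>s)\<close> is \<open>- \<partial>\<^sub>\<rho> w\<close>.
\<close>

lemma second_ff_boundary_normal_coordinates:
  fixes S :: "(real^2) set" and w :: "real^2 \<Rightarrow> real"
  assumes S: "openin (top_of_set half_plane) S" and y: "y \<in> S" "w y = 0"
    and w: "w differentiable (at y within S)"
    and G: "\<And>z. G z = vector [vector [exp (2 * w z), 0], vector [0, 1]]"
  shows "bform (G y) (christoffel_vec S G y (axis 1 1) (axis 1 1)) (axis 2 1) = - pd S 2 w y"
proof -
  obtain w' where w': "(w has_derivative w') (at y within S)"
    using w by (auto simp: differentiable_def)
  have "((\<lambda>z. exp (2 * w z)) has_derivative (\<lambda>h. 2 * w' h)) (at y within S)"
    using y by (auto intro!: derivative_eq_intros w')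
  then have "pd S 2 (\<lambda>z. exp (2 * w z)) y = 2 * pd S 2 w y"
    using pd_eq[OF S y(1)] w' by simp
  moreover have "pd S i (\<lambda>z. c) y = 0" for i c
    using pd_eq[OF S y(1) has_derivative_const] by simp
  moreover have G1: "G y = mat 1"
    using y by (simp add: G vec_eq_iff forall_2 mat_def)
  moreover have "matrix_inv (mat 1 :: real^2^2) = mat 1"
    unfolding matrix_inv_def by (rule some_equality) auto
  ultimately show ?thesis
    by (simp add: bform_2 christoffel_vec_def christoffel_def sum_2 axis_def mat_def)
       (simp add: G)
qed

end

theory Submission
  imports Defs
begin

text \<open>
  The covector \<open>\<eta>\<close> is prescribed on the frame \<open>(V, H)\<close>, and its fan-beam components are its values on
  \<open>(\<partial>\<^sub>s, \<partial>\<^sub>\<alpha>)\<close>. Everything therefore rests on the change of frame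
  \<open>\<partial>\<^sub>\<alpha> = V\<close> and \<open>\<partial>\<^sub>s = H + II V\<close> (\<open>fan_alpha_eq_V\<close>, \<open>H_field_eq\<close>): it gives
  \<open>\<eta>\<^sub>\<alpha> = b\<close> and \<open>\<eta>\<^sub>s = - \<mu> a + II b\<close>.

  The first identity holds because \<open>v = cos \<alpha> \<nu> + sin \<alpha> \<nu>\<^sub>\<perp>\<close>. For the second one, both sides lie over
  \<open>\<Gamma>'\<close>, and what has to be compared is the covariant derivative of \<open>v\<close> along \<open>\<Gamma>\<close>. The field \<open>H\<close> is
  horizontal: since the rotation \<open>w \<mapsto> w\<^sub>\<perp>\<close> is parallel (\<open>rot_coord_parallel\<close>), the bracket
  \<open>X\<^sub>\<perp> = [X, V]\<close> is the horizontal lift of \<open>- v\<^sub>\<perp>\<close> (\<open>X_perp_coord\<close>), so that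
  \<open>\<mu>\<^sub>\<perp> X + \<mu> X\<^sub>\<perp>\<close> is the horizontal lift of \<open>\<mu>\<^sub>\<perp> v - \<mu> v\<^sub>\<perp> = \<Gamma>'\<close>. On the other hand
  \<open>\<Gamma>\<close> has unit speed, so its acceleration is normal, and equal to \<open>II \<nu>\<close> by the definition of \<open>II\<close>
  (\<open>boundary_curve_acceleration\<close>). As rotations are parallel, a vector at a fixed angle to \<open>\<Gamma>'\<close>
  turns at the same rate: the covariant derivative of \<open>v\<close> is \<open>II v\<^sub>\<perp>\<close>, that is, \<open>\<partial>\<^sub>s\<close> has vertical
  part \<open>II V\<close> (\<open>fan_beam_s_derivative\<close>).

  These computations are made in one chart. To turn them into identities between the invariant
  objects, \<open>II\<close> must have the same expression in all charts. This follows from the transformation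
  law of the Christoffel symbols, which relies on the symmetry of second derivatives
  (\<open>symmetric_second_derivative_real\<close>): the inhomogeneous term in this law has no normal component,
  because a transition map preserves the boundary line and hence has a tangential second derivative
  along it (\<open>christoffel_normal_component_transition\<close>). Finally, every tangent vector of \<open>\<partial>SM\<close> has to be a
  combination of \<open>\<partial>\<^sub>s\<close> and \<open>\<partial>\<^sub>\<alpha>\<close> (\<open>fan_basis_spans\<close>): its base component is tangent to the boundary,
  and differentiating \<open>g(v, v) = 1\<close> leaves only a multiple of \<open>v\<^sub>\<perp>\<close> for the remaining part.
\<close>


section \<open>Derivatives on relatively open subsets of the half plane\<close>

text \<open>
  The case \<open>0 \<le> d $ 2\<close> covers all basis vectors, also at boundary points, which makes derivatives
  within such sets unique; the case \<open>0 < y $ 2\<close> says that interior points admit all directions.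
\<close>
lemma segment_in_half_plane_open:
  assumes S: "openin (top_of_set half_plane) S" and y: "y \<in> S"
    and d: "0 < y $ 2 \<or> 0 \<le> d $ 2"
  shows "\<exists>e>0. \<forall>t. 0 \<le> t \<and> t < e \<longrightarrow> y + t *\<^sub>R d \<in> S"
proof -
  obtain T where T: "open T" "S = half_plane \<inter> T"
    using S by (auto simp: openin_open)
  have "isCont (\<lambda>t::real. y + t *\<^sub>R d) 0"
    by (intro continuous_intros)
  then have "\<forall>\<^sub>F t in at 0. y + t *\<^sub>R d \<in> T"
    using T y unfolding isCont_def by (intro topological_tendstoD) auto
  then obtain e where e: "0 < e" "\<And>t. t \<noteq> 0 \<Longrightarrow> dist t 0 < e \<Longrightarrow> y + t *\<^sub>R d \<in> T"
    by (auto simp: eventually_at)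
  obtain e' where e': "0 < e'" "\<And>t. 0 \<le> t \<Longrightarrow> t < e' \<Longrightarrow> 0 \<le> y $ 2 + t * d $ 2"
  proof (cases "0 \<le> d $ 2")
    case True
    then show ?thesis
      using that[of 1] y T by (auto simp: half_plane_def)
  next
    case False
    then have *: "0 < y $ 2" "d $ 2 < 0"
      using d by auto
    show ?thesis
    proof (rule that[of "y $ 2 / (- d $ 2)"])
      show "0 < y $ 2 / (- d $ 2)"
        using * by (intro divide_pos_pos) auto
      fix t assume "0 \<le> t" "t < y $ 2 / (- d $ 2)"
      then show "0 \<le> y $ 2 + t * d $ 2"
        using * by (simp add: field_simps)
    qed
  qed
  show ?thesis
  proof (intro exI[of _ "min e e'"] conjI allI impI)
    fix t assume t: "0 \<le> t \<and> t < min e e'"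
    then have "y + t *\<^sub>R d \<in> T"
      using e(2)[of t] y T by (cases "t = 0") auto
    moreover have "y + t *\<^sub>R d \<in> half_plane"
      using e'(2)[of t] t by (simp add: half_plane_def)
    ultimately show "y + t *\<^sub>R d \<in> S"
      using T by simp
  qed (use e e' in simp)
qed

lemma has_derivative_unique_half_plane:
  fixes f :: "real^2 \<Rightarrow> 'b::real_normed_vector"
  assumes S: "openin (top_of_set half_plane) S" and y: "y \<in> S"
    and f: "(f has_derivative f') (at y within S)" "(f has_derivative f'') (at y within S)"
  shows "f' = f''"
proof (rule frechet_derivative_unique_within[OF f])
  fix b :: "real^2" and e :: real
  assume b: "b \<in> Basis" and e: "0 < e"
  then have "0 \<le> b $ 2"
    by (auto simp: Basis_vec_def axis_def)
  then obtain r where r: "r > 0" "\<And>t. 0 \<le> t \<Longrightarrow> t < r \<Longrightarrow> y + t *\<^sub>R b \<in> S"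
    using segment_in_half_plane_open[OF S y] by blast
  then show "\<exists>d. 0 < \<bar>d\<bar> \<and> \<bar>d\<bar> < e \<and> y + d *\<^sub>R b \<in> S"
    using e by (intro exI[of _ "min e r / 2"]) auto
qed

lemma frechet_derivative_half_plane:
  fixes f :: "real^2 \<Rightarrow> 'b::real_normed_vector"
  assumes "openin (top_of_set half_plane) S" "y \<in> S" "(f has_derivative f') (at y within S)"
  shows "frechet_derivative f (at y within S) = f'"
  using assms has_derivative_unique_half_plane[OF assms(1,2)]
  by (metis differentiable_def frechet_derivative_works)

lemma frechet_derivative_half_plane_times:
  fixes f :: "(real^2) \<times> (real^2) \<Rightarrow> 'b::real_normed_vector"
  assumes S: "openin (top_of_set half_plane) S" and y: "fst q \<in> S"
    and f: "(f has_derivative f') (at q within S \<times> UNIV)"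
  shows "frechet_derivative f (at q within S \<times> UNIV) = f'"
proof (rule frechet_derivative_unique_within[OF _ f])
  show "(f has_derivative frechet_derivative f (at q within S \<times> UNIV)) (at q within S \<times> UNIV)"
    using f by (metis differentiable_def frechet_derivative_works)
  fix b :: "(real^2) \<times> (real^2)" and e :: real
  assume b: "b \<in> Basis" and e: "0 < e"
  then have "0 \<le> fst b $ 2"
    by (auto simp: Basis_prod_def Basis_vec_def axis_def)
  then obtain r where r: "r > 0" "\<And>t. 0 \<le> t \<Longrightarrow> t < r \<Longrightarrow> fst q + t *\<^sub>R fst b \<in> S"
    using segment_in_half_plane_open[OF S y] by blast
  then show "\<exists>d. 0 < \<bar>d\<bar> \<and> \<bar>d\<bar> < e \<and> q + d *\<^sub>R b \<in> S \<times> UNIV"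
    using e by (intro exI[of _ "min e r / 2"]) (auto simp: mem_Times_iff)
qed

text \<open>The first order condition at a minimum that may lie on the edge of the domain.\<close>
lemma directional_derivative_nonneg:
  fixes f :: "'a::real_normed_vector \<Rightarrow> real"
  assumes f: "(f has_derivative f') (at y within S)"
    and min: "\<And>z. z \<in> S \<Longrightarrow> f y \<le> f z"
    and seg: "\<exists>e>0. \<forall>t. 0 \<le> t \<and> t < e \<longrightarrow> y + t *\<^sub>R d \<in> S"
  shows "0 \<le> f' d"
proof -
  obtain e where e: "0 < e" "\<And>t. 0 \<le> t \<Longrightarrow> t < e \<Longrightarrow> y + t *\<^sub>R d \<in> S"
    using seg by blast
  have 1: "((\<lambda>t::real. y + t *\<^sub>R d) has_derivative (\<lambda>t. t *\<^sub>R d)) (at 0 within {0..<e})"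
    by (auto intro!: derivative_eq_intros)
  have "((\<lambda>t. f (y + t *\<^sub>R d)) has_derivative (\<lambda>t. f' (t *\<^sub>R d))) (at 0 within {0..<e})"
    by (rule has_derivative_in_compose[OF 1])
       (use e f in \<open>auto intro: has_derivative_subset\<close>)
  moreover have "linear f'"
    using f has_derivative_linear by blast
  then have "(\<lambda>t. f' (t *\<^sub>R d)) = (*) (f' d)"
    by (auto simp: linear_cmul)
  ultimately have "((\<lambda>t. f (y + t *\<^sub>R d)) has_field_derivative f' d) (at 0 within {0..<e})"
    unfolding has_field_derivative_def by simp
  then have "((\<lambda>t. (f (y + t *\<^sub>R d) - f y) / t) \<longlongrightarrow> f' d) (at 0 within {0..<e})"
    by (simp add: has_field_derivative_iff)
  moreover have "\<forall>\<^sub>F t in at 0 within {0..<e}. 0 \<le> (f (y + t *\<^sub>R d) - f y) / t"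
    unfolding eventually_at_filter using e min by (auto intro!: always_eventually)
  moreover have "at 0 within {0..<e} \<noteq> bot"
  proof -
    have "{0..<e} - {0} = {0<..<e}"
      by auto
    then show ?thesis
      using e by (simp add: at_within_eq_bot_iff)
  qed
  ultimately show ?thesis
    by (rule tendsto_lowerbound)
qed

text \<open>
  The second difference of \<open>f\<close> over the parallelogram spanned by \<open>t u\<close> and \<open>t w\<close> is symmetric in \<open>u\<close>
  and \<open>w\<close>, and divided by \<open>t\<^sup>2\<close> it tends to either of the two second derivatives.
\<close>
lemma symmetric_second_derivative_real:
  fixes f :: "'a::real_normed_vector \<Rightarrow> real"
  assumes N: "open N" "y \<in> N"
    and f: "\<And>z. z \<in> N \<Longrightarrow> (f has_derivative f' z) (at z)"
    and f'': "\<And>e. ((\<lambda>z. f' z e) has_derivative (\<lambda>d. f'' d e)) (at y)"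
  shows "f'' u w = f'' w u"
proof -
  define \<Delta> where "\<Delta> t = f (y + t *\<^sub>R u + t *\<^sub>R w) - f (y + t *\<^sub>R u) - f (y + t *\<^sub>R w) + f y" for t
  \<comment> \<open>The mean value theorem in the direction \<open>a\<close> replaces the second difference by a difference
    of values of \<open>f' _ a\<close> at two points near \<open>y\<close>; differentiability of \<open>f' _ a\<close> at \<open>y\<close> then
    gives the quotient by \<open>t\<^sup>2\<close> up to an error of order \<open>e * C\<close>.\<close>
  have key: "\<forall>\<^sub>F t in at_right 0. \<bar>(f (y + t *\<^sub>R a + t *\<^sub>R b) - f (y + t *\<^sub>R a) - f (y + t *\<^sub>R b) + f y)
        / t\<^sup>2 - f'' b a\<bar> \<le> \<epsilon>"
    if \<epsilon>: "0 < \<epsilon>" for a b :: 'a and \<epsilon>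
  proof -
    interpret Q: bounded_linear "\<lambda>d. f'' d a"
      by (rule has_derivative_bounded_linear[OF f''])
    define C where "C = norm a + norm b + 1"
    have C: "0 < C"
      by (simp add: C_def add_nonneg_pos)
    define e where "e = \<epsilon> / (2 * C)"
    have e: "0 < e" "2 * (e * C) = \<epsilon>"
      using \<epsilon> C by (simp_all add: e_def)
    obtain d where d: "0 < d"
      "\<And>z. norm (z - y) < d \<Longrightarrow> \<bar>f' z a - f' y a - f'' (z - y) a\<bar> \<le> e * norm (z - y)"
      using f''[of a, unfolded has_derivative_at_alt] e(1) by (auto simp: )
    obtain r where r: "0 < r" "ball y r \<subseteq> N"
      using N open_contains_ball by blast
    define \<delta> where "\<delta> = min d r / C"
    have \<delta>: "0 < \<delta>"
      using d r C by (simp add: \<delta>_def)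
    have "\<bar>(f (y + t *\<^sub>R a + t *\<^sub>R b) - f (y + t *\<^sub>R a) - f (y + t *\<^sub>R b) + f y)
        / t\<^sup>2 - f'' b a\<bar> \<le> \<epsilon>" if t: "0 < t" "t < \<delta>" for t
    proof -
      have tC: "t * C < d" "t * C < r"
        using t C by (simp_all add: \<delta>_def field_simps)
      have near: "norm (s *\<^sub>R a + q *\<^sub>R b) \<le> t * C" if "0 \<le> s" "s \<le> t" "0 \<le> q" "q \<le> t" for s q
      proof -
        have "norm (s *\<^sub>R a + q *\<^sub>R b) \<le> s * norm a + q * norm b"
          using that norm_triangle_ineq[of "s *\<^sub>R a" "q *\<^sub>R b"] by simp
        also have "\<dots> \<le> t * norm a + t * norm b"
          using that by (intro add_mono mult_right_mono) auto
        also have "\<dots> \<le> t * C"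
          using t by (simp add: C_def algebra_simps)
        finally show ?thesis .
      qed
      have inN: "y + s *\<^sub>R a + q *\<^sub>R b \<in> N" if "0 \<le> s" "s \<le> t" "0 \<le> q" "q \<le> t" for s q
      proof -
        have "y + s *\<^sub>R a + q *\<^sub>R b \<in> ball y r"
          using near[OF that] tC by (simp add: dist_norm norm_minus_commute algebra_simps)
        then show ?thesis using r by blast
      qed
      have der: "((\<lambda>s. f (y + s *\<^sub>R a + t *\<^sub>R b) - f (y + s *\<^sub>R a)) has_derivative
          (\<lambda>h. f' (y + s *\<^sub>R a + t *\<^sub>R b) (h *\<^sub>R a) - f' (y + s *\<^sub>R a) (h *\<^sub>R a)))
          (at s within {0..t})" if s: "0 \<le> s" "s \<le> t" for s
      proof -
        have 1: "y + s *\<^sub>R a + t *\<^sub>R b \<in> N" "y + s *\<^sub>R a \<in> N"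
          using inN[of s t] inN[of s 0] s t by auto
        have 2: "((\<lambda>s. y + s *\<^sub>R a + t *\<^sub>R b) has_derivative (\<lambda>h. h *\<^sub>R a)) (at s within {0..t})"
          "((\<lambda>s. y + s *\<^sub>R a) has_derivative (\<lambda>h. h *\<^sub>R a)) (at s within {0..t})"
          by (auto intro!: derivative_eq_intros)
        show ?thesis
          using has_derivative_compose[OF 2(1), of f] has_derivative_compose[OF 2(2), of f]
            f[OF 1(1)] f[OF 1(2)] by (intro has_derivative_diff) auto
      qed
      obtain s where s: "0 < s" "s < t" and
        eq: "(f (y + t *\<^sub>R a + t *\<^sub>R b) - f (y + t *\<^sub>R a)) - (f (y + t *\<^sub>R b) - f y)
          = f' (y + s *\<^sub>R a + t *\<^sub>R b) (t *\<^sub>R a) - f' (y + s *\<^sub>R a) (t *\<^sub>R a)"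
        using mvt_simple[OF t(1) der] by auto
      have lin: "linear (f' z)" if "z \<in> N" for z
        using f[OF that] has_derivative_linear by blast
      have N': "y + s *\<^sub>R a + t *\<^sub>R b \<in> N" "y + s *\<^sub>R a \<in> N"
        using inN[of s t] inN[of s 0] s t by auto
      define A B where "A = f' (y + s *\<^sub>R a + t *\<^sub>R b) a - f' y a - f'' (s *\<^sub>R a + t *\<^sub>R b) a"
        and "B = f' (y + s *\<^sub>R a) a - f' y a - f'' (s *\<^sub>R a) a"
      have "\<bar>A\<bar> \<le> e * norm (s *\<^sub>R a + t *\<^sub>R b)"
        using d(2)[of "y + s *\<^sub>R a + t *\<^sub>R b"] near[of s t] s t tC
        by (simp add: A_def algebra_simps)
      also have "\<dots> \<le> e * (t * C)"
        using near[of s t] s t e by (intro mult_left_mono) auto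
      finally have A: "\<bar>A\<bar> \<le> e * (t * C)" .
      have "\<bar>B\<bar> \<le> e * norm (s *\<^sub>R a)"
        using d(2)[of "y + s *\<^sub>R a"] near[of s 0] s t tC
        by (simp add: B_def algebra_simps)
      also have "\<dots> \<le> e * (t * C)"
        using near[of s 0] s t e by (intro mult_left_mono) auto
      finally have B: "\<bar>B\<bar> \<le> e * (t * C)" .
      have "f (y + t *\<^sub>R a + t *\<^sub>R b) - f (y + t *\<^sub>R a) - f (y + t *\<^sub>R b) + f y
          = t * (f' (y + s *\<^sub>R a + t *\<^sub>R b) a - f' (y + s *\<^sub>R a) a)"
        using eq lin[OF N'(1)] lin[OF N'(2)] by (simp add: linear_cmul algebra_simps)
      also have "\<dots> = t * (A - B + t * f'' b a)"
        by (simp add: A_def B_def Q.add Q.scaleR)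
      finally have "(f (y + t *\<^sub>R a + t *\<^sub>R b) - f (y + t *\<^sub>R a) - f (y + t *\<^sub>R b) + f y) / t\<^sup>2 - f'' b a
          = t * (A - B + t * f'' b a) / t\<^sup>2 - f'' b a"
        by (simp only:)
      also have "\<dots> = (A - B) / t"
        using t by (simp add: power2_eq_square field_simps)
      also have "\<bar>\<dots>\<bar> \<le> \<epsilon>"
      proof -
        have "\<bar>A - B\<bar> \<le> 2 * (e * (t * C))"
          using A B by linarith
        also have "\<dots> = \<epsilon> * t"
          using e(2) by (metis mult.assoc mult.commute)
        finally show ?thesis
          using t by (simp add: divide_le_eq)
      qed
      finally show ?thesis .
    qed
    then show ?thesis
      unfolding eventually_at_right_field using \<delta> by blast
  qed
  have "((\<lambda>t. \<Delta> t / t\<^sup>2) \<longlongrightarrow> f'' w u) (at_right 0)"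
  proof (rule tendstoI)
    fix \<epsilon> :: real assume "0 < \<epsilon>"
    then have "\<forall>\<^sub>F t in at_right 0. \<bar>\<Delta> t / t\<^sup>2 - f'' w u\<bar> \<le> \<epsilon> / 2"
      using key[of "\<epsilon> / 2" u w] by (simp add: \<Delta>_def)
    then show "\<forall>\<^sub>F t in at_right 0. dist (\<Delta> t / t\<^sup>2) (f'' w u) < \<epsilon>"
      by eventually_elim (use \<open>0 < \<epsilon>\<close> in \<open>simp add: dist_real_def\<close>)
  qed
  moreover have "((\<lambda>t. \<Delta> t / t\<^sup>2) \<longlongrightarrow> f'' u w) (at_right 0)"
  proof (rule tendstoI)
    fix \<epsilon> :: real assume "0 < \<epsilon>"
    then have "\<forall>\<^sub>F t in at_right 0. \<bar>\<Delta> t / t\<^sup>2 - f'' u w\<bar> \<le> \<epsilon> / 2"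
      using key[of "\<epsilon> / 2" w u] by (simp add: \<Delta>_def algebra_simps)
    then show "\<forall>\<^sub>F t in at_right 0. dist (\<Delta> t / t\<^sup>2) (f'' u w) < \<epsilon>"
      by eventually_elim (use \<open>0 < \<epsilon>\<close> in \<open>simp add: dist_real_def\<close>)
  qed
  ultimately show ?thesis
    using tendsto_unique[of "at_right (0::real)"] trivial_limit_at_right_real by metis
qed

lemma Ck_on_2_derivatives:
  fixes h :: "'a::euclidean_space \<Rightarrow> 'b::real_normed_vector"
  assumes N: "open N" "y \<in> N" and h: "\<And>k. Ck_on k N h"
  shows "\<exists>h''. (\<forall>z\<in>N. (h has_derivative frechet_derivative h (at z)) (at z)) \<and>
    (\<forall>e. ((\<lambda>z. frechet_derivative h (at z) e) has_derivative (\<lambda>d. h'' d e)) (at y))"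
proof -
  have d1: "(h has_derivative frechet_derivative h (at z)) (at z)" if "z \<in> N" for z
    using h[of "Suc 0"] N that
    by (simp add: differentiable_on_eq_differentiable_at frechet_derivative_works)
  have "(\<lambda>z. frechet_derivative h (at z) i) differentiable at y" if "i \<in> Basis" for i
    using h[of "Suc (Suc 0)"] N that
    by (auto simp: differentiable_on_eq_differentiable_at)
  then obtain D where D: "\<And>i. i \<in> Basis \<Longrightarrow>
      ((\<lambda>z. frechet_derivative h (at z) i) has_derivative D i) (at y)"
    unfolding differentiable_def by metis
  define h'' where "h'' d e = (\<Sum>i\<in>Basis. (e \<bullet> i) *\<^sub>R D i d)" for d e
  have expand: "frechet_derivative h (at z) e = (\<Sum>i\<in>Basis. (e \<bullet> i) *\<^sub>R frechet_derivative h (at z) i)"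
    if "z \<in> N" for z e
  proof -
    have "linear (frechet_derivative h (at z))"
      using d1[OF that] has_derivative_linear by blast
    then show ?thesis
      by (subst euclidean_representation[of e, symmetric]) (simp add: linear_sum linear_cmul)
  qed
  have "((\<lambda>z. frechet_derivative h (at z) e) has_derivative (\<lambda>d. h'' d e)) (at y)" for e
  proof -
    have "((\<lambda>z. \<Sum>i\<in>Basis. (e \<bullet> i) *\<^sub>R frechet_derivative h (at z) i) has_derivative (\<lambda>d. h'' d e)) (at y)"
      unfolding h''_def by (intro has_derivative_sum has_derivative_scaleR_right D)
    then show ?thesis
      by (rule has_derivative_transform_within_open[OF _ N]) (simp add: expand)
  qed
  then show ?thesis
    using d1 by blast
qed

text \<open>
  A local smooth extension has the same derivatives within \<open>S\<close> as \<open>f\<close> itself, so the first derivative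
  of \<open>f\<close> is differentiable within \<open>S\<close> and the second derivative is inherited from the extension.
  Symmetry is tested with real functionals, which reduces it to the scalar case.
\<close>
lemma smooth_on_half_plane_derivatives:
  fixes f :: "real^2 \<Rightarrow> 'b::real_normed_vector"
  assumes S: "openin (top_of_set half_plane) S" and f: "smooth_on S f" and y: "y \<in> S"
  shows "\<exists>f''. (f has_derivative frechet_derivative f (at y within S)) (at y within S) \<and>
    (\<forall>e. ((\<lambda>z. frechet_derivative f (at z within S) e) has_derivative (\<lambda>d. f'' d e)) (at y within S)) \<and>
    (\<forall>\<beta>::'b \<Rightarrow> real. bounded_linear \<beta> \<longrightarrow> (\<forall>u w. \<beta> (f'' u w) = \<beta> (f'' w u)))"
proof -
  obtain N h where N: "open N" "y \<in> N" and h: "\<And>k. Ck_on k N h" and hf: "\<And>z. z \<in> N \<inter> S \<Longrightarrow> h z = f z"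
    using f y unfolding smooth_on_def by metis
  obtain h'' where d1: "\<And>z. z \<in> N \<Longrightarrow> (h has_derivative frechet_derivative h (at z)) (at z)"
    and d2: "\<And>e. ((\<lambda>z. frechet_derivative h (at z) e) has_derivative (\<lambda>d. h'' d e)) (at y)"
    using Ck_on_2_derivatives[OF N h] by metis
  have df: "(f has_derivative frechet_derivative h (at z)) (at z within S)" if z: "z \<in> S" "z \<in> N" for z
  proof -
    obtain r where r: "0 < r" "ball z r \<subseteq> N"
      using N z open_contains_ball by blast
    show ?thesis
      by (rule has_derivative_transform_within[OF has_derivative_at_withinI[OF d1[OF z(2)]] r(1) z(1)])
         (use r hf in \<open>auto simp: dist_commute subset_eq\<close>)
  qed
  then have eq: "frechet_derivative f (at z within S) = frechet_derivative h (at z)"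
    if "z \<in> S" "z \<in> N" for z
    using frechet_derivative_half_plane[OF S that(1)] that by blast
  have "((\<lambda>z. frechet_derivative f (at z within S) e) has_derivative (\<lambda>d. h'' d e)) (at y within S)" for e
  proof -
    obtain r where r: "0 < r" "ball y r \<subseteq> N"
      using N open_contains_ball by blast
    show ?thesis
      by (rule has_derivative_transform_within[OF has_derivative_at_withinI[OF d2] r(1) y])
         (use r eq in \<open>auto simp: dist_commute subset_eq\<close>)
  qed
  moreover have "\<beta> (h'' u w) = \<beta> (h'' w u)" if \<beta>: "bounded_linear \<beta>" for \<beta> :: "'b \<Rightarrow> real" and u w
    by (rule symmetric_second_derivative_real[OF N bounded_linear.has_derivative[OF \<beta> d1]
          bounded_linear.has_derivative[OF \<beta> d2]])
  ultimately show ?thesis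
    using df[OF y N(2)] eq[OF y N(2)] by (intro exI[of _ h'']) auto
qed

lemma has_vector_derivative_shift:
  assumes "(f has_vector_derivative d) (at (s + u))"
  shows "((\<lambda>r. f (s + r)) has_vector_derivative d) (at (u :: real))"
proof -
  have "((\<lambda>r. s + r) has_vector_derivative 1) (at u)"
    by (auto simp: has_vector_derivative_def intro!: derivative_eq_intros)
  from vector_diff_chain_at[OF this assms] show ?thesis
    by (simp add: comp_def)
qed


section \<open>Inner products on the plane and their rotations\<close>

definition inner_product_matrix :: "real^2^2 \<Rightarrow> bool" where
  "inner_product_matrix A \<longleftrightarrow> transpose A = A \<and> (\<forall>w. w \<noteq> 0 \<longrightarrow> 0 < bform A w w)"

lemma bform_add_left: "bform A (u + v) w = bform A u w + bform A v w"
  and bform_add_right: "bform A u (v + w) = bform A u v + bform A u w"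
  and bform_diff_left: "bform A (u - v) w = bform A u w - bform A v w"
  and bform_diff_right: "bform A u (v - w) = bform A u v - bform A u w"
  and bform_scaleR_left: "bform A (r *\<^sub>R u) w = r * bform A u w"
  and bform_scaleR_right: "bform A u (r *\<^sub>R w) = r * bform A u w"
  and bform_minus_left: "bform A (- u) w = - bform A u w"
  and bform_minus_right: "bform A u (- w) = - bform A u w"
  and bform_zero_left: "bform A 0 w = 0"
  and bform_zero_right: "bform A u 0 = 0"
  by (simp_all add: bform_2 algebra_simps)

lemmas bform_linear = bform_add_left bform_add_right bform_diff_left bform_diff_right
  bform_scaleR_left bform_scaleR_right bform_minus_left bform_minus_right
  bform_zero_left bform_zero_right

lemma has_derivative_vec_nth:
  "(f has_derivative f') F \<Longrightarrow> ((\<lambda>z. f z $ i) has_derivative (\<lambda>h. f' h $ i)) F"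
  by (rule bounded_linear.has_derivative[OF bounded_linear_vec_nth])

lemma differentiable_vec_nth:
  "f differentiable F \<Longrightarrow> (\<lambda>z. f z $ i) differentiable F"
  unfolding differentiable_def using has_derivative_vec_nth by blast

lemma linear_2:
  fixes f :: "real^2 \<Rightarrow> 'a::real_vector"
  assumes "linear f"
  shows "f h = h $ 1 *\<^sub>R f (axis 1 1) + h $ 2 *\<^sub>R f (axis 2 1)"
proof -
  have "h = h $ 1 *\<^sub>R axis 1 1 + h $ 2 *\<^sub>R axis 2 1"
    by (simp add: vec_eq_iff forall_2 axis_def)
  then have "f h = f (h $ 1 *\<^sub>R axis 1 1 + h $ 2 *\<^sub>R axis 2 1)"
    by (rule arg_cong)
  then show ?thesis
    by (simp only: linear_add[OF assms] linear_cmul[OF assms])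
qed

lemma has_derivative_bform:
  assumes "(G has_derivative G') (at y within S)"
    and "(f has_derivative f') (at y within S)" and "(g has_derivative g') (at y within S)"
  shows "((\<lambda>z. bform (G z) (f z) (g z)) has_derivative
    (\<lambda>h. bform (G' h) (f y) (g y) + bform (G y) (f' h) (g y) + bform (G y) (f y) (g' h)))
    (at y within S)"
  unfolding bform_2
  by (rule has_derivative_eq_rhs, (rule has_derivative_add has_derivative_mult has_derivative_vec_nth assms)+)
     (simp add: fun_eq_iff algebra_simps)

lemma linear_rot_coord: "linear (rot_coord A)"
  by (rule linearI)
     (simp_all add: rot_coord_def vec_eq_iff forall_2 matrix_vector_mult_def sum_2 algebra_simps
       add_divide_distrib diff_divide_distrib)

lemmas rot_coord_linear = linear_add[OF linear_rot_coord] linear_diff[OF linear_rot_coord]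
  linear_cmul[OF linear_rot_coord] linear_neg[OF linear_rot_coord] linear_0[OF linear_rot_coord]

context
  fixes A :: "real^2^2"
  assumes A: "inner_product_matrix A"
begin

lemma inner_product_matrix_entry: "A$2$1 = A$1$2"
proof -
  have "transpose A $ 1 $ 2 = A $ 1 $ 2"
    using A by (metis inner_product_matrix_def)
  then show ?thesis
    by (simp add: transpose_def)
qed

lemma inner_product_matrix_entry_pos: "0 < A$1$1"
proof -
  have "0 < bform A (axis 1 1) (axis 1 1)"
    using A by (simp add: inner_product_matrix_def axis_eq_0_iff)
  then show ?thesis
    by (simp add: bform_2 axis_def)
qed

lemma inner_product_matrix_det: "0 < det A"
proof -
  have "(vector [- A$1$2, A$1$1] :: real^2) \<noteq> 0"
    using inner_product_matrix_entry_pos by (auto simp: vec_eq_iff forall_2)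
  then have "0 < bform A (vector [- A$1$2, A$1$1]) (vector [- A$1$2, A$1$1])"
    using A by (simp add: inner_product_matrix_def)
  then have "0 < A$1$1 * det A"
    using inner_product_matrix_entry by (simp add: bform_2 det_2 algebra_simps)
  then show ?thesis
    using inner_product_matrix_entry_pos by (simp add: zero_less_mult_iff)
qed

lemma bform_pos: "w \<noteq> 0 \<Longrightarrow> 0 < bform A w w"
  using A by (simp add: inner_product_matrix_def)

lemma bform_commute: "bform A u w = bform A w u"
  using inner_product_matrix_entry by (simp add: bform_2 algebra_simps)

lemma rot_coord_components:
  "rot_coord A w $ 1 = - (1 / sqrt (det A)) * (A$1$2 * w$1 + A$2$2 * w$2)"
  "rot_coord A w $ 2 = 1 / sqrt (det A) * (A$1$1 * w$1 + A$1$2 * w$2)"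
  using inner_product_matrix_entry
  by (simp_all add: rot_coord_def matrix_vector_mult_def sum_2 add_divide_distrib diff_divide_distrib)

lemma inverse_sqrt_det: "1 / sqrt (det A) * (1 / sqrt (det A)) * det A = 1"
  using inner_product_matrix_det by simp

lemma rot_coord_skew: "bform A (rot_coord A u) w = - bform A u (rot_coord A w)"
proof -
  define k where "k = 1 / sqrt (det A)"
  note k = rot_coord_components[folded k_def] and d = inverse_sqrt_det[folded k_def]
  show ?thesis
    using inner_product_matrix_entry by (simp add: bform_2 k algebra_simps)
qed

lemma rot_coord_rot_coord: "rot_coord A (rot_coord A w) = - w"
proof -
  define k where "k = 1 / sqrt (det A)"
  note k = rot_coord_components[folded k_def] and d = inverse_sqrt_det[folded k_def]
  have "rot_coord A (rot_coord A w) $ i = - (k * k * det A * w $ i)" for i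
    using exhaust_2[of i] inner_product_matrix_entry by (auto simp: k det_2 algebra_simps)
  then show ?thesis
    by (simp add: d vec_eq_iff)
qed

lemma rot_coord_isometry: "bform A (rot_coord A u) (rot_coord A w) = bform A u w"
  by (simp add: rot_coord_skew rot_coord_rot_coord bform_linear)

lemma rot_coord_orthogonal: "bform A (rot_coord A w) w = 0" "bform A w (rot_coord A w) = 0"
  using rot_coord_skew[of w w] bform_commute[of w "rot_coord A w"] by linarith+

text \<open>In the plane the orthogonal complement of \<open>w\<close> is spanned by the rotated vector.\<close>
lemma orthogonal_expansion:
  assumes "bform A z w = 0"
  shows "bform A w w *\<^sub>R z = bform A z (rot_coord A w) *\<^sub>R rot_coord A w"
proof -
  define k where "k = 1 / sqrt (det A)"
  note k = rot_coord_components[folded k_def] and d = inverse_sqrt_det[folded k_def]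
  define p q where "p = A$1$1 * w$1 + A$1$2 * w$2" and "q = A$1$2 * w$1 + A$2$2 * w$2"
  have e: "z$1 * p + z$2 * q = 0"
    using assms inner_product_matrix_entry by (simp add: bform_2 p_def q_def algebra_simps)
  have ww: "bform A w w = w$1 * p + w$2 * q"
    using inner_product_matrix_entry by (simp add: bform_2 p_def q_def)
  have zJ: "bform A z (rot_coord A w) = k * det A * (z$2 * w$1 - z$1 * w$2)"
    using inner_product_matrix_entry by (simp add: bform_2 k det_2 algebra_simps)
  have "bform A z (rot_coord A w) * rot_coord A w $ 1
      = - (k * k * det A) * (z$2 * w$1 - z$1 * w$2) * q"
    unfolding zJ by (simp add: k q_def)
  moreover have "bform A z (rot_coord A w) * rot_coord A w $ 2
      = (k * k * det A) * (z$2 * w$1 - z$1 * w$2) * p"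
    unfolding zJ by (simp add: k p_def)
  moreover have "(w$1 * p + w$2 * q) * z$1 = - (z$2 * w$1 - z$1 * w$2) * q"
    "(w$1 * p + w$2 * q) * z$2 = (z$2 * w$1 - z$1 * w$2) * p"
  proof -
    have *: "z$1 * p = - (z$2 * q)"
      using e by simp
    have "(w$1 * p + w$2 * q) * z$1 = w$1 * (z$1 * p) + w$2 * q * z$1"
      by (simp add: algebra_simps)
    then show "(w$1 * p + w$2 * q) * z$1 = - (z$2 * w$1 - z$1 * w$2) * q"
      unfolding * by (simp add: algebra_simps)
    have **: "z$2 * q = - (z$1 * p)"
      using e by simp
    have "(w$1 * p + w$2 * q) * z$2 = w$1 * p * z$2 + w$2 * (z$2 * q)"
      by (simp add: algebra_simps)
    then show "(w$1 * p + w$2 * q) * z$2 = (z$2 * w$1 - z$1 * w$2) * p"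
      unfolding ** by (simp add: algebra_simps)
  qed
  ultimately show ?thesis
    by (simp add: vec_eq_iff forall_2 ww d)
qed

lemma orthogonal_eq_rot_coord:
  assumes "bform A z w = 0" and "bform A w w = 1"
  shows "z = bform A z (rot_coord A w) *\<^sub>R rot_coord A w"
  using orthogonal_expansion[OF assms(1)] assms(2) by simp

lemma eq_zero_if_orthogonal:
  assumes "bform A z w = 0" and "bform A z (rot_coord A w) = 0" and "w \<noteq> 0"
  shows "z = 0"
  using orthogonal_expansion[OF assms(1)] bform_pos[OF assms(3)] assms(2) by simp

lemma rot_coord_eq_0_iff: "rot_coord A w = 0 \<longleftrightarrow> w = 0"
  using rot_coord_rot_coord[of w] by (auto simp: rot_coord_linear(5))

end

lemma matrix_inv_2:
  fixes A :: "real^2^2"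
  assumes "det A \<noteq> 0"
  shows "matrix_inv A = (1 / det A) *\<^sub>R vector [vector [A$2$2, - A$1$2], vector [- A$2$1, A$1$1]]"
    (is "_ = ?B")
  unfolding matrix_inv_def
proof (rule some_equality)
  let ?C = "vector [vector [A$2$2, - A$1$2], vector [- A$2$1, A$1$1]] :: real^2^2"
  have "A ** ?C = det A *\<^sub>R mat 1" "?C ** A = det A *\<^sub>R mat 1"
    by (simp_all add: matrix_matrix_mult_def mat_def vec_eq_iff forall_2 sum_2 det_2)
  then have "A ** ?B = mat 1" "?B ** A = mat 1"
    using assms by (simp_all only: matrix_scalar_ac scalar_matrix_assoc[symmetric]) simp_all
  then show *: "A ** ?B = mat 1 \<and> ?B ** A = mat 1" ..
  fix B assume B: "A ** B = mat 1 \<and> B ** A = mat 1"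
  have "B = B ** (A ** ?B)"
    using * by simp
  also have "\<dots> = (B ** A) ** ?B"
    by (rule matrix_mul_assoc)
  also have "\<dots> = ?B"
    using B by simp
  finally show "B = ?B" .
qed

lemma matrix_inv_right:
  fixes A :: "real^'n^'n"
  assumes "det A \<noteq> 0"
  shows "A ** matrix_inv A = mat 1"
proof -
  have "\<exists>B. A ** B = mat 1 \<and> B ** A = mat 1"
    using assms unfolding invertible_det_nz[symmetric] invertible_def .
  from someI_ex[OF this] show ?thesis
    unfolding matrix_inv_def by (rule conjunct1)
qed


section \<open>The Levi-Civita connection in a coordinate domain\<close>

lemma has_derivative_fst_compose:
  assumes "(f has_derivative f') (at (fst q) within S)"
  shows "((\<lambda>q. f (fst q)) has_derivative (\<lambda>h. f' (fst h))) (at q within S \<times> (UNIV :: 'b::real_normed_vector set))"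
  by (rule has_derivative_in_compose[OF has_derivative_fst[OF has_derivative_ident]])
     (use assms in simp)

locale metric_patch =
  fixes S :: "(real^2) set" and G :: "real^2 \<Rightarrow> real^2^2"
  assumes S: "openin (top_of_set half_plane) S"
    and smooth: "smooth_on S G"
    and metric: "z \<in> S \<Longrightarrow> inner_product_matrix (G z)"
begin

definition dG :: "real^2 \<Rightarrow> real^2 \<Rightarrow> real^2^2" where
  "dG y = frechet_derivative G (at y within S)"

lemma has_derivative_G: "y \<in> S \<Longrightarrow> (G has_derivative dG y) (at y within S)"
  unfolding dG_def by (drule smooth_on_half_plane_derivatives[OF S smooth]) (elim exE conjE)

lemma has_derivative_dG: "y \<in> S \<Longrightarrow> \<exists>D. ((\<lambda>z. dG z e) has_derivative D) (at y within S)"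
  unfolding dG_def by (drule smooth_on_half_plane_derivatives[OF S smooth]) (elim exE conjE, intro exI, erule spec)

text \<open>
  Identities between functions on \<open>S\<close> may be differentiated, even at boundary points. All the
  compatibility statements below arise in this way.
\<close>
lemma derivative_unique:
  assumes "y \<in> S" and "(f has_derivative f') (at y within S)" "(g has_derivative g') (at y within S)"
    and "\<And>z. z \<in> S \<Longrightarrow> f z = g z"
  shows "f' = g'"
proof (rule has_derivative_unique_half_plane[OF S assms(1)])
  show "(g has_derivative f') (at y within S)"
    by (rule has_derivative_transform[OF assms(1) _ assms(2)]) (simp add: assms(4))
qed fact

lemma dG_commute:
  assumes "y \<in> S" shows "bform (dG y e) a b = bform (dG y e) b a"
  using derivative_unique[OF assms
      has_derivative_bform[OF has_derivative_G[OF assms] has_derivative_const has_derivative_const, of a b]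
      has_derivative_bform[OF has_derivative_G[OF assms] has_derivative_const has_derivative_const, of b a]]
    bform_commute[OF metric] by (simp add: fun_eq_iff bform_linear)

lemma pd_G: "y \<in> S \<Longrightarrow> pd S i (\<lambda>z. G z $ j $ l) y = dG y (axis i 1) $ j $ l"
  by (rule pd_eq[OF S]) (auto intro!: has_derivative_vec_nth has_derivative_G)

abbreviation Gam :: "real^2 \<Rightarrow> real^2 \<Rightarrow> real^2 \<Rightarrow> real^2" where
  "Gam \<equiv> christoffel_vec S G"

text \<open>The Koszul formula for coordinate fields with constant components.\<close>
lemma bform_christoffel_vec:
  assumes y: "y \<in> S"
  shows "bform (G y) (Gam y u w) z
    = (bform (dG y u) w z + bform (dG y w) u z - bform (dG y z) u w) / 2"
proof -
  define T where "T i j l = dG y (axis i 1) $ j $ l + dG y (axis j 1) $ i $ l - dG y (axis l 1) $ i $ j"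
    for i j l :: 2
  define t :: "real^2" where "t = (\<chi> l. (\<Sum>i\<in>UNIV. \<Sum>j\<in>UNIV. T i j l * u $ i * w $ j) / 2)"
  have lin: "linear (dG y)"
    using has_derivative_G[OF y] has_derivative_linear by blast
  have det: "det (G y) \<noteq> 0"
    using inner_product_matrix_det[OF metric[OF y]] by simp
  have "Gam y u w = matrix_inv (G y) *v t"
    by (simp add: christoffel_vec_def christoffel_def pd_G[OF y] T_def[symmetric] t_def
        matrix_vector_mult_def vec_eq_iff sum_2 algebra_simps add_divide_distrib)
  moreover have "G y *v (matrix_inv (G y) *v t) = t"
    by (simp add: matrix_vector_mul_assoc matrix_inv_right[OF det])
  ultimately have "G y *v Gam y u w = t"
    by simp
  then have "bform (G y) z (Gam y u w) = z \<bullet> t"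
    by (simp only: bform_def)
  also have "\<dots> = (bform (dG y u) w z + bform (dG y w) u z - bform (dG y z) u w) / 2"
    unfolding bform_2 linear_2[OF lin, of u] linear_2[OF lin, of w] linear_2[OF lin, of z]
    by (simp add: t_def T_def inner_vec_def sum_2 algebra_simps add_divide_distrib diff_divide_distrib)
  finally show ?thesis
    using bform_commute[OF metric[OF y]] by simp
qed

lemma bform_cancel:
  assumes "y \<in> S" and "\<And>z. bform (G y) a z = bform (G y) b z"
  shows "a = b"
proof (rule ccontr)
  assume "a \<noteq> b"
  then have "0 < bform (G y) (a - b) (a - b)"
    using bform_pos[OF metric[OF assms(1)]] by simp
  then show False
    using assms(2)[of "a - b"] by (simp add: bform_linear)
qed

lemma christoffel_vec_commute: "y \<in> S \<Longrightarrow> Gam y u w = Gam y w u"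
  by (rule bform_cancel) (auto simp: bform_christoffel_vec dG_commute)

text \<open>The metric is parallel: add the Koszul formulas for \<open>\<Gamma>(e, a)\<close> and \<open>\<Gamma>(e, b)\<close>.\<close>
lemma metric_compatible:
  assumes y: "y \<in> S"
  shows "bform (dG y e) a b = bform (G y) (Gam y e a) b + bform (G y) a (Gam y e b)"
  using bform_commute[OF metric[OF y], of a "Gam y e b"]
  by (simp add: bform_christoffel_vec[OF y] dG_commute[OF y, of _ b a] dG_commute[OF y, of _ e a]
      dG_commute[OF y, of _ e b] field_simps)

lemma christoffel_vec_linear:
  "Gam y (u + u') w = Gam y u w + Gam y u' w" "Gam y u (w + w') = Gam y u w + Gam y u w'"
  "Gam y (r *\<^sub>R u) w = r *\<^sub>R Gam y u w" "Gam y u (r *\<^sub>R w) = r *\<^sub>R Gam y u w"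
  "Gam y (- u) w = - Gam y u w" "Gam y u (- w) = - Gam y u w"
  "Gam y (u - u') w = Gam y u w - Gam y u' w" "Gam y u (w - w') = Gam y u w - Gam y u w'"
  by (simp_all add: christoffel_vec_def vec_eq_iff sum_2 algebra_simps)

lemma rot_coord_differentiable:
  assumes y: "y \<in> S"
  shows "\<exists>D. ((\<lambda>z. rot_coord (G z) w) has_derivative D) (at y within S)"
proof -
  have 1: "((\<lambda>z. det (G z)) has_derivative (\<lambda>h. dG y h $1$1 * G y $2$2 + G y $1$1 * dG y h $2$2
      - (dG y h $1$2 * G y $2$1 + G y $1$2 * dG y h $2$1))) (at y within S)"
    unfolding det_2
    by (rule derivative_eq_intros has_derivative_vec_nth has_derivative_G y refl)+ (simp add: algebra_simps)
  have "\<exists>D. ((\<lambda>r. 1 / sqrt r) has_real_derivative D) (at (det (G y)))"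
    using inner_product_matrix_det[OF metric[OF y]]
    by (intro exI) (rule derivative_eq_intros refl | simp)+
  then obtain D where 2: "((\<lambda>r. 1 / sqrt r) has_real_derivative D) (at (det (G y)))" ..
  have 3: "((\<lambda>z. 1 / sqrt (det (G z))) has_derivative (\<lambda>h. (dG y h $1$1 * G y $2$2 + G y $1$1 * dG y h $2$2
      - (dG y h $1$2 * G y $2$1 + G y $1$2 * dG y h $2$1)) * D)) (at y within S)"
    by (rule DERIV_compose_FDERIV[OF 2 1])
  have 4: "((\<lambda>z. (G z *v w) $ i) has_derivative (\<lambda>h. (dG y h *v w) $ i)) (at y within S)" for i
    unfolding matrix_vector_mult_def
    by (simp add: sum_2)
       ((rule derivative_eq_intros has_derivative_vec_nth has_derivative_G y refl)+, simp)
  have eq: "(\<lambda>z. rot_coord (G z) w) = (\<lambda>z. (1 / sqrt (det (G z))) *\<^sub>R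
      (- (G z *v w) $ 2 *\<^sub>R axis 1 1 + (G z *v w) $ 1 *\<^sub>R axis 2 1))"
    by (simp add: rot_coord_def vec_eq_iff forall_2 axis_def fun_eq_iff)
  show ?thesis
    unfolding eq
    by (rule exI, rule has_derivative_scaleR[OF 3 has_derivative_add[OF
        has_derivative_scaleR_left[OF has_derivative_minus[OF 4]]
        has_derivative_scaleR_left[OF 4]]])
qed

text \<open>
  The rotation is parallel: \<open>K w = (\<nabla>\<^sub>e J) w\<close> vanishes. Differentiating \<open>g(J w, w) = 0\<close> and
  \<open>g(J w, J w) = g(w, w)\<close> for a constant \<open>w\<close>, and using that the metric is parallel, shows that \<open>K w\<close> is
  orthogonal to \<open>w\<close> and to \<open>J w\<close>. No derivative of the explicit formula for \<open>J\<close> has to be computed.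
\<close>
lemma rot_coord_parallel:
  assumes y: "y \<in> S"
  shows "((\<lambda>z. rot_coord (G z) w) has_derivative
    (\<lambda>e. rot_coord (G y) (Gam y e w) - Gam y e (rot_coord (G y) w))) (at y within S)"
proof (cases "w = 0")
  case True
  then show ?thesis
    using christoffel_vec_linear(4)[of y _ 0 0] by (simp add: rot_coord_linear)
next
  case False
  obtain D where D: "((\<lambda>z. rot_coord (G z) w) has_derivative D) (at y within S)"
    using rot_coord_differentiable[OF y] by blast
  note Gy = metric[OF y]
  have "D e = rot_coord (G y) (Gam y e w) - Gam y e (rot_coord (G y) w)" for e
  proof -
    define J where "J = rot_coord (G y)"
    define K where "K = D e + Gam y e (J w) - J (Gam y e w)"
    have "((\<lambda>z. bform (G z) (rot_coord (G z) w) w) has_derivative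
        (\<lambda>e. bform (dG y e) (J w) w + bform (G y) (D e) w + bform (G y) (J w) 0)) (at y within S)"
      unfolding J_def by (rule has_derivative_bform[OF has_derivative_G[OF y] D has_derivative_const])
    from derivative_unique[OF y this has_derivative_const[of 0]]
    have "\<forall>e. bform (dG y e) (J w) w + bform (G y) (D e) w = 0"
      by (simp add: rot_coord_orthogonal[OF metric] fun_eq_iff bform_linear)
    then have "bform (dG y e) (J w) w + bform (G y) (D e) w = 0" ..
    moreover have "bform (G y) (J w) (Gam y e w) = - bform (G y) (J (Gam y e w)) w"
      unfolding J_def using rot_coord_skew[OF Gy] bform_commute[OF Gy] by metis
    ultimately have 1: "bform (G y) K w = 0"
      by (simp add: metric_compatible[OF y] K_def bform_linear)
    have "((\<lambda>z. bform (G z) (rot_coord (G z) w) (rot_coord (G z) w)) has_derivative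
        (\<lambda>e. bform (dG y e) (J w) (J w) + bform (G y) (D e) (J w) + bform (G y) (J w) (D e)))
        (at y within S)"
      unfolding J_def by (rule has_derivative_bform[OF has_derivative_G[OF y] D D])
    from derivative_unique[OF y this has_derivative_bform[OF has_derivative_G[OF y]
          has_derivative_const has_derivative_const, of w w]]
    have "\<forall>e. bform (dG y e) (J w) (J w) + bform (G y) (D e) (J w) + bform (G y) (J w) (D e)
        = bform (dG y e) w w"
      by (simp add: rot_coord_isometry[OF metric] fun_eq_iff bform_linear)
    then have "bform (dG y e) (J w) (J w) + bform (G y) (D e) (J w) + bform (G y) (J w) (D e)
        = bform (dG y e) w w" ..
    then have "bform (dG y e) (J w) (J w) + 2 * bform (G y) (D e) (J w) = bform (dG y e) w w"
      using bform_commute[OF Gy, of "J w" "D e"] by simp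
    moreover have "bform (G y) (Gam y e w) w = bform (G y) (J (Gam y e w)) (J w)"
      unfolding J_def by (simp add: rot_coord_isometry[OF Gy])
    ultimately have 2: "bform (G y) K (J w) = 0"
      using bform_commute[OF Gy, of w "Gam y e w"] bform_commute[OF Gy, of "J w" "Gam y e (J w)"]
      by (simp add: metric_compatible[OF y] K_def bform_linear)
    have "K = 0"
      using eq_zero_if_orthogonal[OF Gy 1 _ False] 2 by (simp add: J_def)
    then show ?thesis
      by (simp add: K_def J_def algebra_simps)
  qed
  then have "D = (\<lambda>e. rot_coord (G y) (Gam y e w) - Gam y e (rot_coord (G y) w))"
    by (rule ext)
  then show ?thesis
    using D by (simp only:)
qed

text \<open>The same on the tangent bundle: \<open>snd h + \<Gamma>(fst h, w)\<close> is the vertical part of the vector \<open>h\<close>.\<close>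
lemma rot_coord_bundle_derivative:
  assumes q: "fst q \<in> S"
  shows "((\<lambda>q. rot_coord (G (fst q)) (snd q)) has_derivative
    (\<lambda>h. rot_coord (G (fst q)) (snd h + Gam (fst q) (fst h) (snd q))
      - Gam (fst q) (fst h) (rot_coord (G (fst q)) (snd q)))) (at q within S \<times> UNIV)"
proof -
  define J where "J z i = rot_coord (G z) (axis i 1)" for z i
  define J' where "J' h i = rot_coord (G (fst q)) (Gam (fst q) h (axis i 1)) - Gam (fst q) h (J (fst q) i)" for h i
  have expand: "rot_coord (G z) w = w$1 *\<^sub>R J z 1 + w$2 *\<^sub>R J z 2" for z w
    unfolding J_def by (rule linear_2[OF linear_rot_coord])
  have J: "((\<lambda>q. J (fst q) i) has_derivative (\<lambda>h. J' (fst h) i)) (at q within S \<times> UNIV)" for i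
    unfolding J_def J'_def by (rule has_derivative_fst_compose[OF rot_coord_parallel[OF q]])
  have "((\<lambda>q. snd q $ 1 *\<^sub>R J (fst q) 1 + snd q $ 2 *\<^sub>R J (fst q) 2) has_derivative
    (\<lambda>h. (snd q $ 1 *\<^sub>R J' (fst h) 1 + snd h $ 1 *\<^sub>R J (fst q) 1)
      + (snd q $ 2 *\<^sub>R J' (fst h) 2 + snd h $ 2 *\<^sub>R J (fst q) 2))) (at q within S \<times> UNIV)"
    by (intro has_derivative_add has_derivative_scaleR J has_derivative_vec_nth has_derivative_snd
        has_derivative_ident)
  moreover have "(snd q $ 1 *\<^sub>R J' (fst h) 1 + snd h $ 1 *\<^sub>R J (fst q) 1)
      + (snd q $ 2 *\<^sub>R J' (fst h) 2 + snd h $ 2 *\<^sub>R J (fst q) 2)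
    = rot_coord (G (fst q)) (snd h + Gam (fst q) (fst h) (snd q))
      - Gam (fst q) (fst h) (rot_coord (G (fst q)) (snd q))" for h
  proof -
    have "linear (\<lambda>w. rot_coord (G (fst q)) (Gam (fst q) (fst h) w))"
      by (intro linearI) (simp_all add: christoffel_vec_linear rot_coord_linear)
    then have "rot_coord (G (fst q)) (Gam (fst q) (fst h) (snd q))
       = snd q$1 *\<^sub>R rot_coord (G (fst q)) (Gam (fst q) (fst h) (axis 1 1))
       + snd q$2 *\<^sub>R rot_coord (G (fst q)) (Gam (fst q) (fst h) (axis 2 1))"
      by (rule linear_2)
    moreover have "Gam (fst q) (fst h) (rot_coord (G (fst q)) (snd q))
       = snd q$1 *\<^sub>R Gam (fst q) (fst h) (J (fst q) 1) + snd q$2 *\<^sub>R Gam (fst q) (fst h) (J (fst q) 2)"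
      by (simp only: expand[of _ "snd q"] christoffel_vec_linear)
    moreover have "rot_coord (G (fst q)) (snd h) = snd h $ 1 *\<^sub>R J (fst q) 1 + snd h $ 2 *\<^sub>R J (fst q) 2"
      by (rule expand)
    ultimately show ?thesis
      by (simp add: J'_def rot_coord_linear algebra_simps)
  qed
  moreover have "(\<lambda>q. rot_coord (G (fst q)) (snd q))
      = (\<lambda>q. snd q $ 1 *\<^sub>R J (fst q) 1 + snd q $ 2 *\<^sub>R J (fst q) 2)"
    by (rule ext) (rule expand)
  ultimately show ?thesis
    by (simp only:)
qed

lemma matrix_inv_differentiable:
  assumes y: "y \<in> S"
  shows "(\<lambda>z. matrix_inv (G z) $ k $ l) differentiable (at y within S)"
proof -
  define B where "B z = (vector [vector [G z$2$2, - G z$1$2], vector [- G z$2$1, G z$1$1]] :: real^2^2)" for z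
  have G: "(\<lambda>z. G z $ i $ j) differentiable (at y within S)" for i j
    using has_derivative_G[OF y] by (intro differentiable_vec_nth differentiableI)
  have "(\<lambda>z. det (G z)) differentiable (at y within S)"
    unfolding det_2 by (intro differentiable_diff differentiable_mult G)
  moreover have "(\<lambda>z. B z $ k $ l) differentiable (at y within S)"
  proof -
    consider "k = 1" "l = 1" | "k = 1" "l = 2" | "k = 2" "l = 1" | "k = 2" "l = 2"
      using exhaust_2[of k] exhaust_2[of l] by blast
    then show ?thesis
      by cases (simp_all add: B_def G differentiable_minus)
  qed
  moreover have "det (G y) \<noteq> 0"
    using inner_product_matrix_det[OF metric[OF y]] by simp
  ultimately have "(\<lambda>z. B z $ k $ l / det (G z)) differentiable (at y within S)"
    by (intro differentiable_divide)
  then show ?thesis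
  proof (rule differentiable_transform_within[OF _ zero_less_one y])
    fix z assume "z \<in> S"
    then have "det (G z) \<noteq> 0"
      using inner_product_matrix_det[OF metric] by (metis less_irrefl)
    then show "B z $ k $ l / det (G z) = matrix_inv (G z) $ k $ l"
      by (simp add: matrix_inv_2 B_def)
  qed
qed

lemma christoffel_differentiable:
  assumes y: "y \<in> S"
  shows "christoffel S G k i j differentiable (at y within S)"
proof -
  have dG: "(\<lambda>z. dG z e $ j $ l) differentiable (at y within S)" for e j l
    using has_derivative_dG[OF y, of e] by (intro differentiable_vec_nth) (simp add: differentiable_def)
  have "(\<lambda>z. (1/2) * (\<Sum>l\<in>UNIV. matrix_inv (G z) $ k $ l *
      (dG z (axis i 1) $ j $ l + dG z (axis j 1) $ i $ l - dG z (axis l 1) $ i $ j)))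
      differentiable (at y within S)"
    unfolding sum_2
    by (intro differentiable_mult differentiable_add differentiable_diff differentiable_const
        matrix_inv_differentiable y dG)
  then show ?thesis
    by (rule differentiable_transform_within[OF _ zero_less_one y]) (simp add: christoffel_def pd_G)
qed

text \<open>
  Only vertical directions matter for the bracket with \<open>V\<close>, so the derivative \<open>C\<close> in the base directions
  is left unspecified; it is the reason why the Christoffel symbols have to be differentiable.
\<close>
lemma christoffel_bundle_derivative:
  assumes q: "fst q \<in> S"
  shows "\<exists>C. ((\<lambda>q. Gam (fst q) (snd q) (snd q)) has_derivative
    (\<lambda>h. C (fst h) + 2 *\<^sub>R Gam (fst q) (snd q) (snd h))) (at q within S \<times> UNIV) \<and> C 0 = 0"
proof -
  define D where "D k i j = frechet_derivative (christoffel S G k i j) (at (fst q) within S)" for k i j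
  have D: "(christoffel S G k i j has_derivative D k i j) (at (fst q) within S)" for k i j
    unfolding D_def using christoffel_differentiable[OF q] by (simp add: frechet_derivative_works[symmetric])
  have D': "((\<lambda>q. christoffel S G k i j (fst q)) has_derivative (\<lambda>h. D k i j (fst h))) (at q within S \<times> UNIV)" for k i j
    by (rule has_derivative_fst_compose[OF D])
  define C :: "real^2 \<Rightarrow> real^2" where
    "C h = (\<chi> k. \<Sum>i\<in>UNIV. \<Sum>j\<in>UNIV. D k i j h * snd q $ i * snd q $ j)" for h
  define F where "F k q = (\<Sum>i\<in>UNIV. \<Sum>j\<in>UNIV. christoffel S G k i j (fst q) * snd q $ i * snd q $ j)"
    for k and q :: "(real^2) \<times> (real^2)"
  have F: "(F k has_derivative (\<lambda>h. \<Sum>i\<in>UNIV. \<Sum>j\<in>UNIV.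
      christoffel S G k i j (fst q) * snd q $ i * snd h $ j
      + (christoffel S G k i j (fst q) * snd h $ i + D k i j (fst h) * snd q $ i) * snd q $ j))
      (at q within S \<times> UNIV)" for k
    unfolding F_def
    by (intro has_derivative_sum has_derivative_mult D' has_derivative_vec_nth has_derivative_snd
        has_derivative_ident)
  define F' where "F' k h = (\<Sum>i\<in>UNIV. \<Sum>j\<in>UNIV.
      christoffel S G k i j (fst q) * snd q $ i * snd h $ j
      + (christoffel S G k i j (fst q) * snd h $ i + D k i j (fst h) * snd q $ i) * snd q $ j)"
    for k and h :: "(real^2) \<times> (real^2)"
  have "((\<lambda>q. F 1 q *\<^sub>R axis 1 1 + F 2 q *\<^sub>R axis 2 1 :: real^2) has_derivative
     (\<lambda>h. F' 1 h *\<^sub>R axis 1 1 + F' 2 h *\<^sub>R axis 2 1)) (at q within S \<times> UNIV)"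
    unfolding F'_def by (intro has_derivative_add has_derivative_scaleR_left F)
  moreover have "(\<lambda>q. F 1 q *\<^sub>R axis 1 1 + F 2 q *\<^sub>R axis 2 1) = (\<lambda>q. Gam (fst q) (snd q) (snd q))"
    by (rule ext) (simp add: F_def christoffel_vec_def vec_eq_iff forall_2 axis_def)
  moreover have "(\<lambda>h. F' 1 h *\<^sub>R axis 1 1 + F' 2 h *\<^sub>R axis 2 1)
      = (\<lambda>h. C (fst h) + 2 *\<^sub>R Gam (fst q) (snd q) (snd h))"
  proof
    fix h :: "(real^2) \<times> (real^2)"
    have "C (fst h) + 2 *\<^sub>R Gam (fst q) (snd q) (snd h)
      = C (fst h) + Gam (fst q) (snd q) (snd h) + Gam (fst q) (snd h) (snd q)"
      using christoffel_vec_commute[OF q, of "snd h" "snd q"] by (simp add: scaleR_2)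
    then show "F' 1 h *\<^sub>R axis 1 1 + F' 2 h *\<^sub>R axis 2 1
        = C (fst h) + 2 *\<^sub>R Gam (fst q) (snd q) (snd h)"
      by (simp add: F'_def C_def christoffel_vec_def vec_eq_iff forall_2 axis_def sum_2 algebra_simps)
  qed
  moreover have "C 0 = 0"
  proof -
    have "D k i j 0 = 0" for k i j
      by (rule linear_0) (rule has_derivative_linear[OF D])
    then show ?thesis
      by (simp add: C_def vec_eq_iff)
  qed
  ultimately show ?thesis
    by (intro exI[of _ C]) (simp only: simp_thms)
qed

end


section \<open>Transition maps and tangent vectors\<close>

locale oriented_riemannian =
  fixes M :: "'a surface"
  assumes oriented_riemannian: "oriented_riemannian_surface M"
begin

lemma chart_at: "c \<in> charts_at M x \<Longrightarrow> c \<in> atlas M" "c \<in> charts_at M x \<Longrightarrow> x \<in> fst c"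
  by (auto simp: charts_at_def)

lemma is_chart: "c \<in> atlas M \<Longrightarrow> is_chart (points M) c"
  using oriented_riemannian by (simp add: oriented_riemannian_surface_def oriented_surface_def)

lemma openin_chart: "c \<in> atlas M \<Longrightarrow> openin (points M) (fst c)"
  using is_chart by (simp add: is_chart_def)

lemma openin_chart_image: "c \<in> atlas M \<Longrightarrow> openin (top_of_set half_plane) (chart_image c)"
  using is_chart by (simp add: is_chart_def)

lemma inj_on_chart: "c \<in> atlas M \<Longrightarrow> inj_on (snd c) (fst c)"
  using is_chart[of c] openin_chart[of c] openin_subset[of "points M" "fst c"]
    homeomorphic_imp_injective_map[of "subtopology (points M) (fst c)" _ "snd c"]
  by (auto simp: is_chart_def Int_absorb1)

lemma openin_image:
  assumes c: "c \<in> atlas M" and U: "openin (points M) U" "U \<subseteq> fst c"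
  shows "openin (top_of_set half_plane) (snd c ` U)"
proof -
  have "openin (subtopology (points M) (fst c)) U"
    using U openin_chart[OF c] by (simp add: openin_open_subtopology)
  then have "openin (top_of_set (chart_image c)) (snd c ` U)"
    using is_chart[OF c] homeomorphic_imp_open_map by (auto simp: is_chart_def open_map_def)
  then show ?thesis
    using openin_chart_image[OF c] openin_trans by blast
qed

lemma openin_overlap:
  "c \<in> atlas M \<Longrightarrow> c' \<in> atlas M \<Longrightarrow> openin (top_of_set half_plane) (overlap c c')"
  unfolding overlap_def by (intro openin_image openin_Int openin_chart) auto

lemma metric_patch: "c \<in> atlas M \<Longrightarrow> metric_patch (chart_image c) (metric M c)"
  using oriented_riemannian openin_chart_image
  by unfold_locales
     (auto simp: oriented_riemannian_surface_def riemannian_metric_def inner_product_matrix_def)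

lemma transition: "c \<in> atlas M \<Longrightarrow> x \<in> fst c \<Longrightarrow> transition c c' (snd c x) = snd c' x"
  by (simp add: transition_def inv_into_f_f inj_on_chart)

lemma metric_at: "c \<in> charts_at M x \<Longrightarrow> inner_product_matrix (metric M c (snd c x))"
  using metric_patch.metric[OF metric_patch] chart_at by blast

lemma transition_derivatives:
  assumes c: "c \<in> atlas M" "c' \<in> atlas M" and y: "y \<in> overlap c c'"
  shows "\<exists>f''. (transition c c' has_derivative d_transition c c' y) (at y within overlap c c') \<and>
    (\<forall>e. ((\<lambda>z. d_transition c c' z e) has_derivative (\<lambda>d. f'' d e)) (at y within overlap c c')) \<and>
    (\<forall>\<beta>::real^2 \<Rightarrow> real. bounded_linear \<beta> \<longrightarrow> (\<forall>u w. \<beta> (f'' u w) = \<beta> (f'' w u)))"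
proof -
  have "smooth_on (overlap c c') (transition c c')"
    using oriented_riemannian c
    by (simp add: oriented_riemannian_surface_def oriented_surface_def)
  from smooth_on_half_plane_derivatives[OF openin_overlap[OF c] this y]
  show ?thesis
    unfolding d_transition_def .
qed

text \<open>The second derivative of the transition map at \<open>y\<close>, in the directions \<open>d\<close> and \<open>e\<close>.\<close>
definition d2_transition :: "'a chart \<Rightarrow> 'a chart \<Rightarrow> real^2 \<Rightarrow> real^2 \<Rightarrow> real^2 \<Rightarrow> real^2" where
  "d2_transition c c' y d e
    = frechet_derivative (\<lambda>z. d_transition c c' z e) (at y within overlap c c') d"

lemma
  assumes c: "c \<in> charts_at M x" "c' \<in> charts_at M x"
  shows has_derivative_transition:
      "(transition c c' has_derivative d_transition c c' (snd c x)) (at (snd c x) within overlap c c')"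
    and has_derivative_d_transition:
      "((\<lambda>z. d_transition c c' z e) has_derivative (\<lambda>d. d2_transition c c' (snd c x) d e))
        (at (snd c x) within overlap c c')"
    and d2_transition_commute: "d2_transition c c' (snd c x) u w = d2_transition c c' (snd c x) w u"
proof -
  have c': "c \<in> atlas M" "c' \<in> atlas M"
    using c chart_at by blast+
  have y: "snd c x \<in> overlap c c'"
    using c chart_at(2) by (auto simp: overlap_def)
  obtain f'' where 1: "(transition c c' has_derivative d_transition c c' (snd c x)) (at (snd c x) within overlap c c')"
    and 2: "\<forall>e. ((\<lambda>z. d_transition c c' z e) has_derivative (\<lambda>d. f'' d e)) (at (snd c x) within overlap c c')"
    and 3: "\<forall>\<beta>::real^2 \<Rightarrow> real. bounded_linear \<beta> \<longrightarrow> (\<forall>u w. \<beta> (f'' u w) = \<beta> (f'' w u))"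
    using transition_derivatives[OF c' y] by (elim exE conjE)
  have eq: "d2_transition c c' (snd c x) d e = f'' d e" for d e
    unfolding d2_transition_def
    using frechet_derivative_half_plane[OF openin_overlap[OF c'] y] 2 by metis
  show "(transition c c' has_derivative d_transition c c' (snd c x)) (at (snd c x) within overlap c c')"
    by (rule 1)
  show "((\<lambda>z. d_transition c c' z e) has_derivative (\<lambda>d. d2_transition c c' (snd c x) d e))
        (at (snd c x) within overlap c c')"
    unfolding eq using 2 by blast
  show "d2_transition c c' (snd c x) u w = d2_transition c c' (snd c x) w u"
    unfolding eq vec_eq_iff using 3 bounded_linear_vec_nth by blast
qed

lemma linear_d_transition:
  "c \<in> charts_at M x \<Longrightarrow> c' \<in> charts_at M x \<Longrightarrow> linear (d_transition c c' (snd c x))"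
  using has_derivative_transition has_derivative_linear by blast

lemma d_transition_cocycle:
  assumes c: "c \<in> charts_at M x" "c' \<in> charts_at M x" "c'' \<in> charts_at M x"
  shows "d_transition c' c'' (snd c' x) (d_transition c c' (snd c x) w) = d_transition c c'' (snd c x) w"
proof -
  have at: "c \<in> atlas M" "c' \<in> atlas M" "c'' \<in> atlas M" and x: "x \<in> fst c" "x \<in> fst c'" "x \<in> fst c''"
    using c chart_at by blast+
  define U where "U = snd c ` (fst c \<inter> fst c' \<inter> fst c'')"
  have U: "openin (top_of_set half_plane) U"
    unfolding U_def by (intro openin_image openin_Int openin_chart at) auto
  have y: "snd c x \<in> U"
    using x by (auto simp: U_def)
  have sub: "U \<subseteq> overlap c c'" "U \<subseteq> overlap c c''" "transition c c' ` U \<subseteq> overlap c' c''"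
    using transition[OF at(1), of _ c'] by (auto simp: U_def overlap_def)
  have 1: "(transition c c' has_derivative d_transition c c' (snd c x)) (at (snd c x) within U)"
    by (rule has_derivative_subset[OF has_derivative_transition[OF c(1,2)] sub(1)])
  have 2: "(transition c' c'' has_derivative d_transition c' c'' (snd c' x))
      (at (transition c c' (snd c x)) within transition c c' ` U)"
    unfolding transition[OF at(1) x(1)]
    by (rule has_derivative_subset[OF has_derivative_transition[OF c(2,3)] sub(3)])
  have 3: "((\<lambda>z. transition c' c'' (transition c c' z)) has_derivative
      (\<lambda>w. d_transition c' c'' (snd c' x) (d_transition c c' (snd c x) w))) (at (snd c x) within U)"
    by (rule has_derivative_in_compose[OF 1 2])
  have "((\<lambda>z. transition c' c'' (transition c c' z)) has_derivative d_transition c c'' (snd c x))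
      (at (snd c x) within U)"
    by (rule has_derivative_transform[OF y _ has_derivative_subset[OF has_derivative_transition[OF c(1,3)] sub(2)]])
       (auto simp: U_def transition at)
  from has_derivative_unique_half_plane[OF U y 3 this] show ?thesis
    by (rule fun_cong)
qed

lemma d_transition_self:
  assumes c: "c \<in> charts_at M x"
  shows "d_transition c c (snd c x) w = w"
proof -
  have at: "c \<in> atlas M" and x: "x \<in> fst c"
    using c chart_at by blast+
  have y: "snd c x \<in> overlap c c"
    using x by (auto simp: overlap_def)
  have "(transition c c has_derivative (\<lambda>w. w)) (at (snd c x) within overlap c c)"
    by (rule has_derivative_transform[OF y _ has_derivative_ident])
       (auto simp: overlap_def transition at)
  from has_derivative_unique_half_plane[OF openin_overlap[OF at at] y has_derivative_transition[OF c c] this]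
  show ?thesis
    by (rule fun_cong)
qed

lemma metric_transition:
  assumes c: "c \<in> charts_at M x" "c' \<in> charts_at M x"
  shows "bform (metric M c (snd c x)) u w
    = bform (metric M c' (snd c' x)) (d_transition c c' (snd c x) u) (d_transition c c' (snd c x) w)"
proof -
  have at: "c \<in> atlas M" "c' \<in> atlas M" and x: "x \<in> fst c" "x \<in> fst c'"
    using c chart_at by blast+
  have y: "snd c x \<in> overlap c c'"
    using x by (auto simp: overlap_def)
  have "riemannian_metric M"
    using oriented_riemannian by (simp add: oriented_riemannian_surface_def)
  from conjunct2[OF this[unfolded riemannian_metric_def]]
  have "\<forall>u w. bform (metric M c (snd c x)) u w = bform (metric M c' (transition c c' (snd c x)))
      (d_transition c c' (snd c x) u) (d_transition c c' (snd c x) w)"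
    using at y by (elim ballE) auto
  then show ?thesis
    unfolding transition[OF at(1) x(1)] by (elim allE)
qed

lemma det_d_transition:
  assumes c: "c \<in> charts_at M x" "c' \<in> charts_at M x"
  shows "0 < det (matrix (d_transition c c' (snd c x)))"
proof -
  have "c \<in> atlas M" "c' \<in> atlas M" "snd c x \<in> overlap c c'"
    using c chart_at by (auto simp: overlap_def)
  then show ?thesis
    using oriented_riemannian by (simp add: oriented_riemannian_surface_def oriented_surface_def)
qed

lemma chart_value_eq:
  assumes c: "c \<in> charts_at M x" and f: "\<And>c'. c' \<in> charts_at M x \<Longrightarrow> f c' = f c"
  shows "chart_value M x f = f c"
  unfolding chart_value_def
proof (rule the_equality)
  show "\<forall>c'\<in>charts_at M x. f c' = f c"
    using f by blast
  show "r = f c" if "\<forall>c'\<in>charts_at M x. f c' = r" for r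
    using bspec[OF that c] by (rule sym)
qed

lemma tangent_spaceD:
  "v \<in> tangent_space M x \<Longrightarrow> c \<in> charts_at M x \<Longrightarrow> c' \<in> charts_at M x \<Longrightarrow>
    v c' = d_transition c c' (snd c x) (v c)"
  unfolding tangent_space_def by blast

lemma tangent_space_outside: "v \<in> tangent_space M x \<Longrightarrow> c \<notin> charts_at M x \<Longrightarrow> v c = 0"
  unfolding tangent_space_def by blast

lemma tangent_spaceI:
  assumes "\<And>c c'. c \<in> charts_at M x \<Longrightarrow> c' \<in> charts_at M x \<Longrightarrow> v c' = d_transition c c' (snd c x) (v c)"
    and "\<And>c. c \<notin> charts_at M x \<Longrightarrow> v c = 0"
  shows "v \<in> tangent_space M x"
  unfolding tangent_space_def using assms by blast

lemma inner_g_eq: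
  assumes "u \<in> tangent_space M x" "w \<in> tangent_space M x" "c \<in> charts_at M x"
  shows "inner_g M x u w = bform (metric M c (snd c x)) (u c) (w c)"
  unfolding inner_g_def
proof (rule chart_value_eq[OF assms(3)])
  fix c' assume c': "c' \<in> charts_at M x"
  show "bform (metric M c' (snd c' x)) (u c') (w c') = bform (metric M c (snd c x)) (u c) (w c)"
    unfolding metric_transition[OF assms(3) c', of "u c" "w c"] tangent_spaceD[OF assms(1,3) c']
      tangent_spaceD[OF assms(2,3) c'] ..
qed

lemma tangent_space_lincomb:
  assumes "u \<in> tangent_space M x" "w \<in> tangent_space M x"
  shows "(\<lambda>c. r *\<^sub>R u c + q *\<^sub>R w c) \<in> tangent_space M x"
proof (rule tangent_spaceI)
  fix c c' assume c: "c \<in> charts_at M x" "c' \<in> charts_at M x"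
  show "r *\<^sub>R u c' + q *\<^sub>R w c' = d_transition c c' (snd c x) (r *\<^sub>R u c + q *\<^sub>R w c)"
    unfolding linear_add[OF linear_d_transition[OF c]] linear_cmul[OF linear_d_transition[OF c]]
      tangent_spaceD[OF assms(1) c] tangent_spaceD[OF assms(2) c] ..
qed (simp add: tangent_space_outside[OF assms(1)] tangent_space_outside[OF assms(2)])

text \<open>The tangent vector at \<open>x\<close> with components \<open>w\<close> in the chart \<open>c\<close>.\<close>
definition tangent_vector :: "'a \<Rightarrow> 'a chart \<Rightarrow> real^2 \<Rightarrow> 'a tvec" where
  "tangent_vector x c w = (\<lambda>c'. if c' \<in> charts_at M x then d_transition c c' (snd c x) w else 0)"

lemma tangent_vector_in: "c \<in> charts_at M x \<Longrightarrow> tangent_vector x c w \<in> tangent_space M x"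
  by (rule tangent_spaceI) (simp_all add: tangent_vector_def d_transition_cocycle)

lemma tangent_vector_chart: "c \<in> charts_at M x \<Longrightarrow> tangent_vector x c w c = w"
  by (simp add: tangent_vector_def d_transition_self)

lemma tangent_space_eqI:
  assumes "u \<in> tangent_space M x" "w \<in> tangent_space M x" "c \<in> charts_at M x" "u c = w c"
  shows "u = w"
proof
  fix c' show "u c' = w c'"
    using tangent_spaceD[OF assms(1,3), of c'] tangent_spaceD[OF assms(2,3), of c'] assms(4)
      tangent_space_outside[OF assms(1), of c'] tangent_space_outside[OF assms(2), of c']
    by (cases "c' \<in> charts_at M x") simp_all
qed


section \<open>The boundary and its inward normal\<close>

lemma in_half_plane: "c \<in> charts_at M x \<Longrightarrow> 0 \<le> snd c x $ 2"
  using openin_imp_subset[OF openin_chart_image, of c] chart_at[of c x] by (auto simp: half_plane_def)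

lemma transition_2_nonneg:
  assumes "c \<in> atlas M" "c' \<in> atlas M" "z \<in> overlap c c'"
  shows "0 \<le> transition c c' z $ 2"
  using assms in_half_plane[of c'] transition[OF assms(1), of _ c'] by (auto simp: overlap_def charts_at_def)

text \<open>
  A boundary point of one chart is a boundary point of all charts. Otherwise the second component of a
  transition map would attain its minimum \<open>0\<close> at a point around which all directions are admissible,
  and its differential would vanish there, against the determinant being positive.
\<close>
lemma boundary_chart:
  assumes x: "x \<in> boundary M" and c': "c' \<in> charts_at M x"
  shows "snd c' x $ 2 = 0"
proof (rule ccontr)
  assume "snd c' x $ 2 \<noteq> 0"
  then have pos: "0 < snd c' x $ 2"
    using in_half_plane[OF c'] by simp
  obtain c where c: "c \<in> charts_at M x" "snd c x $ 2 = 0"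
    using x by (auto simp: boundary_def)
  have at: "c \<in> atlas M" "c' \<in> atlas M" and x: "x \<in> fst c" "x \<in> fst c'"
    using c c' chart_at by blast+
  have y: "snd c' x \<in> overlap c' c"
    using x by (auto simp: overlap_def)
  have nonneg: "0 \<le> d_transition c' c (snd c' x) d $ 2" for d
  proof (rule directional_derivative_nonneg[OF has_derivative_vec_nth[OF has_derivative_transition[OF c' c(1)]]])
    show "transition c' c (snd c' x) $ 2 \<le> transition c' c z $ 2" if "z \<in> overlap c' c" for z
      using transition_2_nonneg[OF at(2,1) that] c(2) transition[OF at(2) x(2)] by simp
    show "\<exists>e>0. \<forall>t. 0 \<le> t \<and> t < e \<longrightarrow> snd c' x + t *\<^sub>R d \<in> overlap c' c"
      using segment_in_half_plane_open[OF openin_overlap[OF at(2,1)] y] pos by blast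
  qed
  have "d_transition c' c (snd c' x) d $ 2 = 0" for d
    using nonneg[of d] nonneg[of "- d"] linear_neg[OF linear_d_transition[OF c' c(1)], of d] by simp
  then show False
    using det_d_transition[OF c' c(1)] by (simp add: det_2 matrix_def)
qed

context
  fixes x c c'
  assumes x: "x \<in> boundary M" and c: "c \<in> charts_at M x" and c': "c' \<in> charts_at M x"
begin

text \<open>
  Transition maps send the half plane to itself and boundary points to boundary points, so their
  differentials at the boundary preserve the inward and the tangential directions.
\<close>
lemma d_transition_2_nonneg: "0 \<le> d $ 2 \<Longrightarrow> 0 \<le> d_transition c c' (snd c x) d $ 2"
proof (rule directional_derivative_nonneg[OF has_derivative_vec_nth[OF has_derivative_transition[OF c c']]])
  have at: "c \<in> atlas M" "c' \<in> atlas M" and x': "x \<in> fst c" "x \<in> fst c'"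
    using c c' chart_at by blast+
  show "transition c c' (snd c x) $ 2 \<le> transition c c' z $ 2" if "z \<in> overlap c c'" for z
    using transition_2_nonneg[OF at that] boundary_chart[OF x c'] transition[OF at(1) x'(1)] by simp
  assume "0 \<le> d $ 2"
  moreover have "snd c x \<in> overlap c c'"
    using x' by (auto simp: overlap_def)
  ultimately show "\<exists>e>0. \<forall>t. 0 \<le> t \<and> t < e \<longrightarrow> snd c x + t *\<^sub>R d \<in> overlap c c'"
    using segment_in_half_plane_open[OF openin_overlap[OF at]] by blast
qed

lemma d_transition_tangential: "d $ 2 = 0 \<Longrightarrow> d_transition c c' (snd c x) d $ 2 = 0"
  using d_transition_2_nonneg[of d] d_transition_2_nonneg[of "- d"]
    linear_neg[OF linear_d_transition[OF c c'], of d] by simp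

lemma d_transition_inward:
  assumes d: "0 < d $ 2"
  shows "0 < d_transition c c' (snd c x) d $ 2"
proof -
  have "d_transition c c' (snd c x) (axis 1 1) $ 2 = 0"
    by (rule d_transition_tangential) (simp add: axis_def)
  moreover from this have "d_transition c c' (snd c x) (axis 2 1) $ 2 \<noteq> 0"
    using det_d_transition[OF c c'] by (auto simp: det_2 matrix_def)
  moreover have "0 \<le> d_transition c c' (snd c x) (axis 2 1) $ 2"
    by (rule d_transition_2_nonneg) (simp add: axis_def)
  ultimately show ?thesis
    using d by (subst linear_2[OF linear_d_transition[OF c c']]) simp
qed

end

text \<open>
  In a chart the normal is the rotated unit vector in the direction of the boundary. Its
  transport to the other charts points inward there, and it is the only candidate because in
  the plane a unit vector orthogonal to the boundary is determined up to its sign.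
\<close>
lemma inward_normal:
  assumes x: "x \<in> boundary M"
  shows "inward_normal M x \<in> tangent_space M x" "inner_g M x (inward_normal M x) (inward_normal M x) = 1"
    and "\<And>u. u \<in> boundary_tangent_space M x \<Longrightarrow> inner_g M x (inward_normal M x) u = 0"
    and "\<And>c. c \<in> charts_at M x \<Longrightarrow> 0 < inward_normal M x c $ 2"
proof -
  define P where "P n \<longleftrightarrow> n \<in> tangent_space M x \<and> inner_g M x n n = 1 \<and>
     (\<forall>u\<in>boundary_tangent_space M x. inner_g M x n u = 0) \<and>
     (\<forall>c\<in>charts_at M x. 0 < n c $ 2)" for n
  obtain c where c: "c \<in> charts_at M x"
    using x by (auto simp: boundary_def)
  define A where "A = metric M c (snd c x)"
  have A: "inner_product_matrix A"
    unfolding A_def by (rule metric_at[OF c])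
  define e :: "real^2" where "e = (1 / sqrt (bform A (axis 1 1) (axis 1 1))) *\<^sub>R axis 1 1"
  have e0: "(axis 1 1 :: real^2) \<noteq> 0"
    by (simp add: axis_eq_0_iff)
  have ee: "bform A e e = 1"
    using bform_pos[OF A e0] by (simp add: e_def bform_linear)
  have e1: "0 < e $ 1" "e $ 2 = 0"
    using bform_pos[OF A e0] by (simp_all add: e_def axis_def)
  define n0 where "n0 = rot_coord A e"
  have n02: "0 < n0 $ 2"
    unfolding n0_def rot_coord_components[OF A]
    using inner_product_matrix_det[OF A] inner_product_matrix_entry_pos[OF A] e1 by simp
  have tang: "d = (d $ 1 / e $ 1) *\<^sub>R e" if "d $ 2 = 0" for d :: "real^2"
    using that e1 by (simp add: vec_eq_iff forall_2)
  define n where "n = tangent_vector x c n0"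
  have nT: "n \<in> tangent_space M x" and nc: "n c = n0"
    by (simp_all add: n_def tangent_vector_in tangent_vector_chart c)
  have "P n"
    unfolding P_def
  proof (intro conjI ballI)
    show "inner_g M x n n = 1"
      unfolding inner_g_eq[OF nT nT c] nc A_def[symmetric] n0_def by (simp add: rot_coord_isometry[OF A] ee)
    show "inner_g M x n u = 0" if "u \<in> boundary_tangent_space M x" for u
    proof -
      have u: "u \<in> tangent_space M x" "u c $ 2 = 0"
        using that c by (auto simp: boundary_tangent_space_def)
      have "bform A n0 (u c) = 0"
        by (subst tang[OF u(2)]) (simp add: n0_def bform_linear rot_coord_orthogonal[OF A])
      then show ?thesis
        unfolding inner_g_eq[OF nT u(1) c] nc A_def .
    qed
    show "0 < n c' $ 2" if "c' \<in> charts_at M x" for c'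
      using d_transition_inward[OF x c that n02] that by (simp add: n_def tangent_vector_def)
  qed (rule nT)
  moreover have "m = n" if "P m" for m
  proof -
    have m: "m \<in> tangent_space M x" "inner_g M x m m = 1" "0 < m c $ 2"
      "\<And>u. u \<in> boundary_tangent_space M x \<Longrightarrow> inner_g M x m u = 0"
      using that c by (auto simp: P_def)
    define u where "u = tangent_vector x c e"
    have u: "u \<in> tangent_space M x" "u c = e"
      by (simp_all add: u_def tangent_vector_in tangent_vector_chart c)
    have "u \<in> boundary_tangent_space M x"
      using u d_transition_tangential[OF x c _ e1(2)]
      by (auto simp: boundary_tangent_space_def u_def tangent_vector_def)
    then have "bform A (m c) e = 0"
      using m(4) inner_g_eq[OF m(1) u(1) c] u(2) by (simp add: A_def)
    from orthogonal_eq_rot_coord[OF A this ee] obtain k where k: "m c = k *\<^sub>R n0"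
      unfolding n0_def by blast
    have "k * k = 1"
      using m(2) unfolding inner_g_eq[OF m(1) m(1) c] A_def[symmetric] k n0_def
      by (simp add: bform_linear rot_coord_isometry[OF A] ee)
    moreover have "0 < k"
      using m(3) n02 by (simp add: k zero_less_mult_iff)
    ultimately have "k = 1"
      by (simp add: square_eq_1_iff)
    then show "m = n"
      by (intro tangent_space_eqI[OF m(1) nT c]) (simp add: k nc)
  qed
  ultimately have "P (inward_normal M x)"
    unfolding inward_normal_def P_def[symmetric] by (rule theI)
  then show "inward_normal M x \<in> tangent_space M x" "inner_g M x (inward_normal M x) (inward_normal M x) = 1"
    "\<And>u. u \<in> boundary_tangent_space M x \<Longrightarrow> inner_g M x (inward_normal M x) u = 0"
    "\<And>c. c \<in> charts_at M x \<Longrightarrow> 0 < inward_normal M x c $ 2"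
    by (auto simp: P_def)
qed

lemma inward_normal_chart:
  assumes x: "x \<in> boundary M" and c: "c \<in> charts_at M x"
  shows "bform (metric M c (snd c x)) (inward_normal M x c) (inward_normal M x c) = 1"
    and "d $ 2 = 0 \<Longrightarrow> bform (metric M c (snd c x)) (inward_normal M x c) d = 0"
proof -
  show "bform (metric M c (snd c x)) (inward_normal M x c) (inward_normal M x c) = 1"
    using inward_normal(1,2)[OF x] inner_g_eq[OF _ _ c] by metis
  assume d: "d $ 2 = 0"
  have u: "tangent_vector x c d \<in> boundary_tangent_space M x"
    using tangent_vector_in[OF c] d_transition_tangential[OF x c _ d]
    by (auto simp: boundary_tangent_space_def tangent_vector_def)
  then show "bform (metric M c (snd c x)) (inward_normal M x c) d = 0"
    using inward_normal(3)[OF x u] inner_g_eq[OF inward_normal(1)[OF x] tangent_vector_in[OF c] c]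
      tangent_vector_chart[OF c] by simp
qed


section \<open>Chart independence of the second fundamental form\<close>

text \<open>
  The derivative of the identity that expresses the metric in the chart \<open>c\<close> as the pullback of the
  metric in the chart \<open>c'\<close>, with \<open>a\<close> and \<open>b\<close> held constant in \<open>c\<close>.
\<close>
lemma dG_transition:
  assumes c: "c \<in> charts_at M x" "c' \<in> charts_at M x"
  shows "bform (metric_patch.dG (chart_image c) (metric M c) (snd c x) e) a b
    = bform (metric_patch.dG (chart_image c') (metric M c') (snd c' x) (d_transition c c' (snd c x) e))
        (d_transition c c' (snd c x) a) (d_transition c c' (snd c x) b)
      + bform (metric M c' (snd c' x)) (d2_transition c c' (snd c x) e a) (d_transition c c' (snd c x) b)
      + bform (metric M c' (snd c' x)) (d_transition c c' (snd c x) a) (d2_transition c c' (snd c x) e b)"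
proof -
  have at: "c \<in> atlas M" "c' \<in> atlas M" and x: "x \<in> fst c" "x \<in> fst c'"
    using c chart_at by blast+
  interpret P: metric_patch "chart_image c" "metric M c"
    by (rule metric_patch[OF at(1)])
  interpret P': metric_patch "chart_image c'" "metric M c'"
    by (rule metric_patch[OF at(2)])
  define y where "y = snd c x"
  have y: "y \<in> overlap c c'"
    using x by (auto simp: y_def overlap_def)
  have ty: "transition c c' y = snd c' x"
    unfolding y_def by (rule transition[OF at(1) x(1)])
  have sub: "overlap c c' \<subseteq> chart_image c" "transition c c' ` overlap c c' \<subseteq> chart_image c'"
    using transition[OF at(1), of _ c'] by (auto simp: overlap_def)
  have yc: "y \<in> chart_image c" "snd c' x \<in> chart_image c'"
    using x by (auto simp: y_def)
  have G: "(metric M c has_derivative P.dG y) (at y within overlap c c')"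
    by (rule has_derivative_subset[OF P.has_derivative_G[OF yc(1)] sub(1)])
  have G': "((\<lambda>z. metric M c' (transition c c' z)) has_derivative
      (\<lambda>e. P'.dG (snd c' x) (d_transition c c' y e))) (at y within overlap c c')"
  proof -
    have 1: "(transition c c' has_derivative d_transition c c' y) (at y within overlap c c')"
      unfolding y_def by (rule has_derivative_transition[OF c])
    have 2: "(metric M c' has_derivative P'.dG (snd c' x))
        (at (transition c c' y) within transition c c' ` overlap c c')"
      unfolding ty by (rule has_derivative_subset[OF P'.has_derivative_G[OF yc(2)] sub(2)])
    show ?thesis
      by (rule has_derivative_in_compose[OF 1 2])
  qed
  have eq: "bform (metric M c z) a b = bform (metric M c' (transition c c' z))
      (d_transition c c' z a) (d_transition c c' z b)" if "z \<in> overlap c c'" for z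
  proof -
    obtain x' where x': "x' \<in> fst c" "x' \<in> fst c'" "z = snd c x'"
      using \<open>z \<in> overlap c c'\<close> by (auto simp: overlap_def)
    then show ?thesis
      using metric_transition[of c x' c' a b] at transition[OF at(1) x'(1), of c']
      by (simp add: charts_at_def)
  qed
  note D = has_derivative_d_transition[OF c, folded y_def]
  have 1: "((\<lambda>z. bform (metric M c z) a b) has_derivative
      (\<lambda>h. bform (P.dG y h) a b + bform (metric M c y) 0 b + bform (metric M c y) a 0))
      (at y within overlap c c')"
    by (rule has_derivative_bform[OF G has_derivative_const has_derivative_const])
  have 2: "((\<lambda>z. bform (metric M c z) a b) has_derivative
      (\<lambda>h. bform (P'.dG (snd c' x) (d_transition c c' y h)) (d_transition c c' y a) (d_transition c c' y b)
      + bform (metric M c' (transition c c' y)) (d2_transition c c' y h a) (d_transition c c' y b)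
      + bform (metric M c' (transition c c' y)) (d_transition c c' y a) (d2_transition c c' y h b)))
      (at y within overlap c c')"
    by (rule has_derivative_transform[OF y eq has_derivative_bform[OF G' D D]])
  show ?thesis
    using fun_cong[OF has_derivative_unique_half_plane[OF openin_overlap[OF at] y 1 2], of e]
    unfolding ty bform_zero_left bform_zero_right unfolding y_def by simp
qed

text \<open>
  The differential maps \<open>u\<close> to a tangential vector at all points of the boundary line, so the
  second component of its image is constant along that line.
\<close>
lemma d2_transition_tangential:
  assumes x: "x \<in> boundary M" and c: "c \<in> charts_at M x" "c' \<in> charts_at M x" and u: "u $ 2 = 0"
  shows "d2_transition c c' (snd c x) u u $ 2 = 0"
proof -
  have at: "c \<in> atlas M" "c' \<in> atlas M" and x': "x \<in> fst c" "x \<in> fst c'"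
    using c chart_at by blast+
  define y where "y = snd c x"
  have y: "y \<in> overlap c c'" "y $ 2 = 0"
    using x' boundary_chart[OF x c(1)] by (auto simp: y_def overlap_def)
  define S where "S = overlap c c' \<inter> {z. z $ 2 = 0}"
  have zero: "d_transition c c' z u $ 2 = 0" if "z \<in> S" for z
  proof -
    obtain x' where x': "x' \<in> fst c" "x' \<in> fst c'" "z = snd c x'"
      using \<open>z \<in> S\<close> by (auto simp: S_def overlap_def)
    then have "c \<in> charts_at M x'" "snd c x' $ 2 = 0"
      using that at by (simp_all add: S_def charts_at_def)
    then have "x' \<in> boundary M"
      unfolding boundary_def by blast
    then show ?thesis
      using d_transition_tangential[of x' c c' u] x' at u by (simp add: charts_at_def)
  qed
  have D: "((\<lambda>z. d_transition c c' z u $ 2) has_derivative (\<lambda>d. d2_transition c c' y d u $ 2)) (at y within S)"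
    by (rule has_derivative_vec_nth[OF has_derivative_subset[OF has_derivative_d_transition[OF c, folded y_def]]])
       (simp add: S_def)
  have nonneg: "0 \<le> d2_transition c c' y d u $ 2" if d: "d $ 2 = 0" for d
  proof (rule directional_derivative_nonneg[OF D])
    show "d_transition c c' y u $ 2 \<le> d_transition c c' z u $ 2" if "z \<in> S" for z
      using zero[OF that] zero[of y] y by (simp add: S_def)
    show "\<exists>e>0. \<forall>t. 0 \<le> t \<and> t < e \<longrightarrow> y + t *\<^sub>R d \<in> S"
      using segment_in_half_plane_open[OF openin_overlap[OF at] y(1), of d] d y(2)
      by (simp add: S_def)
  qed
  have "d2_transition c c' y (- u) u = - d2_transition c c' y u u"
    using has_derivative_linear[OF has_derivative_d_transition[OF c, folded y_def], of u]
    by (rule linear_neg)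
  then show ?thesis
    using nonneg[OF u] nonneg[of "- u"] u by (simp add: y_def)
qed

text \<open>
  By the Koszul formula the two sides differ by first order terms of the metric, which
  \<open>dG_transition\<close> compares. With the symmetry of the second derivative \<open>D\<close> of the transition map all its
  terms cancel except the product of \<open>D(u, u)\<close> with the normal, and \<open>D(u, u)\<close> is tangential.
\<close>
lemma christoffel_normal_component_transition:
  assumes x: "x \<in> boundary M" and c: "c \<in> charts_at M x" "c' \<in> charts_at M x"
    and u: "u \<in> boundary_tangent_space M x"
  shows "bform (metric M c (snd c x))
      (christoffel_vec (chart_image c) (metric M c) (snd c x) (u c) (u c)) (inward_normal M x c)
    = bform (metric M c' (snd c' x))
      (christoffel_vec (chart_image c') (metric M c') (snd c' x) (u c') (u c')) (inward_normal M x c')"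
proof -
  have at: "c \<in> atlas M" "c' \<in> atlas M" and x': "x \<in> fst c" "x \<in> fst c'"
    using c chart_at by blast+
  interpret P: metric_patch "chart_image c" "metric M c"
    by (rule metric_patch[OF at(1)])
  interpret P': metric_patch "chart_image c'" "metric M c'"
    by (rule metric_patch[OF at(2)])
  define A where "A = d_transition c c' (snd c x)"
  define D where "D = d2_transition c c' (snd c x)"
  define G' where "G' = metric M c' (snd c' x)"
  define n where "n = inward_normal M x c"
  define w where "w = u c"
  have G': "inner_product_matrix G'"
    unfolding G'_def by (rule metric_at[OF c(2)])
  have u': "u \<in> tangent_space M x" "w $ 2 = 0"
    using u c by (auto simp: boundary_tangent_space_def w_def)
  have uc': "u c' = A w" and nc': "inward_normal M x c' = A n"
    unfolding A_def w_def n_def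
    using tangent_spaceD[OF u'(1) c] tangent_spaceD[OF inward_normal(1)[OF x] c] by simp_all
  have normal: "bform G' (D w w) (A n) = 0"
  proof -
    have "bform G' (A n) (D w w) = 0"
      unfolding G'_def nc'[symmetric] D_def
      by (rule inward_normal_chart(2)[OF x c(2) d2_transition_tangential[OF x c u'(2)]])
    then show ?thesis
      using bform_commute[OF G'] by simp
  qed
  have 1: "bform (P.dG (snd c x) w) w n = bform (P'.dG (snd c' x) (A w)) (A w) (A n)
      + bform G' (D w w) (A n) + bform G' (A w) (D w n)"
    unfolding A_def D_def G'_def by (rule dG_transition[OF c])
  have 2: "bform (P.dG (snd c x) n) w w = bform (P'.dG (snd c' x) (A n)) (A w) (A w)
      + bform G' (D n w) (A w) + bform G' (A w) (D n w)"
    unfolding A_def D_def G'_def by (rule dG_transition[OF c])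
  have 3: "D n w = D w n"
    unfolding D_def by (rule d2_transition_commute[OF c])
  have y: "snd c x \<in> chart_image c" "snd c' x \<in> chart_image c'"
    using x' by auto
  show ?thesis
    unfolding uc' nc' unfolding w_def[symmetric] n_def[symmetric]
      P.bform_christoffel_vec[OF y(1)] P'.bform_christoffel_vec[OF y(2)] 1 2 3 normal
    using bform_commute[OF G', of "D w n" "A w"] by simp
qed

lemma second_ff_chart:
  assumes x: "x \<in> boundary M" and c: "c \<in> charts_at M x" and u: "u \<in> boundary_tangent_space M x"
  shows "second_ff M x u u = bform (metric M c (snd c x))
      (christoffel_vec (chart_image c) (metric M c) (snd c x) (u c) (u c)) (inward_normal M x c)"
  unfolding second_ff_def
  by (rule chart_value_eq[OF c]) (rule christoffel_normal_component_transition[OF x _ c u])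


section \<open>Vector fields and velocities in induced coordinates\<close>

text \<open>
  The bracket of the geodesic field with the vertical field is the horizontal lift of \<open>- J w\<close>: its
  second component is \<open>- \<Gamma>(w, - J w)\<close>. The other Christoffel terms cancel because \<open>J\<close> is parallel.
\<close>
lemma X_perp_coord:
  assumes c: "c \<in> atlas M" and q: "fst q \<in> chart_image c"
  shows "X_perp_coord M c q = (- rot_coord (metric M c (fst q)) (snd q),
    christoffel_vec (chart_image c) (metric M c) (fst q) (snd q) (rot_coord (metric M c (fst q)) (snd q)))"
proof -
  interpret P: metric_patch "chart_image c" "metric M c"
    by (rule metric_patch[OF c])
  define J where "J = rot_coord (metric M c (fst q))"
  define w where "w = snd q"
  have V: "(V_coord M c has_derivative (\<lambda>h. (0, J (snd h + P.Gam (fst q) (fst h) w)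
      - P.Gam (fst q) (fst h) (J w)))) (at q within chart_image c \<times> UNIV)"
    unfolding V_coord_def J_def w_def
    by (rule has_derivative_Pair[OF has_derivative_const P.rot_coord_bundle_derivative[OF q]])
  obtain C where "((\<lambda>q. P.Gam (fst q) (snd q) (snd q)) has_derivative
      (\<lambda>h. C (fst h) + 2 *\<^sub>R P.Gam (fst q) (snd q) (snd h))) (at q within chart_image c \<times> UNIV)"
    and C: "C 0 = 0"
    using P.christoffel_bundle_derivative[OF q] by (elim exE conjE)
  then have X: "(X_coord M c has_derivative (\<lambda>h. (snd h, - (C (fst h) + 2 *\<^sub>R P.Gam (fst q) w (snd h)))))
      (at q within chart_image c \<times> UNIV)"
    unfolding X_coord_def w_def
    by (intro has_derivative_Pair has_derivative_snd[OF has_derivative_ident] has_derivative_minus)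
  have "J (- P.Gam (fst q) w w + P.Gam (fst q) w w) = 0"
    by (simp add: J_def rot_coord_linear)
  then show ?thesis
    unfolding X_perp_coord_def lie_bracket_def
      frechet_derivative_half_plane_times[OF P.S q V] frechet_derivative_half_plane_times[OF P.S q X]
    by (simp add: X_coord_def V_coord_def J_def[symmetric] w_def[symmetric] C scaleR_2)
qed

text \<open>
  The differential at \<open>q\<close> of the coordinate change \<open>(y, w) \<mapsto> (\<phi> y, D\<phi>(y) w)\<close> of the tangent bundle, with
  \<open>w\<close> expanded in the standard basis.
\<close>
definition velocity_transition ::
    "'a chart \<Rightarrow> 'a chart \<Rightarrow> (real^2) \<times> (real^2) \<Rightarrow> (real^2) \<times> (real^2) \<Rightarrow> (real^2) \<times> (real^2)" where
  "velocity_transition c c' q \<zeta> = (d_transition c c' (fst q) (fst \<zeta>),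
     d_transition c c' (fst q) (snd \<zeta>)
       + (snd q $ 1 *\<^sub>R d2_transition c c' (fst q) (fst \<zeta>) (axis 1 1)
        + snd q $ 2 *\<^sub>R d2_transition c c' (fst q) (fst \<zeta>) (axis 2 1)))"

lemma linear_velocity_transition:
  assumes c: "c \<in> charts_at M x" "c' \<in> charts_at M x" and q: "fst q = snd c x"
  shows "linear (velocity_transition c c' q)"
proof -
  have D: "linear (\<lambda>d. d2_transition c c' (fst q) d e)" for e
    unfolding q by (rule has_derivative_linear[OF has_derivative_d_transition[OF c]])
  have A: "linear (d_transition c c' (fst q))"
    unfolding q by (rule linear_d_transition[OF c])
  show ?thesis
    by (rule linearI)
       (simp_all add: velocity_transition_def linear_add[OF D] linear_add[OF A] linear_cmul[OF D]
          linear_cmul[OF A] algebra_simps)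
qed

lemma open_preimage:
  assumes "open J" "continuous_map (top_of_set J) (points M) f" "openin (points M) U"
  shows "open {r \<in> J. f r \<in> U}"
proof -
  have "openin (top_of_set J) {r \<in> topspace (top_of_set J). f r \<in> U}"
    by (rule openin_continuous_map_preimage[OF assms(2,3)])
  then show ?thesis
    using assms(1) by (simp add: openin_open_eq)
qed

text \<open>
  Velocities of curves in the tangent bundle transform linearly between charts, so a linear relation
  between them that holds in one chart holds in all of them.
\<close>
lemma tcoord_transition:
  assumes J: "open J" "u \<in> J" and cont: "continuous_map (top_of_set J) (points M) (fst \<circ> z)"
    and tang: "\<And>r. r \<in> J \<Longrightarrow> snd (z r) \<in> tangent_space M (fst (z r))"
    and c: "c \<in> charts_at M (fst (z u))" "c' \<in> charts_at M (fst (z u))"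
    and der: "((\<lambda>r. tcoord c (z r)) has_vector_derivative \<zeta>) (at u)"
  shows "((\<lambda>r. tcoord c' (z r)) has_vector_derivative velocity_transition c c' (tcoord c (z u)) \<zeta>) (at u)"
proof -
  have at: "c \<in> atlas M" "c' \<in> atlas M" and x: "fst (z u) \<in> fst c" "fst (z u) \<in> fst c'"
    using c chart_at by blast+
  define I where "I = {r \<in> J. (fst \<circ> z) r \<in> fst c \<inter> fst c'}"
  have I: "open I" "u \<in> I"
    using open_preimage[OF J(1) cont openin_Int[OF openin_chart[OF at(1)] openin_chart[OF at(2)]]] J(2) x
    by (auto simp: I_def)
  define y where "y r = snd c (fst (z r))" for r
  define w where "w r = snd (z r) c" for r
  have tc: "tcoord c (z r) = (y r, w r)" for r
    by (simp add: tcoord_def y_def w_def)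
  have "((\<lambda>r. fst (tcoord c (z r))) has_vector_derivative fst \<zeta>) (at u within I)"
    "((\<lambda>r. snd (tcoord c (z r))) has_vector_derivative snd \<zeta>) (at u within I)"
    using has_derivative_fst[OF has_derivative_at_withinI[OF der[unfolded has_vector_derivative_def], of I]]
      has_derivative_snd[OF has_derivative_at_withinI[OF der[unfolded has_vector_derivative_def], of I]]
    by (simp_all add: has_vector_derivative_def)
  then have y: "(y has_derivative (\<lambda>h. h *\<^sub>R fst \<zeta>)) (at u within I)"
    and w: "(w has_derivative (\<lambda>h. h *\<^sub>R snd \<zeta>)) (at u within I)"
    by (simp_all add: tc has_vector_derivative_def)
  have yI: "y ` I \<subseteq> overlap c c'"
    by (auto simp: I_def y_def overlap_def)
  have trans: "((\<lambda>r. transition c c' (y r)) has_derivative (\<lambda>h. d_transition c c' (y u) (h *\<^sub>R fst \<zeta>)))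
      (at u within I)"
    using has_derivative_subset[OF has_derivative_transition[OF c] yI] unfolding y_def[symmetric]
    by (rule has_derivative_in_compose[OF y])
  have d: "((\<lambda>r. d_transition c c' (y r) e) has_derivative (\<lambda>h. d2_transition c c' (y u) (h *\<^sub>R fst \<zeta>) e))
      (at u within I)" for e
    using has_derivative_subset[OF has_derivative_d_transition[OF c] yI] unfolding y_def[symmetric]
    by (rule has_derivative_in_compose[OF y])
  define F where "F r = (transition c c' (y r),
     w r $ 1 *\<^sub>R d_transition c c' (y r) (axis 1 1) + w r $ 2 *\<^sub>R d_transition c c' (y r) (axis 2 1))" for r
  have F: "F r = tcoord c' (z r)" if r: "r \<in> I" for r
  proof -
    have cr: "c \<in> charts_at M (fst (z r))" "c' \<in> charts_at M (fst (z r))"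
      using r at by (auto simp: I_def charts_at_def)
    have "snd (z r) c' = d_transition c c' (y r) (w r)"
      unfolding y_def w_def using tangent_spaceD[OF tang cr] r by (simp add: I_def)
    also have "\<dots> = w r $ 1 *\<^sub>R d_transition c c' (y r) (axis 1 1) + w r $ 2 *\<^sub>R d_transition c c' (y r) (axis 2 1)"
      unfolding y_def by (rule linear_2[OF linear_d_transition[OF cr]])
    finally show ?thesis
      using transition[OF at(1) chart_at(2)[OF cr(1)], of c'] by (simp add: F_def tcoord_def y_def)
  qed
  have F': "(F has_derivative (\<lambda>h. (d_transition c c' (y u) (h *\<^sub>R fst \<zeta>),
      (w u $ 1 *\<^sub>R d2_transition c c' (y u) (h *\<^sub>R fst \<zeta>) (axis 1 1)
        + (h *\<^sub>R snd \<zeta>) $ 1 *\<^sub>R d_transition c c' (y u) (axis 1 1))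
      + (w u $ 2 *\<^sub>R d2_transition c c' (y u) (h *\<^sub>R fst \<zeta>) (axis 2 1)
        + (h *\<^sub>R snd \<zeta>) $ 2 *\<^sub>R d_transition c c' (y u) (axis 2 1))))) (at u within I)"
    unfolding F_def
    by (intro has_derivative_Pair trans has_derivative_add has_derivative_scaleR d has_derivative_vec_nth w)
  have F'': "(d_transition c c' (y u) (h *\<^sub>R fst \<zeta>),
      (w u $ 1 *\<^sub>R d2_transition c c' (y u) (h *\<^sub>R fst \<zeta>) (axis 1 1)
        + (h *\<^sub>R snd \<zeta>) $ 1 *\<^sub>R d_transition c c' (y u) (axis 1 1))
      + (w u $ 2 *\<^sub>R d2_transition c c' (y u) (h *\<^sub>R fst \<zeta>) (axis 2 1)
        + (h *\<^sub>R snd \<zeta>) $ 2 *\<^sub>R d_transition c c' (y u) (axis 2 1)))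
    = h *\<^sub>R velocity_transition c c' (tcoord c (z u)) \<zeta>" for h
  proof -
    have q: "fst (tcoord c (z u)) = snd c (fst (z u))"
      by (simp add: tcoord_def)
    have "d_transition c c' (y u) (h *\<^sub>R snd \<zeta>)
      = (h *\<^sub>R snd \<zeta>) $ 1 *\<^sub>R d_transition c c' (y u) (axis 1 1) + (h *\<^sub>R snd \<zeta>) $ 2 *\<^sub>R d_transition c c' (y u) (axis 2 1)"
      unfolding y_def by (rule linear_2[OF linear_d_transition[OF c]])
    moreover have "h *\<^sub>R velocity_transition c c' (tcoord c (z u)) \<zeta>
      = velocity_transition c c' (tcoord c (z u)) (h *\<^sub>R \<zeta>)"
      by (rule linear_cmul[OF linear_velocity_transition[OF c q], symmetric])
    ultimately show ?thesis
      by (simp add: velocity_transition_def tc add_ac)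
  qed
  have "(F has_vector_derivative velocity_transition c c' (tcoord c (z u)) \<zeta>) (at u within I)"
    unfolding has_vector_derivative_def
    by (rule has_derivative_eq_rhs[OF F']) (rule ext, rule F'')
  then have "(F has_vector_derivative velocity_transition c c' (tcoord c (z u)) \<zeta>) (at u)"
    unfolding at_within_open[OF I(2,1)] .
  then show ?thesis
    by (rule has_vector_derivative_transform_within_open[OF _ I]) (rule F)
qed


section \<open>Tangent vectors of the boundary of the unit sphere bundle\<close>


lemma velocity_chart:
  assumes "c \<in> charts_at M (fst (z u))" "((\<lambda>r. tcoord c (z r)) has_vector_derivative \<zeta>) (at u)"
  shows "velocity M z u c = \<zeta>"
  using assms by (simp add: velocity_def vector_derivative_at)

lemma boundary_SM_chart:
  assumes p: "p \<in> boundary_SM M" and c: "c \<in> charts_at M (fst p)"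
  shows "snd p \<in> tangent_space M (fst p)" "snd c (fst p) $ 2 = 0"
    "bform (metric M c (snd c (fst p))) (snd p c) (snd p c) = 1"
proof -
  show 1: "snd p \<in> tangent_space M (fst p)"
    using p by (auto simp: boundary_SM_def SM_def)
  show "snd c (fst p) $ 2 = 0"
    using p boundary_chart[OF _ c] by (simp add: boundary_SM_def)
  show "bform (metric M c (snd c (fst p))) (snd p c) (snd p c) = 1"
    using p inner_g_eq[OF 1 1 c] by (auto simp: boundary_SM_def SM_def)
qed

lemma has_vector_derivative_tcoord:
  assumes "differentiable_curve M I z" "u \<in> I" "c \<in> charts_at M (fst (z u))"
  shows "((\<lambda>r. tcoord c (z r)) has_vector_derivative velocity M z u c) (at u)"
  using assms by (simp add: differentiable_curve_def velocity_def vector_derivative_works)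

lemma tangent_boundary_SM_cases:
  assumes \<xi>: "\<xi> \<in> tangent_boundary_SM M p"
  obtains e z where "0 < e" "continuous_map (top_of_set {-e<..<e}) (points M) (fst \<circ> z)"
    "\<And>u. u \<in> {-e<..<e} \<Longrightarrow> z u \<in> boundary_SM M" "z 0 = p"
    "\<And>c. c \<notin> charts_at M (fst p) \<Longrightarrow> \<xi> c = 0"
    "\<And>c. c \<in> charts_at M (fst p) \<Longrightarrow> ((\<lambda>r. tcoord c (z r)) has_vector_derivative \<xi> c) (at 0)"
proof -
  obtain e z where e: "0 < e" and z: "differentiable_curve M {-e<..<e} z"
    "\<forall>u\<in>{-e<..<e}. z u \<in> boundary_SM M" "z 0 = p" "\<xi> = velocity M z 0"
    using \<xi> by (auto simp: tangent_boundary_SM_def)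
  show ?thesis
  proof (rule that[OF e])
    show "continuous_map (top_of_set {-e<..<e}) (points M) (fst \<circ> z)"
      using z(1) by (simp add: differentiable_curve_def)
    show "((\<lambda>r. tcoord c (z r)) has_vector_derivative \<xi> c) (at 0)" if "c \<in> charts_at M (fst p)" for c
      using has_vector_derivative_tcoord[OF z(1), of 0 c] e that z(3,4) by simp
    show "\<xi> c = 0" if "c \<notin> charts_at M (fst p)" for c
      using that z(3,4) by (simp add: velocity_def)
  qed (use z in auto)
qed

lemma tangent_boundary_SM_outside:
  "\<xi> \<in> tangent_boundary_SM M p \<Longrightarrow> c \<notin> charts_at M (fst p) \<Longrightarrow> \<xi> c = 0"
  by (erule tangent_boundary_SM_cases) blast

lemma tangent_boundary_SM_transition:
  assumes \<xi>: "\<xi> \<in> tangent_boundary_SM M p" and c: "c \<in> charts_at M (fst p)" "c' \<in> charts_at M (fst p)"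
  shows "\<xi> c' = velocity_transition c c' (tcoord c p) (\<xi> c)"
  using \<xi>
proof (rule tangent_boundary_SM_cases)
  fix e :: real and z
  assume e: "0 < e" and cont: "continuous_map (top_of_set {-e<..<e}) (points M) (fst \<circ> z)"
    and bd: "\<And>u. u \<in> {-e<..<e} \<Longrightarrow> z u \<in> boundary_SM M" and z0: "z 0 = p"
    and der: "\<And>c. c \<in> charts_at M (fst p) \<Longrightarrow> ((\<lambda>r. tcoord c (z r)) has_vector_derivative \<xi> c) (at 0)"
  have tang: "snd (z r) \<in> tangent_space M (fst (z r))" if "r \<in> {-e<..<e}" for r
    using bd[OF that] by (auto simp: boundary_SM_def SM_def)
  have cz: "c \<in> charts_at M (fst (z 0))" "c' \<in> charts_at M (fst (z 0))"
    using c z0 by simp_all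
  have "((\<lambda>r. tcoord c' (z r)) has_vector_derivative velocity_transition c c' (tcoord c (z 0)) (\<xi> c)) (at 0)"
    by (rule tcoord_transition[OF open_greaterThanLessThan _ cont tang cz der[OF c(1)]]) (use e in auto)
  from vector_derivative_unique_at[OF der[OF c(2)] this] show ?thesis
    unfolding z0 .
qed

text \<open>
  The equations \<open>y $ 2 = 0\<close> and \<open>g(w, w) = 1\<close> that define the boundary of the unit sphere bundle in a
  chart, differentiated along a curve. They cut out a plane in the space of all pairs.
\<close>
lemma tangent_boundary_SM_constraints:
  assumes \<xi>: "\<xi> \<in> tangent_boundary_SM M p" and c: "c \<in> charts_at M (fst p)"
  shows "fst (\<xi> c) $ 2 = 0 \<and>
    bform (metric_patch.dG (chart_image c) (metric M c) (snd c (fst p)) (fst (\<xi> c))) (snd p c) (snd p c)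
      + 2 * bform (metric M c (snd c (fst p))) (snd (\<xi> c)) (snd p c) = 0"
  using \<xi>
proof (rule tangent_boundary_SM_cases)
  fix e :: real and z
  assume e: "0 < e" and cont: "continuous_map (top_of_set {-e<..<e}) (points M) (fst \<circ> z)"
    and bd: "\<And>u. u \<in> {-e<..<e} \<Longrightarrow> z u \<in> boundary_SM M" and z0: "z 0 = p"
    and "\<And>c. c \<in> charts_at M (fst p) \<Longrightarrow> ((\<lambda>r. tcoord c (z r)) has_vector_derivative \<xi> c) (at 0)"
  then have der: "((\<lambda>r. tcoord c (z r)) has_vector_derivative \<xi> c) (at 0)"
    using c by blast
  have at: "c \<in> atlas M" and x: "fst p \<in> fst c"
    using c chart_at by blast+
  interpret P: metric_patch "chart_image c" "metric M c"
    by (rule metric_patch[OF at])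
  define I where "I = {r \<in> {-e<..<e}. (fst \<circ> z) r \<in> fst c}"
  have I: "open I" "0 \<in> I"
    using open_preimage[OF open_greaterThanLessThan cont openin_chart[OF at]] x z0 e
    by (auto simp: I_def)
  have cr: "c \<in> charts_at M (fst (z r))" if "r \<in> I" for r
    using that at by (simp add: I_def charts_at_def)
  define y where "y r = fst (tcoord c (z r))" for r
  define w where "w r = snd (tcoord c (z r))" for r
  have y: "(y has_derivative (\<lambda>h. h *\<^sub>R fst (\<xi> c))) (at 0)" and w: "(w has_derivative (\<lambda>h. h *\<^sub>R snd (\<xi> c))) (at 0)"
    using has_derivative_fst[OF der[unfolded has_vector_derivative_def]]
      has_derivative_snd[OF der[unfolded has_vector_derivative_def]]
    by (simp_all add: y_def[abs_def] w_def[abs_def])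
  have y0: "y 0 = snd c (fst p)" "w 0 = snd p c"
    by (simp_all add: y_def w_def tcoord_def z0)
  have zI: "y r $ 2 = 0" "bform (metric M c (y r)) (w r) (w r) = 1" if r: "r \<in> I" for r
  proof -
    have "z r \<in> boundary_SM M"
      using r bd by (simp add: I_def)
    from boundary_SM_chart(2,3)[OF this cr[OF r]]
    show "y r $ 2 = 0" "bform (metric M c (y r)) (w r) (w r) = 1"
      by (simp_all add: y_def w_def tcoord_def)
  qed
  have "((\<lambda>r. 0 :: real) has_derivative (\<lambda>h. (h *\<^sub>R fst (\<xi> c)) $ 2)) (at 0)"
    by (rule has_derivative_transform_within_open[OF has_derivative_vec_nth[OF y] I]) (rule zI(1))
  from has_derivative_unique[OF this has_derivative_const] have "(1 *\<^sub>R fst (\<xi> c)) $ 2 = 0"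
    by (rule fun_cong)
  then have tangential: "fst (\<xi> c) $ 2 = 0"
    by simp
  have yI: "y ` I \<subseteq> chart_image c"
    by (auto simp: I_def y_def tcoord_def)
  have "(metric M c has_derivative P.dG (y 0)) (at (y 0) within y ` I)"
    by (rule has_derivative_subset[OF P.has_derivative_G yI]) (use yI I in auto)
  from has_derivative_in_compose[OF has_derivative_at_withinI[OF y] this]
  have G: "((\<lambda>r. metric M c (y r)) has_derivative (\<lambda>h. P.dG (y 0) (h *\<^sub>R fst (\<xi> c)))) (at 0 within I)" .
  have 1: "((\<lambda>r. bform (metric M c (y r)) (w r) (w r)) has_derivative
     (\<lambda>h. bform (P.dG (y 0) (h *\<^sub>R fst (\<xi> c))) (w 0) (w 0) + bform (metric M c (y 0)) (h *\<^sub>R snd (\<xi> c)) (w 0)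
        + bform (metric M c (y 0)) (w 0) (h *\<^sub>R snd (\<xi> c)))) (at 0)"
    using has_derivative_bform[OF G has_derivative_at_withinI[OF w] has_derivative_at_withinI[OF w]]
    unfolding at_within_open[OF I(2,1)] .
  have "((\<lambda>r. 1 :: real) has_derivative
     (\<lambda>h. bform (P.dG (y 0) (h *\<^sub>R fst (\<xi> c))) (w 0) (w 0) + bform (metric M c (y 0)) (h *\<^sub>R snd (\<xi> c)) (w 0)
        + bform (metric M c (y 0)) (w 0) (h *\<^sub>R snd (\<xi> c)))) (at 0)"
    by (rule has_derivative_transform_within_open[OF 1 I]) (rule zI(2))
  from has_derivative_unique[OF this has_derivative_const]
  have "bform (P.dG (y 0) (1 *\<^sub>R fst (\<xi> c))) (w 0) (w 0) + bform (metric M c (y 0)) (1 *\<^sub>R snd (\<xi> c)) (w 0)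
        + bform (metric M c (y 0)) (w 0) (1 *\<^sub>R snd (\<xi> c)) = 0"
    by (rule fun_cong)
  then have "bform (P.dG (snd c (fst p)) (fst (\<xi> c))) (snd p c) (snd p c)
      + 2 * bform (metric M c (snd c (fst p))) (snd (\<xi> c)) (snd p c) = 0"
    using bform_commute[OF metric_at[OF c], of "snd p c" "snd (\<xi> c)"] by (simp add: y0)
  with tangential show ?thesis ..
qed

end


section \<open>Fan-beam coordinates\<close>

locale fan_beam_coordinates = oriented_riemannian +
  fixes \<Gamma> :: "real \<Rightarrow> 'a" and L :: real
  assumes param: "boundary_arclength_param M \<Gamma> L"
begin

text \<open>The parameter is moved into one period.\<close>
lemma boundary_point: "\<Gamma> s \<in> boundary M"
proof -
  have per: "\<Gamma> (r + L) = \<Gamma> r" for r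
    using param by (simp add: boundary_arclength_param_def)
  have L: "0 < L" and image: "\<Gamma> ` {0..L} = boundary M"
    using param by (simp_all add: boundary_arclength_param_def)
  have nat: "\<Gamma> (r + real n * L) = \<Gamma> r" for r n
  proof (induction n)
    case (Suc n)
    have "\<Gamma> (r + real (Suc n) * L) = \<Gamma> (r + real n * L + L)"
      by (simp add: algebra_simps)
    then show ?case
      using per[of "r + real n * L"] Suc by simp
  qed simp
  have int: "\<Gamma> (r + real_of_int k * L) = \<Gamma> r" for r k
  proof (cases "0 \<le> k")
    case True
    then show ?thesis
      using nat[of r "nat k"] by simp
  next
    case False
    then show ?thesis
      using nat[of "r + real_of_int k * L" "nat (- k)"] by simp
  qed
  define k where "k = \<lfloor>s / L\<rfloor>"
  have "of_int k \<le> s / L" "s / L \<le> of_int k + 1"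
    unfolding k_def by linarith+
  then have "s + real_of_int (- k) * L \<in> {0..L}"
    using L by (simp add: field_simps)
  then show ?thesis
    using int[of s "- k"] image by (metis imageI)
qed

lemma continuous_map_\<Gamma>: "continuous_map euclideanreal (points M) \<Gamma>"
  using param by (simp add: boundary_arclength_param_def)

lemma open_chart_times: "c \<in> atlas M \<Longrightarrow> open {r. \<Gamma> r \<in> fst c}"
  using openin_continuous_map_preimage[OF continuous_map_\<Gamma> openin_chart] by simp

lemma boundary_curve_derivatives:
  assumes c: "c \<in> charts_at M (\<Gamma> s)"
  shows "((\<lambda>r. snd c (\<Gamma> r)) has_vector_derivative curve_velocity M \<Gamma> s c) (at s)"
    and "\<exists>d. ((\<lambda>r. curve_velocity M \<Gamma> r c) has_vector_derivative d) (at s)"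
proof -
  have at: "c \<in> atlas M" and x: "\<Gamma> s \<in> fst c"
    using c chart_at by blast+
  define U where "U = {r. \<Gamma> r \<in> fst c}"
  have U: "open U" "s \<in> U"
    using open_chart_times[OF at] x by (simp_all add: U_def)
  have "smooth_on U (\<lambda>r. snd c (\<Gamma> r))"
    using param at by (auto simp: boundary_arclength_param_def U_def)
  then obtain N h where N: "open N" "s \<in> N" and h: "\<And>k. Ck_on k N h"
    and eq: "\<And>r. r \<in> N \<inter> U \<Longrightarrow> h r = snd c (\<Gamma> r)"
    using U(2) unfolding smooth_on_def by meson
  obtain h'' where "\<forall>r\<in>N. (h has_derivative frechet_derivative h (at r)) (at r)"
    and *: "\<forall>e. ((\<lambda>r. frechet_derivative h (at r) e) has_derivative (\<lambda>d. h'' d e)) (at s)"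
    using Ck_on_2_derivatives[OF N h] by (elim exE conjE)
  then have h': "(h has_derivative frechet_derivative h (at r)) (at r)" if "r \<in> N" for r
    using that by blast
  have h'': "((\<lambda>r. frechet_derivative h (at r) 1) has_derivative (\<lambda>d. h'' d 1)) (at s)"
    using * ..
  have NU: "open (N \<inter> U)" "s \<in> N \<inter> U"
    using N U by auto
  have der: "((\<lambda>r. snd c (\<Gamma> r)) has_vector_derivative frechet_derivative h (at r) 1) (at r)"
    if r: "r \<in> N \<inter> U" for r
  proof -
    have h'r: "(h has_derivative frechet_derivative h (at r)) (at r)"
      using h' r by blast
    have "frechet_derivative h (at r) d = d *\<^sub>R frechet_derivative h (at r) 1" for d
      using linear_cmul[OF has_derivative_linear[OF h'r], of d 1] by simp
    then have "(h has_vector_derivative frechet_derivative h (at r) 1) (at r)"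
      unfolding has_vector_derivative_def by (intro has_derivative_eq_rhs[OF h'r] ext)
    then show ?thesis
      by (rule has_vector_derivative_transform_within_open[OF _ NU(1) r]) (rule eq)
  qed
  have cv: "curve_velocity M \<Gamma> r c = frechet_derivative h (at r) 1" if r: "r \<in> N \<inter> U" for r
    using vector_derivative_at[OF der[OF r]] r at by (simp add: curve_velocity_def charts_at_def U_def)
  show "((\<lambda>r. snd c (\<Gamma> r)) has_vector_derivative curve_velocity M \<Gamma> s c) (at s)"
    unfolding cv[OF NU(2)] by (rule der[OF NU(2)])
  have "((\<lambda>r. frechet_derivative h (at r) 1) has_vector_derivative h'' 1 1) (at s)"
    unfolding has_vector_derivative_def
  proof (intro has_derivative_eq_rhs[OF h''] ext)
    show "h'' d 1 = d *\<^sub>R h'' 1 1" for d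
      using linear_cmul[OF has_derivative_linear[OF h''], of d 1] by simp
  qed
  then have "((\<lambda>r. curve_velocity M \<Gamma> r c) has_vector_derivative h'' 1 1) (at s)"
    by (rule has_vector_derivative_transform_within_open[OF _ NU]) (simp add: cv)
  then show "\<exists>d. ((\<lambda>r. curve_velocity M \<Gamma> r c) has_vector_derivative d) (at s)" ..
qed

text \<open>
  The zero section over \<open>\<Gamma>\<close> is a curve in the tangent bundle; the base component of the
  transformation law for its velocity is the claim.
\<close>
lemma curve_velocity_tangent: "curve_velocity M \<Gamma> s \<in> tangent_space M (\<Gamma> s)"
proof (rule tangent_spaceI)
  fix c c' assume c: "c \<in> charts_at M (\<Gamma> s)" "c' \<in> charts_at M (\<Gamma> s)"
  define z where "z r = (\<Gamma> r, (\<lambda>c. 0) :: 'a tvec)" for r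
  have cz: "c \<in> charts_at M (fst (z s))" "c' \<in> charts_at M (fst (z s))"
    using c by (simp_all add: z_def)
  have der: "((\<lambda>r. tcoord c (z r)) has_vector_derivative (curve_velocity M \<Gamma> s c, 0)) (at s)"
    if "c \<in> charts_at M (\<Gamma> s)" for c
    unfolding tcoord_def z_def fst_conv snd_conv
    by (rule has_vector_derivative_Pair[OF boundary_curve_derivatives(1)[OF that] has_vector_derivative_const])
  have "((\<lambda>r. tcoord c' (z r)) has_vector_derivative
      velocity_transition c c' (tcoord c (z s)) (curve_velocity M \<Gamma> s c, 0)) (at s)"
  proof (rule tcoord_transition[OF open_UNIV UNIV_I _ _ cz der[OF c(1)]])
    show "continuous_map (top_of_set UNIV) (points M) (fst \<circ> z)"
      using continuous_map_\<Gamma> by (simp add: z_def comp_def)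
    show "snd (z r) \<in> tangent_space M (fst (z r))" for r
      using tangent_space_lincomb[OF inward_normal(1)[OF boundary_point[of r]]
        inward_normal(1)[OF boundary_point[of r]], of 0 0] by (simp add: z_def)
  qed
  from vector_derivative_unique_at[OF der[OF c(2)] this]
  show "curve_velocity M \<Gamma> s c' = d_transition c c' (snd c (\<Gamma> s)) (curve_velocity M \<Gamma> s c)"
    by (simp add: velocity_transition_def tcoord_def z_def)
qed (simp add: curve_velocity_def)

lemma fan_beam_tangent: "snd (fan_beam M \<Gamma> s \<alpha>) \<in> tangent_space M (\<Gamma> s)"
  using tangent_space_lincomb[OF inward_normal(1)[OF boundary_point[of s]] curve_velocity_tangent,
      of "cos \<alpha>" "- sin \<alpha>"]
  by (simp add: fan_beam_def)

context
  fixes s :: real and c :: "'a chart"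
  assumes c: "c \<in> charts_at M (\<Gamma> s)"
begin

abbreviation (input) "Gs \<equiv> metric M c (snd c (\<Gamma> s))"
abbreviation (input) "\<nu> \<equiv> inward_normal M (\<Gamma> s) c"
abbreviation (input) "\<gamma>' \<equiv> curve_velocity M \<Gamma> s c"

text \<open>
  As \<open>\<Gamma>'\<close> is the normal rotated by \<open>- \<pi>/2\<close>, the normal is \<open>\<Gamma>'\<close> rotated by \<open>\<pi>/2\<close>. This
  expresses the normal along the boundary through the smooth curve \<open>\<Gamma>\<close>, which gives its differentiability.
\<close>
lemma rot_coord_frame: "rot_coord Gs \<nu> = - \<gamma>'" "rot_coord Gs \<gamma>' = \<nu>"
proof -
  have "curve_velocity M \<Gamma> s = (\<lambda>c. - perp M (\<Gamma> s) (inward_normal M (\<Gamma> s)) c)"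
    using param by (simp add: boundary_arclength_param_def)
  from fun_cong[OF this, of c] show 1: "rot_coord Gs \<nu> = - \<gamma>'"
    using c by (simp add: perp_def)
  have "rot_coord Gs (rot_coord Gs \<nu>) = - \<nu>"
    by (rule rot_coord_rot_coord[OF metric_at[OF c]])
  then show "rot_coord Gs \<gamma>' = \<nu>"
    unfolding 1 by (simp add: rot_coord_linear)
qed

lemma frame_orthonormal:
  "bform Gs \<nu> \<nu> = 1" "bform Gs \<gamma>' \<gamma>' = 1" "bform Gs \<nu> \<gamma>' = 0" "bform Gs \<gamma>' \<nu> = 0"
proof -
  note A = metric_at[OF c]
  show 1: "bform Gs \<nu> \<nu> = 1"
    by (rule inward_normal_chart(1)[OF boundary_point c])
  show "bform Gs \<gamma>' \<gamma>' = 1"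
    using rot_coord_isometry[OF A, of \<gamma>' \<gamma>'] 1 by (simp add: rot_coord_frame)
  show "bform Gs \<nu> \<gamma>' = 0" "bform Gs \<gamma>' \<nu> = 0"
    using rot_coord_orthogonal[OF A, of \<gamma>'] by (simp_all add: rot_coord_frame)
qed

lemma fan_beam_chart:
  "snd (fan_beam M \<Gamma> s \<alpha>) c = cos \<alpha> *\<^sub>R \<nu> - sin \<alpha> *\<^sub>R \<gamma>'"
  "rot_coord Gs (snd (fan_beam M \<Gamma> s \<alpha>) c) = - sin \<alpha> *\<^sub>R \<nu> - cos \<alpha> *\<^sub>R \<gamma>'"
  by (simp_all add: fan_beam_def rot_coord_linear rot_coord_frame)

lemma fan_beam_unit: "bform Gs (snd (fan_beam M \<Gamma> s \<alpha>) c) (snd (fan_beam M \<Gamma> s \<alpha>) c) = 1"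
  by (simp add: fan_beam_chart bform_linear frame_orthonormal power2_eq_square[symmetric])

lemma tangential_along_boundary:
  fixes f :: "real \<Rightarrow> real^2"
  assumes f: "(f has_vector_derivative d) (at s)" and zero: "\<And>r. \<Gamma> r \<in> fst c \<Longrightarrow> f r $ 2 = 0"
  shows "d $ 2 = 0"
proof -
  have at: "c \<in> atlas M" and x: "\<Gamma> s \<in> fst c"
    using c chart_at by blast+
  have "((\<lambda>r. 0 :: real) has_derivative (\<lambda>h. (h *\<^sub>R d) $ 2)) (at s)"
    by (rule has_derivative_transform_within_open[OF has_derivative_vec_nth[OF f[unfolded has_vector_derivative_def]]
          open_chart_times[OF at]]) (use x zero in auto)
  from has_derivative_unique[OF this has_derivative_const] have "(1 *\<^sub>R d) $ 2 = 0"
    by (rule fun_cong)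
  then show "d $ 2 = 0"
    by simp
qed

end

lemma curve_velocity_tangential:
  assumes c: "c \<in> charts_at M (\<Gamma> s)"
  shows "curve_velocity M \<Gamma> s c $ 2 = 0"
proof (rule tangential_along_boundary[OF c boundary_curve_derivatives(1)[OF c]])
  fix r assume "\<Gamma> r \<in> fst c"
  then show "snd c (\<Gamma> r) $ 2 = 0"
    using boundary_chart[OF boundary_point[of r], of c] chart_at(1)[OF c] by (simp add: charts_at_def)
qed

lemma II_chart:
  assumes c: "c \<in> charts_at M (\<Gamma> s)"
  shows "II M \<Gamma> s = bform (metric M c (snd c (\<Gamma> s))) (christoffel_vec (chart_image c) (metric M c)
    (snd c (\<Gamma> s)) (curve_velocity M \<Gamma> s c) (curve_velocity M \<Gamma> s c)) (inward_normal M (\<Gamma> s) c)"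
proof -
  have "curve_velocity M \<Gamma> s \<in> boundary_tangent_space M (\<Gamma> s)"
    using curve_velocity_tangent curve_velocity_tangential by (simp add: boundary_tangent_space_def)
  then show ?thesis
    unfolding II_def by (rule second_ff_chart[OF boundary_point c])
qed

text \<open>
  The covariant acceleration of \<open>\<Gamma>\<close> is orthogonal to \<open>\<Gamma>'\<close> because \<open>g(\<Gamma>', \<Gamma>') = 1\<close>, hence a multiple of the
  normal. The coefficient is \<open>II\<close>, since the ordinary second derivative \<open>d\<close> is tangent to the boundary.
\<close>
lemma boundary_curve_acceleration:
  assumes c: "c \<in> charts_at M (\<Gamma> s)"
    and d: "((\<lambda>r. curve_velocity M \<Gamma> r c) has_vector_derivative d) (at s)"
  shows "d + christoffel_vec (chart_image c) (metric M c) (snd c (\<Gamma> s))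
      (curve_velocity M \<Gamma> s c) (curve_velocity M \<Gamma> s c) = II M \<Gamma> s *\<^sub>R inward_normal M (\<Gamma> s) c"
proof -
  have at: "c \<in> atlas M" and x: "\<Gamma> s \<in> fst c"
    using c chart_at by blast+
  interpret P: metric_patch "chart_image c" "metric M c"
    by (rule metric_patch[OF at])
  define y where "y = snd c (\<Gamma> s)"
  define u where "u = curve_velocity M \<Gamma> s c"
  define A where "A = metric M c y"
  define U where "U = {r. \<Gamma> r \<in> fst c}"
  have U: "open U" "s \<in> U"
    using open_chart_times[OF at] x by (simp_all add: U_def)
  have yc: "y \<in> chart_image c"
    using x by (simp add: y_def)
  have A: "inner_product_matrix A"
    unfolding A_def y_def by (rule metric_at[OF c])
  have im: "(\<lambda>r. snd c (\<Gamma> r)) ` U \<subseteq> chart_image c"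
    by (auto simp: U_def)
  have cr: "c \<in> charts_at M (\<Gamma> r)" if "r \<in> U" for r
    using that at by (simp add: U_def charts_at_def)
  have y': "((\<lambda>r. snd c (\<Gamma> r)) has_derivative (\<lambda>h. h *\<^sub>R u)) (at s within U)"
    using boundary_curve_derivatives(1)[OF c] unfolding has_vector_derivative_def u_def
    by (rule has_derivative_at_withinI)
  have u': "((\<lambda>r. curve_velocity M \<Gamma> r c) has_derivative (\<lambda>h. h *\<^sub>R d)) (at s within U)"
    using d unfolding has_vector_derivative_def by (rule has_derivative_at_withinI)
  have "(metric M c has_derivative P.dG y) (at (snd c (\<Gamma> s)) within (\<lambda>r. snd c (\<Gamma> r)) ` U)"
    unfolding y_def[symmetric] by (rule has_derivative_subset[OF P.has_derivative_G[OF yc] im])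
  from has_derivative_in_compose[OF y' this]
  have G: "((\<lambda>r. metric M c (snd c (\<Gamma> r))) has_derivative (\<lambda>h. P.dG y (h *\<^sub>R u))) (at s within U)" .
  have "((\<lambda>r. bform (metric M c (snd c (\<Gamma> r))) (curve_velocity M \<Gamma> r c) (curve_velocity M \<Gamma> r c)) has_derivative
     (\<lambda>h. bform (P.dG y (h *\<^sub>R u)) u u + bform A (h *\<^sub>R d) u + bform A u (h *\<^sub>R d))) (at s)"
    using has_derivative_bform[OF G u' u'] unfolding at_within_open[OF U(2,1)] A_def y_def u_def .
  then have "((\<lambda>r. 1 :: real) has_derivative
     (\<lambda>h. bform (P.dG y (h *\<^sub>R u)) u u + bform A (h *\<^sub>R d) u + bform A u (h *\<^sub>R d))) (at s)"
    by (rule has_derivative_transform_within_open[OF _ U]) (rule frame_orthonormal(2)[OF cr])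
  from has_derivative_unique[OF this has_derivative_const]
  have "bform (P.dG y (1 *\<^sub>R u)) u u + bform A (1 *\<^sub>R d) u + bform A u (1 *\<^sub>R d) = 0"
    by (rule fun_cong)
  then have "bform A (d + P.Gam y u u) u = 0"
    using P.metric_compatible[OF yc, of u u u] bform_commute[OF A, of u d] bform_commute[OF A, of u "P.Gam y u u"]
    by (simp add: bform_linear A_def[symmetric])
  moreover have "bform A u u = 1" "rot_coord A u = inward_normal M (\<Gamma> s) c"
    unfolding A_def y_def u_def by (rule frame_orthonormal(2)[OF c], rule rot_coord_frame(2)[OF c])
  ultimately have "d + P.Gam y u u
      = bform A (d + P.Gam y u u) (inward_normal M (\<Gamma> s) c) *\<^sub>R inward_normal M (\<Gamma> s) c"
    using orthogonal_eq_rot_coord[OF A, of "d + P.Gam y u u" u] by simp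
  moreover have "bform A d (inward_normal M (\<Gamma> s) c) = 0"
  proof -
    have "d $ 2 = 0"
      by (rule tangential_along_boundary[OF c d])
         (use curve_velocity_tangential cr in \<open>simp add: U_def\<close>)
    then have "bform A (inward_normal M (\<Gamma> s) c) d = 0"
      unfolding A_def y_def by (rule inward_normal_chart(2)[OF boundary_point c])
    then show ?thesis
      using bform_commute[OF A] by simp
  qed
  moreover have "bform A (P.Gam y u u) (inward_normal M (\<Gamma> s) c) = II M \<Gamma> s"
    unfolding A_def y_def u_def by (rule II_chart[OF c, symmetric])
  ultimately show ?thesis
    by (simp add: bform_linear y_def u_def)
qed

text \<open>
  The vertical part of \<open>\<partial>\<^sub>s\<close> is \<open>II V\<close>: by \<open>boundary_curve_acceleration\<close> and the parallelism of the rotation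
  the frame \<open>(\<Gamma>', \<nu>)\<close> turns with angular speed \<open>II\<close>, and \<open>v\<close> has constant components in this frame.
\<close>
lemma fan_beam_s_derivative:
  assumes c: "c \<in> charts_at M (\<Gamma> s)"
  shows "((\<lambda>r. tcoord c (fan_beam M \<Gamma> r \<alpha>)) has_vector_derivative
    (curve_velocity M \<Gamma> s c,
     - christoffel_vec (chart_image c) (metric M c) (snd c (\<Gamma> s)) (curve_velocity M \<Gamma> s c)
        (snd (fan_beam M \<Gamma> s \<alpha>) c)
     + II M \<Gamma> s *\<^sub>R rot_coord (metric M c (snd c (\<Gamma> s))) (snd (fan_beam M \<Gamma> s \<alpha>) c))) (at s)"
proof -
  have at: "c \<in> atlas M" and x: "\<Gamma> s \<in> fst c"
    using c chart_at by blast+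
  interpret P: metric_patch "chart_image c" "metric M c"
    by (rule metric_patch[OF at])
  define y where "y = snd c (\<Gamma> s)"
  define u where "u = curve_velocity M \<Gamma> s c"
  define n where "n = inward_normal M (\<Gamma> s) c"
  define k where "k = II M \<Gamma> s"
  define J where "J = rot_coord (metric M c y)"
  define U where "U = {r. \<Gamma> r \<in> fst c}"
  have U: "open U" "s \<in> U"
    using open_chart_times[OF at] x by (simp_all add: U_def)
  have cr: "c \<in> charts_at M (\<Gamma> r)" if "r \<in> U" for r
    using that at by (simp add: U_def charts_at_def)
  have yc: "y \<in> chart_image c"
    using x by (simp add: y_def)
  obtain d where d: "((\<lambda>r. curve_velocity M \<Gamma> r c) has_vector_derivative d) (at s)"
    using boundary_curve_derivatives(2)[OF c] by blast
  have dk: "d + P.Gam y u u = k *\<^sub>R n"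
    unfolding y_def u_def k_def n_def by (rule boundary_curve_acceleration[OF c d])
  have Ju: "J u = n" and Jn: "J n = - u"
    unfolding J_def y_def u_def n_def by (rule rot_coord_frame[OF c])+
  define q where "q r = (snd c (\<Gamma> r), curve_velocity M \<Gamma> r c)" for r
  have qs: "q s = (y, u)"
    by (simp add: q_def y_def u_def)
  have q: "(q has_derivative (\<lambda>h. h *\<^sub>R (u, d))) (at s within U)"
    using has_vector_derivative_Pair[OF boundary_curve_derivatives(1)[OF c] d]
    unfolding has_vector_derivative_def q_def u_def by (rule has_derivative_at_withinI)
  have qU: "q ` U \<subseteq> chart_image c \<times> UNIV"
    by (auto simp: U_def q_def)
  have "((\<lambda>q. rot_coord (metric M c (fst q)) (snd q)) has_derivative
    (\<lambda>h. J (snd h + P.Gam y (fst h) u) - P.Gam y (fst h) (J u))) (at (q s) within q ` U)"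
    using has_derivative_subset[OF P.rot_coord_bundle_derivative[of "(y, u)"] qU] yc
    unfolding qs by (simp add: J_def)
  from has_derivative_in_compose[OF q this]
  have "((\<lambda>r. rot_coord (metric M c (fst (q r))) (snd (q r))) has_derivative
    (\<lambda>h. J (h *\<^sub>R d + P.Gam y (h *\<^sub>R u) u) - P.Gam y (h *\<^sub>R u) (J u))) (at s)"
    unfolding at_within_open[OF U(2,1)] by simp
  moreover have "J (h *\<^sub>R d + P.Gam y (h *\<^sub>R u) u) - P.Gam y (h *\<^sub>R u) (J u) = h *\<^sub>R (- k *\<^sub>R u - P.Gam y u n)" for h
  proof -
    have "J (h *\<^sub>R d + P.Gam y (h *\<^sub>R u) u) = h *\<^sub>R J (d + P.Gam y u u)"
      by (simp only: J_def P.christoffel_vec_linear rot_coord_linear scaleR_add_right)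
    also have "J (d + P.Gam y u u) = - k *\<^sub>R u"
      unfolding dk by (simp add: J_def rot_coord_linear Jn[unfolded J_def])
    finally show ?thesis
      unfolding Ju by (simp add: P.christoffel_vec_linear algebra_simps)
  qed
  ultimately have "((\<lambda>r. rot_coord (metric M c (fst (q r))) (snd (q r))) has_vector_derivative
      - k *\<^sub>R u - P.Gam y u n) (at s)"
    unfolding has_vector_derivative_def by (simp only:)
  then have n': "((\<lambda>r. inward_normal M (\<Gamma> r) c) has_vector_derivative - k *\<^sub>R u - P.Gam y u n) (at s)"
    by (rule has_vector_derivative_transform_within_open[OF _ U])
       (simp add: q_def rot_coord_frame(2)[OF cr])
  have "((\<lambda>r. cos \<alpha> *\<^sub>R inward_normal M (\<Gamma> r) c - sin \<alpha> *\<^sub>R curve_velocity M \<Gamma> r c) has_vector_derivative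
      cos \<alpha> *\<^sub>R (- k *\<^sub>R u - P.Gam y u n) - sin \<alpha> *\<^sub>R d) (at s)"
    using n' d unfolding has_vector_derivative_def
    by (auto intro!: derivative_eq_intros simp: algebra_simps)
  moreover have "cos \<alpha> *\<^sub>R (- k *\<^sub>R u - P.Gam y u n) - sin \<alpha> *\<^sub>R d
      = - P.Gam y u (snd (fan_beam M \<Gamma> s \<alpha>) c) + k *\<^sub>R J (snd (fan_beam M \<Gamma> s \<alpha>) c)"
  proof -
    have w: "snd (fan_beam M \<Gamma> s \<alpha>) c = cos \<alpha> *\<^sub>R n - sin \<alpha> *\<^sub>R u"
      unfolding n_def u_def by (rule fan_beam_chart(1)[OF c])
    have Jw: "J (snd (fan_beam M \<Gamma> s \<alpha>) c) = - sin \<alpha> *\<^sub>R n - cos \<alpha> *\<^sub>R u"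
      unfolding J_def y_def n_def u_def by (rule fan_beam_chart(2)[OF c])
    have d: "d = k *\<^sub>R n - P.Gam y u u"
      using dk by (simp add: algebra_simps)
    show ?thesis
      unfolding Jw unfolding w d by (simp add: P.christoffel_vec_linear algebra_simps)
  qed
  ultimately have "((\<lambda>r. cos \<alpha> *\<^sub>R inward_normal M (\<Gamma> r) c - sin \<alpha> *\<^sub>R curve_velocity M \<Gamma> r c) has_vector_derivative
      - P.Gam y u (snd (fan_beam M \<Gamma> s \<alpha>) c) + k *\<^sub>R J (snd (fan_beam M \<Gamma> s \<alpha>) c)) (at s)"
    by (simp only:)
  from has_vector_derivative_Pair[OF boundary_curve_derivatives(1)[OF c] this]
  show ?thesis
    by (simp add: tcoord_def fan_beam_def y_def u_def k_def J_def)
qed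

lemma fan_beam_alpha_derivative:
  assumes c: "c \<in> charts_at M (\<Gamma> s)"
  shows "((\<lambda>\<beta>. tcoord c (fan_beam M \<Gamma> s \<beta>)) has_vector_derivative
    (0, rot_coord (metric M c (snd c (\<Gamma> s))) (snd (fan_beam M \<Gamma> s \<alpha>) c))) (at \<alpha>)"
  unfolding fan_beam_chart(2)[OF c]
  unfolding tcoord_def fan_beam_def fst_conv snd_conv
  by (rule has_vector_derivative_Pair[OF has_vector_derivative_const])
     (auto simp: has_vector_derivative_def algebra_simps intro!: derivative_eq_intros)

lemma fan_beam_boundary_SM: "fan_beam M \<Gamma> s \<alpha> \<in> boundary_SM M"
proof -
  obtain c where c: "c \<in> charts_at M (\<Gamma> s)"
    using boundary_point[of s] by (auto simp: boundary_def)
  have "\<Gamma> s \<in> topspace (points M)"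
    using openin_subset[OF openin_chart] chart_at[OF c] by blast
  moreover have "inner_g M (\<Gamma> s) (snd (fan_beam M \<Gamma> s \<alpha>)) (snd (fan_beam M \<Gamma> s \<alpha>)) = 1"
    unfolding inner_g_eq[OF fan_beam_tangent fan_beam_tangent c] by (rule fan_beam_unit[OF c])
  moreover have "fst (fan_beam M \<Gamma> s \<alpha>) = \<Gamma> s"
    by (simp add: fan_beam_def)
  ultimately show ?thesis
    using fan_beam_tangent[of s \<alpha>] boundary_point[of s]
    by (simp add: boundary_SM_def SM_def case_prod_unfold)
qed

lemma fan_beam_base: "fst (fan_beam M \<Gamma> s \<alpha>) = \<Gamma> s"
  by (simp add: fan_beam_def)

lemma fan_s_tangent: "fan_s M \<Gamma> s \<alpha> \<in> tangent_boundary_SM M (fan_beam M \<Gamma> s \<alpha>)"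
  unfolding tangent_boundary_SM_def
proof (intro CollectI exI conjI)
  let ?z = "\<lambda>r. fan_beam M \<Gamma> (s + r) \<alpha>"
  have der: "((\<lambda>r. tcoord c (?z r)) has_vector_derivative
      vector_derivative (\<lambda>r. tcoord c (fan_beam M \<Gamma> r \<alpha>)) (at (s + u))) (at u)"
    if "c \<in> charts_at M (\<Gamma> (s + u))" for c u
    using has_vector_derivative_shift[OF fan_beam_s_derivative[OF that]]
    unfolding vector_derivative_at[OF fan_beam_s_derivative[OF that]] .
  show "(0::real) < 1"
    by simp
  have "continuous_map (top_of_set {-1<..<1}) euclideanreal (\<lambda>r. s + r)"
    by (intro continuous_map_from_subtopology) (simp add: continuous_intros)
  from continuous_map_compose[OF this continuous_map_\<Gamma>]
  show "differentiable_curve M {-1<..<1} ?z"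
    using der by (auto simp: differentiable_curve_def comp_def fan_beam_base
        intro!: differentiableI_vector)
  show "\<forall>u\<in>{-1<..<1}. ?z u \<in> boundary_SM M"
    using fan_beam_boundary_SM by blast
  show "?z 0 = fan_beam M \<Gamma> s \<alpha>"
    by simp
  show "fan_s M \<Gamma> s \<alpha> = velocity M ?z 0"
  proof
    fix c
    show "fan_s M \<Gamma> s \<alpha> c = velocity M ?z 0 c"
      using vector_derivative_at[OF der[of c 0]]
      by (simp add: fan_s_def velocity_def fan_beam_base)
  qed
qed

lemma fan_alpha_tangent: "fan_alpha M \<Gamma> s \<alpha> \<in> tangent_boundary_SM M (fan_beam M \<Gamma> s \<alpha>)"
  unfolding tangent_boundary_SM_def
proof (intro CollectI exI conjI)
  let ?z = "\<lambda>r. fan_beam M \<Gamma> s (\<alpha> + r)"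
  have der: "((\<lambda>r. tcoord c (?z r)) has_vector_derivative
      vector_derivative (\<lambda>r. tcoord c (fan_beam M \<Gamma> s r)) (at (\<alpha> + u))) (at u)"
    if "c \<in> charts_at M (\<Gamma> s)" for c u
    using has_vector_derivative_shift[OF fan_beam_alpha_derivative[OF that]]
    unfolding vector_derivative_at[OF fan_beam_alpha_derivative[OF that]] .
  have "\<Gamma> s \<in> topspace (points M)"
    using fan_beam_boundary_SM[of s \<alpha>] by (auto simp: boundary_SM_def SM_def fan_beam_def)
  then show "differentiable_curve M {-1<..<1} ?z"
    using der by (auto simp: differentiable_curve_def comp_def fan_beam_base
        intro!: differentiableI_vector)
  show "(0::real) < 1"
    by simp
  show "\<forall>u\<in>{-1<..<1}. ?z u \<in> boundary_SM M"
    using fan_beam_boundary_SM by blast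
  show "?z 0 = fan_beam M \<Gamma> s \<alpha>"
    by simp
  show "fan_alpha M \<Gamma> s \<alpha> = velocity M ?z 0"
  proof
    fix c
    show "fan_alpha M \<Gamma> s \<alpha> c = velocity M ?z 0 c"
      using vector_derivative_at[OF der[of c 0]]
      by (simp add: fan_alpha_def velocity_def fan_beam_base)
  qed
qed

lemma fan_s_chart:
  assumes c: "c \<in> charts_at M (\<Gamma> s)"
  shows "fan_s M \<Gamma> s \<alpha> c = (curve_velocity M \<Gamma> s c,
     - christoffel_vec (chart_image c) (metric M c) (snd c (\<Gamma> s)) (curve_velocity M \<Gamma> s c)
        (snd (fan_beam M \<Gamma> s \<alpha>) c)
     + II M \<Gamma> s *\<^sub>R rot_coord (metric M c (snd c (\<Gamma> s))) (snd (fan_beam M \<Gamma> s \<alpha>) c))"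
  unfolding fan_s_def
  by (rule velocity_chart[OF _ fan_beam_s_derivative[OF c]]) (simp add: fan_beam_base c)

lemma fan_alpha_chart:
  assumes c: "c \<in> charts_at M (\<Gamma> s)"
  shows "fan_alpha M \<Gamma> s \<alpha> c
    = (0, rot_coord (metric M c (snd c (\<Gamma> s))) (snd (fan_beam M \<Gamma> s \<alpha>) c))"
  unfolding fan_alpha_def
  by (rule velocity_chart[OF _ fan_beam_alpha_derivative[OF c]]) (simp add: fan_beam_base c)

lemma fan_alpha_eq_V: "fan_alpha M \<Gamma> s \<alpha> = V_field M (fan_beam M \<Gamma> s \<alpha>)"
proof
  fix c
  show "fan_alpha M \<Gamma> s \<alpha> c = V_field M (fan_beam M \<Gamma> s \<alpha>) c"
  proof (cases "c \<in> charts_at M (\<Gamma> s)")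
    case True
    then show ?thesis
      by (simp add: fan_alpha_chart V_field_def field_at_def V_coord_def tcoord_def fan_beam_base)
  next
    case False
    then show ?thesis
      by (simp add: fan_alpha_def velocity_def V_field_def field_at_def fan_beam_base)
  qed
qed

lemma mu_fan_beam: "mu M (fan_beam M \<Gamma> s \<alpha>) = cos \<alpha>"
proof -
  obtain c where c: "c \<in> charts_at M (\<Gamma> s)"
    using boundary_point[of s] by (auto simp: boundary_def)
  show ?thesis
    unfolding mu_def fan_beam_base
      inner_g_eq[OF fan_beam_tangent inward_normal(1)[OF boundary_point] c] fan_beam_chart(1)[OF c]
    by (simp add: bform_linear frame_orthonormal[OF c])
qed

text \<open>
  The value is computed in every chart, as \<open>inner_g_eq\<close> would need \<open>v\<^sub>\<perp>\<close> to be a tangent vector, that is,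
  that rotations commute with the differentials of transition maps.
\<close>
lemma mu_perp_fan_beam: "mu_perp M (fan_beam M \<Gamma> s \<alpha>) = - sin \<alpha>"
proof -
  obtain c where c: "c \<in> charts_at M (\<Gamma> s)"
    using boundary_point[of s] by (auto simp: boundary_def)
  have *: "bform (metric M c (snd c (\<Gamma> s))) (perp M (\<Gamma> s) (snd (fan_beam M \<Gamma> s \<alpha>)) c)
      (inward_normal M (\<Gamma> s) c) = - sin \<alpha>" if c: "c \<in> charts_at M (\<Gamma> s)" for c
    using c fan_beam_chart(2)[OF c, of \<alpha>]
    by (simp add: perp_def bform_linear frame_orthonormal[OF c])
  show ?thesis
    unfolding mu_perp_def fan_beam_base inner_g_def
    using chart_value_eq[OF c, of "\<lambda>c. bform (metric M c (snd c (\<Gamma> s)))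
      (perp M (\<Gamma> s) (snd (fan_beam M \<Gamma> s \<alpha>)) c) (inward_normal M (\<Gamma> s) c)"] * c
    by simp
qed

text \<open>
  \<open>H\<close> is the horizontal lift of \<open>- sin \<alpha> v - cos \<alpha> v\<^sub>\<perp> = \<Gamma>'\<close>, so it is \<open>\<partial>\<^sub>s\<close> without its vertical part.
  The coefficient \<open>1\<close> is kept so that the right-hand side is literally a combination of two tangent
  vectors, to which the linearity of a covector applies.
\<close>
lemma H_field_eq:
  "H_field M (fan_beam M \<Gamma> s \<alpha>) = (\<lambda>c. 1 *\<^sub>R fan_s M \<Gamma> s \<alpha> c + (- II M \<Gamma> s) *\<^sub>R fan_alpha M \<Gamma> s \<alpha> c)"
proof
  fix c
  show "H_field M (fan_beam M \<Gamma> s \<alpha>) c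
    = 1 *\<^sub>R fan_s M \<Gamma> s \<alpha> c + (- II M \<Gamma> s) *\<^sub>R fan_alpha M \<Gamma> s \<alpha> c"
  proof (cases "c \<in> charts_at M (\<Gamma> s)")
    case c: True
    have at: "c \<in> atlas M" and x: "\<Gamma> s \<in> fst c"
      using c chart_at by blast+
    interpret P: metric_patch "chart_image c" "metric M c"
      by (rule metric_patch[OF at])
    define y where "y = snd c (\<Gamma> s)"
    define w where "w = snd (fan_beam M \<Gamma> s \<alpha>) c"
    define J where "J = rot_coord (metric M c y)"
    define u where "u = curve_velocity M \<Gamma> s c"
    define n where "n = inward_normal M (\<Gamma> s) c"
    have yc: "y \<in> chart_image c"
      using x by (simp add: y_def)
    have t: "tcoord c (fan_beam M \<Gamma> s \<alpha>) = (y, w)"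
      by (simp add: tcoord_def y_def w_def fan_beam_base)
    have w: "w = cos \<alpha> *\<^sub>R n - sin \<alpha> *\<^sub>R u" and Jw: "J w = - sin \<alpha> *\<^sub>R n - cos \<alpha> *\<^sub>R u"
      unfolding J_def y_def n_def u_def w_def by (rule fan_beam_chart[OF c])+
    have uw: "- sin \<alpha> *\<^sub>R w - cos \<alpha> *\<^sub>R J w = u"
    proof -
      have "- sin \<alpha> *\<^sub>R w - cos \<alpha> *\<^sub>R J w = (sin \<alpha> * sin \<alpha>) *\<^sub>R u + (cos \<alpha> * cos \<alpha>) *\<^sub>R u"
        unfolding Jw unfolding w by (simp add: algebra_simps)
      also have "\<dots> = ((sin \<alpha>)\<^sup>2 + (cos \<alpha>)\<^sup>2) *\<^sub>R u"
        by (simp only: scaleR_add_left power2_eq_square)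
      finally show ?thesis
        by simp
    qed
    have "sin \<alpha> *\<^sub>R P.Gam y w w + cos \<alpha> *\<^sub>R P.Gam y w (J w) = - P.Gam y w (- sin \<alpha> *\<^sub>R w - cos \<alpha> *\<^sub>R J w)"
      by (simp add: P.christoffel_vec_linear)
    also have "\<dots> = - P.Gam y u w"
      unfolding uw by (simp add: P.christoffel_vec_commute[OF yc, of w u])
    finally have "sin \<alpha> *\<^sub>R P.Gam y w w + cos \<alpha> *\<^sub>R P.Gam y w (J w) = - P.Gam y u w" .
    moreover have "H_field M (fan_beam M \<Gamma> s \<alpha>) c
      = (- sin \<alpha> *\<^sub>R w - cos \<alpha> *\<^sub>R J w, sin \<alpha> *\<^sub>R P.Gam y w w + cos \<alpha> *\<^sub>R P.Gam y w (J w))"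
      using c yc by (simp add: H_field_def X_field_def X_perp_field_def field_at_def fan_beam_base t
          X_coord_def X_perp_coord[OF at] mu_fan_beam mu_perp_fan_beam J_def)
    moreover have "1 *\<^sub>R fan_s M \<Gamma> s \<alpha> c + (- II M \<Gamma> s) *\<^sub>R fan_alpha M \<Gamma> s \<alpha> c = (u, - P.Gam y u w)"
      unfolding fan_s_chart[OF c] fan_alpha_chart[OF c] by (simp add: u_def y_def w_def)
    ultimately show ?thesis
      using uw by simp
  next
    case False
    then show ?thesis
      by (simp add: fan_s_def fan_alpha_def velocity_def H_field_def X_field_def X_perp_field_def
          field_at_def fan_beam_base)
  qed
qed

text \<open>
  The coefficient of \<open>\<partial>\<^sub>s\<close> is read off from the base component, which is proportional to \<open>\<Gamma>'\<close>. What
  remains is vertical and orthogonal to \<open>v\<close>, by \<open>tangent_boundary_SM_constraints\<close> for the given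
  vector and for \<open>\<partial>\<^sub>s\<close>, hence a multiple of \<open>V\<close>.
\<close>
lemma fan_basis_spans:
  assumes \<xi>: "\<xi> \<in> tangent_boundary_SM M (fan_beam M \<Gamma> s \<alpha>)"
  shows "\<exists>a b. \<xi> = (\<lambda>c. a *\<^sub>R fan_s M \<Gamma> s \<alpha> c + b *\<^sub>R fan_alpha M \<Gamma> s \<alpha> c)"
proof -
  obtain c where c: "c \<in> charts_at M (\<Gamma> s)"
    using boundary_point[of s] by (auto simp: boundary_def)
  let ?p = "fan_beam M \<Gamma> s \<alpha>"
  have cp: "c \<in> charts_at M (fst ?p)"
    by (simp add: fan_beam_base c)
  have at: "c \<in> atlas M" and x: "\<Gamma> s \<in> fst c"
    using c chart_at by blast+
  interpret P: metric_patch "chart_image c" "metric M c"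
    by (rule metric_patch[OF at])
  define y where "y = snd c (\<Gamma> s)"
  define A where "A = metric M c y"
  define w where "w = snd ?p c"
  define u where "u = curve_velocity M \<Gamma> s c"
  define h where "h = snd (fan_s M \<Gamma> s \<alpha> c)"
  have A: "inner_product_matrix A"
    unfolding A_def y_def by (rule metric_at[OF c])
  have yc: "y \<in> chart_image c"
    using x by (simp add: y_def)
  have lin: "linear (P.dG y)"
    by (rule has_derivative_linear[OF P.has_derivative_G[OF yc]])
  have us: "fst (fan_s M \<Gamma> s \<alpha> c) = u"
    by (simp add: fan_s_chart[OF c] u_def)
  have "u $ 2 = 0"
    unfolding u_def by (rule curve_velocity_tangential[OF c])
  moreover have "bform A u u = 1"
    unfolding A_def y_def u_def by (rule frame_orthonormal(2)[OF c])
  ultimately have u1: "u $ 1 \<noteq> 0"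
    by (auto simp: bform_2)
  have \<xi>2: "fst (\<xi> c) $ 2 = 0"
    and \<xi>w: "bform (P.dG y (fst (\<xi> c))) w w + 2 * bform A (snd (\<xi> c)) w = 0"
    using tangent_boundary_SM_constraints[OF \<xi> cp] by (simp_all add: fan_beam_base y_def A_def w_def)
  have hw: "bform (P.dG y u) w w + 2 * bform A h w = 0"
    using tangent_boundary_SM_constraints[OF fan_s_tangent cp]
    by (simp add: fan_beam_base y_def A_def w_def h_def us)
  define a where "a = fst (\<xi> c) $ 1 / u $ 1"
  have a: "fst (\<xi> c) = a *\<^sub>R u"
    using \<xi>2 \<open>u $ 2 = 0\<close> u1 by (simp add: a_def vec_eq_iff forall_2)
  define d where "d = snd (\<xi> c) - a *\<^sub>R h"
  have "bform (P.dG y (a *\<^sub>R u)) w w = a * bform (P.dG y u) w w"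
    unfolding linear_cmul[OF lin] by (simp add: bform_2 algebra_simps)
  then have "bform A d w = 0"
    using \<xi>w hw unfolding a d_def by (simp add: bform_linear) algebra
  moreover have "bform A w w = 1"
    unfolding A_def y_def w_def by (rule fan_beam_unit[OF c])
  ultimately obtain b where b: "d = b *\<^sub>R rot_coord A w"
    using orthogonal_eq_rot_coord[OF A] by blast
  have chart: "\<xi> c = a *\<^sub>R fan_s M \<Gamma> s \<alpha> c + b *\<^sub>R fan_alpha M \<Gamma> s \<alpha> c"
  proof (rule prod_eqI)
    show "fst (\<xi> c) = fst (a *\<^sub>R fan_s M \<Gamma> s \<alpha> c + b *\<^sub>R fan_alpha M \<Gamma> s \<alpha> c)"
      by (simp add: a us fan_alpha_chart[OF c])
    have "snd (\<xi> c) = a *\<^sub>R h + d"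
      by (simp add: d_def)
    then show "snd (\<xi> c) = snd (a *\<^sub>R fan_s M \<Gamma> s \<alpha> c + b *\<^sub>R fan_alpha M \<Gamma> s \<alpha> c)"
      by (simp add: b h_def fan_alpha_chart[OF c] A_def y_def w_def)
  qed
  have "\<xi> c' = a *\<^sub>R fan_s M \<Gamma> s \<alpha> c' + b *\<^sub>R fan_alpha M \<Gamma> s \<alpha> c'" for c'
  proof (cases "c' \<in> charts_at M (fst ?p)")
    case c': True
    have l: "linear (velocity_transition c c' (tcoord c ?p))"
      by (rule linear_velocity_transition[OF cp c']) (simp add: tcoord_def)
    show ?thesis
      unfolding tangent_boundary_SM_transition[OF \<xi> cp c']
        tangent_boundary_SM_transition[OF fan_s_tangent cp c']
        tangent_boundary_SM_transition[OF fan_alpha_tangent cp c']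
        chart linear_add[OF l] linear_cmul[OF l] ..
  next
    case False
    then show ?thesis
      using tangent_boundary_SM_outside[OF \<xi> False] tangent_boundary_SM_outside[OF fan_s_tangent False]
        tangent_boundary_SM_outside[OF fan_alpha_tangent False] by simp
  qed
  then show ?thesis
    by blast
qed

lemma fan_components_eq:
  "fan_components M \<Gamma> s \<alpha> (\<lambda>c. a *\<^sub>R fan_s M \<Gamma> s \<alpha> c + b *\<^sub>R fan_alpha M \<Gamma> s \<alpha> c) = (a, b)"
  unfolding fan_components_def
proof (rule the_equality)
  fix q
  assume q: "(\<lambda>c. a *\<^sub>R fan_s M \<Gamma> s \<alpha> c + b *\<^sub>R fan_alpha M \<Gamma> s \<alpha> c)
    = (\<lambda>c. fst q *\<^sub>R fan_s M \<Gamma> s \<alpha> c + snd q *\<^sub>R fan_alpha M \<Gamma> s \<alpha> c)"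
  obtain c where c: "c \<in> charts_at M (\<Gamma> s)"
    using boundary_point[of s] by (auto simp: boundary_def)
  note A = metric_at[OF c]
  have u: "curve_velocity M \<Gamma> s c \<noteq> 0"
    using frame_orthonormal(2)[OF c] by (auto simp: bform_linear)
  have w: "rot_coord (metric M c (snd c (\<Gamma> s))) (snd (fan_beam M \<Gamma> s \<alpha>) c) \<noteq> 0"
    using fan_beam_unit[OF c, of \<alpha>] by (auto simp: rot_coord_eq_0_iff[OF A] bform_linear)
  have eq: "a *\<^sub>R fan_s M \<Gamma> s \<alpha> c + b *\<^sub>R fan_alpha M \<Gamma> s \<alpha> c
      = fst q *\<^sub>R fan_s M \<Gamma> s \<alpha> c + snd q *\<^sub>R fan_alpha M \<Gamma> s \<alpha> c"
    using fun_cong[OF q, of c] .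
  from arg_cong[OF eq, of fst] have "a = fst q"
    using u by (simp add: fan_s_chart[OF c] fan_alpha_chart[OF c])
  moreover from this arg_cong[OF eq, of snd] have "b = snd q"
    using w by (simp add: fan_alpha_chart[OF c])
  ultimately show "q = (a, b)"
    by simp
qed simp

end

theorem lemma3p2:
  fixes M :: "'a surface" and \<Gamma> :: "real \<Rightarrow> 'a" and L :: real
    and x :: 'a and v :: "'a tvec" and t s \<alpha> :: real
    and \<eta> :: "'a ttvec \<Rightarrow> real"
  assumes "oriented_riemannian_surface M"
    and "compact_space (points M)"
    and "non_trapping M"
    and "strictly_convex_boundary M"
    and "boundary_arclength_param M \<Gamma> L"
    and "(x, v) \<in> inward_SM M"
    and "0 < t" and "ereal t < exit_time M (x, v)"
    and "covector (tangent_boundary_SM M (x, v)) \<eta>"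
    and "\<eta> (V_field M (x, v)) = jacobi_b M (x, v) t"
    and "\<eta> (H_field M (x, v)) = - mu M (x, v) * jacobi_a M (x, v) t"
    and "\<alpha> \<in> {- pi / 2 .. pi / 2}"
    and "(x, v) = fan_beam M \<Gamma> s \<alpha>"
  shows "\<forall>\<xi>\<in>tangent_boundary_SM M (x, v).
    \<eta> \<xi> = (II M \<Gamma> s * jacobi_b M (x, v) t - mu M (x, v) * jacobi_a M (x, v) t) * fan_ds M \<Gamma> s \<alpha> \<xi>
          + jacobi_b M (x, v) t * fan_dalpha M \<Gamma> s \<alpha> \<xi>"
proof
  interpret fan_beam_coordinates M \<Gamma> L
    by unfold_locales fact+
  let ?a = "jacobi_a M (x, v) t" and ?b = "jacobi_b M (x, v) t"
  let ?s = "fan_s M \<Gamma> s \<alpha>" and ?\<alpha> = "fan_alpha M \<Gamma> s \<alpha>"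
  note p = assms(13)
  have T: "?s \<in> tangent_boundary_SM M (x, v)" "?\<alpha> \<in> tangent_boundary_SM M (x, v)"
    unfolding p by (rule fan_s_tangent, rule fan_alpha_tangent)
  have \<eta>: "\<eta> (\<lambda>c. r *\<^sub>R ?s c + q *\<^sub>R ?\<alpha> c) = r * \<eta> ?s + q * \<eta> ?\<alpha>" for r q
    using assms(9) T unfolding covector_def by blast
  have \<eta>\<alpha>: "\<eta> ?\<alpha> = ?b"
    using assms(10) unfolding p fan_alpha_eq_V .
  have "\<eta> ?s - II M \<Gamma> s * \<eta> ?\<alpha> = - mu M (x, v) * ?a"
    using assms(11) \<eta>[of 1 "- II M \<Gamma> s"] unfolding p H_field_eq by simp
  then have \<eta>s: "\<eta> ?s = II M \<Gamma> s * ?b - mu M (x, v) * ?a"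
    by (simp add: \<eta>\<alpha>)
  fix \<xi> assume "\<xi> \<in> tangent_boundary_SM M (x, v)"
  then obtain a b where \<xi>: "\<xi> = (\<lambda>c. a *\<^sub>R ?s c + b *\<^sub>R ?\<alpha> c)"
    using fan_basis_spans unfolding p by blast
  have "fan_ds M \<Gamma> s \<alpha> \<xi> = a" "fan_dalpha M \<Gamma> s \<alpha> \<xi> = b"
    unfolding fan_ds_def fan_dalpha_def \<xi> fan_components_eq by simp_all
  then show "\<eta> \<xi> = (II M \<Gamma> s * ?b - mu M (x, v) * ?a) * fan_ds M \<Gamma> s \<alpha> \<xi> + ?b * fan_dalpha M \<Gamma> s \<alpha> \<xi>"
    unfolding \<xi> \<eta> by (simp add: \<eta>\<alpha> \<eta>s)
qed

end
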